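(* Let $\Omega$ be an admissible $\mathcal{C}^2$ domain in $\mathbf{D}\subset\mathbb{R}^N$ with boundary $\Gamma=\partial\Omega$, and let $z$ be a real-valued boundary function with $z(\Gamma)\in\mathcal{C}^2(\Gamma)$. If $z$ is shape differentiable at $\Gamma$ in the direction $\boldsymbol{V}\in\mathcal{C}([0,\epsilon],V^2(\mathbf{D}))$, then the boundary function $\nabla_\Gamma z$ is shape differentiable at $\Gamma$ in the direction $\boldsymbol{V}$, and $$(\nabla_\Gamma z)'(\Gamma,\boldsymbol{V})=\nabla_\Gamma z'(\Gamma,\boldsymbol{V})+\left(\boldsymbol{n}\otimes\nabla_\Gamma v_n-v_n D_\Gamma\boldsymbol{n}\right)\nabla_\Gamma z,$$ where $v_n=\boldsymbol{V}(0)\cdot\boldsymbol{n}$.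
   Context: Velocity method: $\mathbf{D}\subset\mathbb{R}^N$ is a fixed hold-all domain and $V^k(\mathbf{D})=\mathcal{C}^k_0(\mathbf{D},\mathbb{R}^N)$ is the set of $\mathcal{C}^k$ vector fields $f$ such that $D^\alpha f$ has compact support in $\mathbf{D}$ for $0\le|\alpha|\le k$. A velocity field $\boldsymbol{V}\in\mathcal{C}([0,\epsilon],V^k(\mathbf{D}))$ defines trajectories $x(t)$ by $\dot x(t)=\boldsymbol{V}(t)\circ x(t)$, $x(0)=\mathrm{id}$; put $\boldsymbol{v}=\boldsymbol{V}(0)$. A domain is an open bounded set $\Omega$, a boundary is $\Gamma=\partial\Omega$, $\boldsymbol{n}$ is its unit normal pointing outward of $\Omega$, and $\Gamma_t=x(t)(\Gamma)$. Tangential calculus: for $f$ scalar and $\boldsymbol{w}$ vector valued on $\Gamma$, with any $\mathcal{C}^1$ extensions $F$, $\boldsymbol{W}$ to a neighborhood of $\Gamma$, $\nabla_\Gamma f=(I-\boldsymbol{n}\otimes\boldsymbol{n})\nabla F|_\Gamma$ and $D_\Gamma\boldsymbol{w}=(D\boldsymbol{W}-D\boldsymbol{W}\boldsymbol{n}\otimes\boldsymbol{n})|_\Gamma$ (independent of the extension). Here $(\boldsymbol{a}\otimes\boldsymbol{b})\boldsymbol{c}=(\boldsymbol{b}\cdot\boldsymbol{c})\boldsymbol{a}$. Shape derivatives of boundary functions: a boundary function assigns to each admissible boundary $\Gamma$ (in particular to each $\Gamma_t$) a function $z(\Gamma)$ on $\Gamma$. If $z(\Gamma)\in\mathcal{C}^r(\Gamma)$,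 $1\le r\le k$, its material derivative is $\dot z(\Gamma,\boldsymbol{V})=\lim_{t\searrow0}\frac{z(\Gamma_t)\circ x(t)-z(\Gamma)}{t}$, the limit being taken in $\mathcal{C}^{r-1}(\Gamma)$; $z$ is shape differentiable at $\Gamma$ in the direction $\boldsymbol{V}$ if it exists, and the shape derivative is $z'(\Gamma,\boldsymbol{V})=\dot z(\Gamma,\boldsymbol{V})-\nabla_\Gamma z(\Gamma)\cdot\boldsymbol{v}$. For vector valued boundary functions, $\boldsymbol{w}'(\Gamma,\boldsymbol{V})=\dot{\boldsymbol{w}}(\Gamma,\boldsymbol{V})-D_\Gamma\boldsymbol{w}\,\boldsymbol{v}$, with the analogous material derivative. *)

theory Defs
  imports "HOL-Analysis.Analysis"
begin

section \<open>Functions of class \<open>C^k\<close>\<close>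

definition gradient :: "('a::euclidean_space \<Rightarrow> real) \<Rightarrow> 'a \<Rightarrow> 'a" where
  "gradient F X = (THE d. GDERIV F X :> d)"

text \<open>A multi-index derivative is given by a list of basis vectors.\<close>

primrec dpartial :: "'a::euclidean_space list \<Rightarrow> ('a \<Rightarrow> 'b::real_normed_vector) \<Rightarrow> 'a \<Rightarrow> 'b" where
  "dpartial [] f = f"
| "dpartial (b # bs) f = (\<lambda>X. frechet_derivative (dpartial bs f) (at X) b)"

text \<open>The set \<open>U\<close> is meant to be open.\<close>

definition Ck_on :: "nat \<Rightarrow> 'a::euclidean_space set \<Rightarrow> ('a \<Rightarrow> 'b::real_normed_vector) \<Rightarrow> bool" where
  "Ck_on k U f \<longleftrightarrow>
     (\<forall>bs. set bs \<subseteq> Basis \<longrightarrow>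
        (length bs < k \<longrightarrow> (\<forall>X\<in>U. dpartial bs f differentiable (at X))) \<and>
        (length bs \<le> k \<longrightarrow> continuous_on U (dpartial bs f)))"

section \<open>Velocity fields and trajectories\<close>

text \<open>Elements of \<open>V^k(D)\<close> are identified with their extensions by zero to the whole space.\<close>

definition Vspace :: "nat \<Rightarrow> 'a::euclidean_space set \<Rightarrow> ('a \<Rightarrow> 'a) set" where
  "Vspace k D = {f. Ck_on k UNIV f \<and>
     (\<forall>bs. set bs \<subseteq> Basis \<and> length bs \<le> k \<longrightarrow>
        compact (closure {X. dpartial bs f X \<noteq> 0}) \<and> closure {X. dpartial bs f X \<noteq> 0} \<subseteq> D)}"

text \<open>\<open>V \<in> C([0,\<epsilon>], V^k(D))\<close>, where \<open>V^k(D)\<close> carries the topology of uniform convergence of all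
  derivatives of order at most \<open>k\<close>. This is weaker than continuity for the inductive limit topology,
  which would in addition confine the supports of all \<open>V t\<close> to one compact subset of \<open>D\<close>.\<close>

definition velocity_field ::
    "nat \<Rightarrow> real \<Rightarrow> 'a::euclidean_space set \<Rightarrow> (real \<Rightarrow> 'a \<Rightarrow> 'a) \<Rightarrow> bool" where
  "velocity_field k \<epsilon> D V \<longleftrightarrow>
     (\<forall>t\<in>{0..\<epsilon>}. V t \<in> Vspace k D) \<and>
     (\<forall>t\<in>{0..\<epsilon>}. \<forall>bs. set bs \<subseteq> Basis \<and> length bs \<le> k \<longrightarrow>
        uniform_limit UNIV (\<lambda>s. dpartial bs (V s)) (dpartial bs (V t)) (at t within {0..\<epsilon>}))"

definition is_flow :: "real \<Rightarrow> (real \<Rightarrow> 'a::euclidean_space \<Rightarrow> 'a) \<Rightarrow> (real \<Rightarrow> 'a \<Rightarrow> 'a) \<Rightarrow> bool" where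
  "is_flow \<epsilon> V x \<longleftrightarrow>
     (\<forall>X. x 0 X = X) \<and>
     (\<forall>X. \<forall>t\<in>{0..\<epsilon>}. ((\<lambda>s. x s X) has_vector_derivative V t (x t X)) (at t within {0..\<epsilon>}))"

section \<open>Domains and unit normals\<close>

text \<open>Near each boundary point, a \<open>C^k\<close> domain is the negativity set of a \<open>C^k\<close> function with
  nonvanishing gradient; so the domain lies on one side of its boundary and the gradient points
  outward.\<close>

definition local_defining ::
    "nat \<Rightarrow> 'a::euclidean_space set \<Rightarrow> 'a \<Rightarrow> 'a set \<Rightarrow> ('a \<Rightarrow> real) \<Rightarrow> bool" where
  "local_defining k \<Omega> X U \<phi> \<longleftrightarrow>
     open U \<and> X \<in> U \<and> Ck_on k U \<phi> \<and> (\<forall>Y\<in>U. gradient \<phi> Y \<noteq> 0) \<and>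
     \<Omega> \<inter> U = {Y \<in> U. \<phi> Y < 0} \<and> frontier \<Omega> \<inter> U = {Y \<in> U. \<phi> Y = 0}"

text \<open>Bounded open sets of class \<open>C^k\<close> (\<open>k \<ge> 1\<close>), not necessarily connected.\<close>

definition Ck_domain :: "nat \<Rightarrow> 'a::euclidean_space set \<Rightarrow> bool" where
  "Ck_domain k \<Omega> \<longleftrightarrow>
     open \<Omega> \<and> bounded \<Omega> \<and> (\<forall>X\<in>frontier \<Omega>. \<exists>U \<phi>. local_defining k \<Omega> X U \<phi>)"

definition outward_normal :: "'a::euclidean_space set \<Rightarrow> 'a \<Rightarrow> 'a" where
  "outward_normal \<Omega> X = (THE n. \<exists>U \<phi>. local_defining 1 \<Omega> X U \<phi> \<and> n = sgn (gradient \<phi> X))"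

text \<open>A domain is determined by its boundary, because it is bounded and lies locally on one side of
  it; hence the choice below is immaterial. (The tangential operators do not even depend on the sign
  of the normal.) Asking only for class \<open>C^1\<close> covers the boundaries of all smoother domains.\<close>

definition enclosed_domain :: "'a::euclidean_space set \<Rightarrow> 'a set" where
  "enclosed_domain \<Gamma> = (SOME \<Omega>. Ck_domain 1 \<Omega> \<and> frontier \<Omega> = \<Gamma>)"

abbreviation normal :: "'a::euclidean_space set \<Rightarrow> 'a \<Rightarrow> 'a" where
  "normal \<Gamma> \<equiv> outward_normal (enclosed_domain \<Gamma>)"

section \<open>Tangential calculus on a boundary \<open>\<Gamma>\<close>\<close>

text \<open>A function on \<open>\<Gamma>\<close> is represented by a total function whose values off \<open>\<Gamma>\<close> are irrelevant.\<close>

definition Ck_extension ::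
    "nat \<Rightarrow> 'a::euclidean_space set \<Rightarrow> ('a \<Rightarrow> 'b::real_normed_vector) \<Rightarrow> ('a \<Rightarrow> 'b) \<Rightarrow> bool" where
  "Ck_extension k \<Gamma> f F \<longleftrightarrow> (\<exists>U. open U \<and> \<Gamma> \<subseteq> U \<and> Ck_on k U F) \<and> (\<forall>X\<in>\<Gamma>. F X = f X)"

definition Ck_boundary ::
    "nat \<Rightarrow> 'a::euclidean_space set \<Rightarrow> ('a \<Rightarrow> 'b::real_normed_vector) \<Rightarrow> bool" where
  "Ck_boundary k \<Gamma> f \<longleftrightarrow> (\<exists>F. Ck_extension k \<Gamma> f F)"

definition outer :: "'a::real_inner \<Rightarrow> 'a \<Rightarrow> 'a \<Rightarrow> 'a" where
  "outer a b = (\<lambda>c. (b \<bullet> c) *\<^sub>R a)"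

definition tgrad :: "'a::euclidean_space set \<Rightarrow> ('a \<Rightarrow> real) \<Rightarrow> 'a \<Rightarrow> 'a" where
  "tgrad \<Gamma> f X =
     (let F = (SOME F. Ck_extension 1 \<Gamma> f F); n = normal \<Gamma> X
      in gradient F X - outer n n (gradient F X))"

text \<open>\<open>tderiv \<Gamma> w X\<close> is the linear map \<open>D\<^sub>\<Gamma> w = DW - (DW n) \<otimes> n\<close> at \<open>X\<close>.\<close>

definition tderiv ::
    "'a::euclidean_space set \<Rightarrow> ('a \<Rightarrow> 'b::real_normed_vector) \<Rightarrow> 'a \<Rightarrow> 'a \<Rightarrow> 'b" where
  "tderiv \<Gamma> w X h =
     (let W = (SOME W. Ck_extension 1 \<Gamma> w W); n = normal \<Gamma> X; DW = frechet_derivative W (at X)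
      in DW h - (n \<bullet> h) *\<^sub>R DW n)"

primrec tpartial ::
    "'a::euclidean_space set \<Rightarrow> 'a list \<Rightarrow> ('a \<Rightarrow> 'b::real_normed_vector) \<Rightarrow> 'a \<Rightarrow> 'b" where
  "tpartial \<Gamma> [] f = f"
| "tpartial \<Gamma> (b # bs) f = (\<lambda>X. tderiv \<Gamma> (tpartial \<Gamma> bs f) X b)"

text \<open>Convergence in \<open>C^m(\<Gamma>)\<close>: all functions involved are of class \<open>C^m\<close>, and all tangential
  derivatives of order at most \<open>m\<close> converge uniformly on \<open>\<Gamma>\<close>.\<close>

definition Ck_limit ::
    "nat \<Rightarrow> 'a::euclidean_space set \<Rightarrow> (real \<Rightarrow> 'a \<Rightarrow> 'b::real_normed_vector) \<Rightarrow> ('a \<Rightarrow> 'b) \<Rightarrow>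
      real filter \<Rightarrow> bool" where
  "Ck_limit m \<Gamma> f g \<F> \<longleftrightarrow>
     (\<forall>\<^sub>F t in \<F>. Ck_boundary m \<Gamma> (f t)) \<and> Ck_boundary m \<Gamma> g \<and>
     (\<forall>bs. set bs \<subseteq> Basis \<and> length bs \<le> m \<longrightarrow>
        uniform_limit \<Gamma> (\<lambda>t. tpartial \<Gamma> bs (f t)) (tpartial \<Gamma> bs g) \<F>)"

section \<open>Material and shape derivatives of boundary functions\<close>

text \<open>A boundary function \<open>z\<close> maps a boundary \<open>\<Gamma>\<close> to a function \<open>z \<Gamma>\<close> on \<open>\<Gamma>\<close>. The parameter \<open>x\<close> is the
  flow of the velocity field, \<open>v\<close> its initial value \<open>V 0\<close>, and \<open>r\<close> the smoothness class of \<open>z \<Gamma>\<close>.\<close>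

definition has_material_derivative ::
    "nat \<Rightarrow> ('a::euclidean_space set \<Rightarrow> 'a \<Rightarrow> 'b::real_normed_vector) \<Rightarrow> 'a set \<Rightarrow>
      (real \<Rightarrow> 'a \<Rightarrow> 'a) \<Rightarrow> ('a \<Rightarrow> 'b) \<Rightarrow> bool" where
  "has_material_derivative r z \<Gamma> x zdot \<longleftrightarrow>
     1 \<le> r \<and> Ck_boundary r \<Gamma> (z \<Gamma>) \<and>
     Ck_limit (r - 1) \<Gamma> (\<lambda>t X. (z (x t ` \<Gamma>) (x t X) - z \<Gamma> X) /\<^sub>R t) zdot (at_right 0)"

definition has_shape_derivative ::
    "nat \<Rightarrow> ('a::euclidean_space set \<Rightarrow> 'a \<Rightarrow> real) \<Rightarrow> 'a set \<Rightarrow>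
      (real \<Rightarrow> 'a \<Rightarrow> 'a) \<Rightarrow> ('a \<Rightarrow> 'a) \<Rightarrow> ('a \<Rightarrow> real) \<Rightarrow> bool" where
  "has_shape_derivative r z \<Gamma> x v z' \<longleftrightarrow>
     (\<exists>zdot. has_material_derivative r z \<Gamma> x zdot \<and>
        (\<forall>X\<in>\<Gamma>. z' X = zdot X - tgrad \<Gamma> (z \<Gamma>) X \<bullet> v X))"

definition has_shape_derivative_vec ::
    "nat \<Rightarrow> ('a::euclidean_space set \<Rightarrow> 'a \<Rightarrow> 'a) \<Rightarrow> 'a set \<Rightarrow>
      (real \<Rightarrow> 'a \<Rightarrow> 'a) \<Rightarrow> ('a \<Rightarrow> 'a) \<Rightarrow> ('a \<Rightarrow> 'a) \<Rightarrow> bool" where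
  "has_shape_derivative_vec r w \<Gamma> x v w' \<longleftrightarrow>
     (\<exists>wdot. has_material_derivative r w \<Gamma> x wdot \<and>
        (\<forall>X\<in>\<Gamma>. w' X = wdot X - tderiv \<Gamma> (w \<Gamma>) X (v X)))"

end

theory Submission
  imports Defs
begin

text \<open>Write \<open>T\<close> for the flow at a small time \<open>t\<close>, \<open>n\<close> for the unit normal of \<open>\<Gamma>\<close>, \<open>g\<close> for the tangential gradient of
\<open>z(\<Gamma>)\<close>, and \<open>P\<close> for the orthogonal projection onto the tangent space. Everything rests on one formula for a
function \<open>f\<close> on the moved boundary \<open>T(\<Gamma>)\<close>: by the chain rule, both the gradient of an extension of \<open>f\<close> and the
gradient of a defining function of the domain are transported by \<open>B\<close>, the adjoint of the inverse of
\<open>DT\<close>. Hence the tangential gradient of \<open>f\<close> at \<open>T(X)\<close> is the part of \<open>B \<nabla>\<^sub>\<Gamma>(f \<circ> T)\<close> orthogonal to \<open>B n\<close>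
(\<open>tgrad_image\<close>); the normal component of the gradient has dropped out.

For the material derivative, put \<open>f = z(T(\<Gamma>))\<close>. By hypothesis
\<open>f \<circ> T = z(\<Gamma>) + t q\<^sub>t\<close> with \<open>q\<^sub>t\<close> converging in \<open>C\<^sup>1(\<Gamma>)\<close> to the material derivative \<open>q\<close> of \<open>z\<close>, and
\<open>B = I - t E + o(t)\<close> uniformly, where \<open>E\<close> is the adjoint of \<open>DV(0)\<close>. Differentiating the formula at \<open>t = 0\<close>
gives the material derivative
\<open>\<nabla>\<^sub>\<Gamma>q - P E g + (E n \<bullet> g) n\<close> of \<open>\<nabla>\<^sub>\<Gamma>z\<close> (\<open>tangential_transport_limit\<close>).

The expansion of \<open>B\<close> needs the flow to be continuously differentiable in space, with derivative
\<open>I + t DV(0) + o(t)\<close> uniformly. For short times this follows from an elementary bound of Gronwall type: the linearised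
equation is solved by Banach's fixed point theorem, and its solution is compared with difference quotients of the
flow (\<open>flow_derivative\<close>). Since \<open>DT\<close> is then close to the identity, \<open>T\<close> is a diffeomorphism of the whole space
(\<open>near_identity_diffeomorphism\<close>), so \<open>T(\<Gamma>)\<close> again bounds a domain of class \<open>C\<^sup>1\<close>.

It remains to turn the material derivative into the claimed shape derivative. The product rule for
\<open>z' = q - g \<bullet> v\<close> brings in the adjoint of \<open>D\<^sub>\<Gamma>g\<close> applied to \<open>v\<close>, whereas the definition of the shape
derivative of \<open>g\<close> contains \<open>D\<^sub>\<Gamma>g v\<close> itself. The difference of the two is
\<open>(v \<bullet> D\<^sub>\<Gamma>n g) n - (v \<bullet> n) D\<^sub>\<Gamma>n g\<close> (\<open>tderiv_tgrad_antisymmetric_part\<close>); this is where the symmetry of second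
derivatives and of \<open>D\<^sub>\<Gamma>n\<close> enters.

Two points of rigour run through the argument. The tangential operators are defined by a chosen extension and by the
normal of a chosen enclosed domain. They are independent of both choices, because a differentiable function vanishing
on \<open>\<Gamma>\<close> has a derivative that vanishes on tangent vectors (\<open>derivative_vanishes_on_tangent\<close>): applied to a
difference of extensions this gives the first independence, applied to a second defining function it shows that
normals are determined up to sign, which the operators do not see. And extensions found near each point are glued
to extensions near the whole of \<open>\<Gamma>\<close> by a partition of unity (\<open>Ck_boundary_1_local\<close>).\<close>

section \<open>Calculus of continuously differentiable functions\<close>

text \<open>The derivative takes values in the normed space of bounded linear maps. Continuity in the operator norm is what the chain
and product rules need, whereas \<open>Ck_on\<close> only speaks of partial derivatives; the two agree by \<open>Ck_on_1_iff\<close>.\<close>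

definition has_C1_derivative ::
    "'a::euclidean_space set \<Rightarrow> ('a \<Rightarrow> 'b::real_normed_vector) \<Rightarrow> ('a \<Rightarrow> 'a \<Rightarrow>\<^sub>L 'b) \<Rightarrow> bool" where
  "has_C1_derivative U f f' \<longleftrightarrow>
     (\<forall>X\<in>U. (f has_derivative blinfun_apply (f' X)) (at X)) \<and> continuous_on U f'"

lemma has_C1_derivativeI:
  assumes "\<And>X. X \<in> U \<Longrightarrow> (f has_derivative blinfun_apply (f' X)) (at X)" "continuous_on U f'"
  shows "has_C1_derivative U f f'"
  using assms by (simp add: has_C1_derivative_def)

lemma has_C1_derivativeD:
  assumes "has_C1_derivative U f f'"
  shows "X \<in> U \<Longrightarrow> (f has_derivative blinfun_apply (f' X)) (at X)" "continuous_on U f'"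
  using assms by (auto simp: has_C1_derivative_def)

lemma blinfun_apply_Blinfun_frechet:
  assumes "f differentiable (at X)"
  shows "blinfun_apply (Blinfun (frechet_derivative f (at X))) = frechet_derivative f (at X)"
  using assms by (intro bounded_linear_Blinfun_apply has_derivative_bounded_linear[OF iffD1[OF frechet_derivative_works]])

lemma Ck_on_0: "Ck_on 0 U f \<longleftrightarrow> continuous_on U f"
  by (simp add: Ck_on_def)

lemma Ck_on_mono:
  assumes "Ck_on k U f" "j \<le> k" "W \<subseteq> U"
  shows "Ck_on j W f"
  using assms unfolding Ck_on_def by (meson continuous_on_subset le_trans less_le_trans subsetD)

lemma Ck_on_1_canonical:
  assumes "Ck_on 1 U f"
  shows "has_C1_derivative U f (\<lambda>X. Blinfun (frechet_derivative f (at X)))"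
proof (rule has_C1_derivativeI)
  have d: "f differentiable (at X)" if "X \<in> U" for X
    using assms[unfolded Ck_on_def, rule_format, of "[]"] that by simp
  then show "(f has_derivative blinfun_apply (Blinfun (frechet_derivative f (at X)))) (at X)"
    if "X \<in> U" for X using that
    by (simp add: blinfun_apply_Blinfun_frechet frechet_derivative_works)
  have "continuous_on U (\<lambda>X. frechet_derivative f (at X) b)" if "b \<in> Basis" for b
    using assms[unfolded Ck_on_def, rule_format, of "[b]"] that by simp
  then have "continuous_on U (\<lambda>X. blinfun_apply (Blinfun (frechet_derivative f (at X))) b)"
    if "b \<in> Basis" for b using that
    by (subst continuous_on_cong[OF refl]) (auto simp: blinfun_apply_Blinfun_frechet d)
  then show "continuous_on U (\<lambda>X. Blinfun (frechet_derivative f (at X)))"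
    by (intro continuous_on_blinfun_componentwise)
qed

lemma Ck_on_1_iff: "Ck_on 1 U f \<longleftrightarrow> (\<exists>f'. has_C1_derivative U f f')"
proof
  assume "\<exists>f'. has_C1_derivative U f f'"
  then obtain f' where f': "has_C1_derivative U f f'" by blast
  note d = has_C1_derivativeD[OF f']
  have fr: "frechet_derivative f (at X) = blinfun_apply (f' X)" if "X \<in> U" for X
    using frechet_derivative_at[OF d(1)[OF that]] by simp
  have c: "continuous_on U f"
    using d(1) by (meson continuous_at_imp_continuous_on has_derivative_continuous)
  have cb: "continuous_on U (\<lambda>X. frechet_derivative f (at X) b)" for b
    by (subst continuous_on_cong[OF refl fr[THEN fun_cong]])
       (auto intro!: continuous_intros d(2))
  show "Ck_on 1 U f"
    unfolding Ck_on_def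
  proof (intro allI impI conjI)
    fix bs :: "'a list" assume bs: "set bs \<subseteq> Basis"
    show "\<forall>X\<in>U. dpartial bs f differentiable at X" if "length bs < 1"
      using that d(1) by (auto simp: differentiable_def)
    show "continuous_on U (dpartial bs f)" if "length bs \<le> 1"
      using that c cb by (cases bs) auto
  qed
qed (use Ck_on_1_canonical in blast)

lemma Ck_on_1I: "has_C1_derivative U f f' \<Longrightarrow> Ck_on 1 U f"
  using Ck_on_1_iff by blast

lemma Ck_on_1_derivI:
  assumes "\<And>X. X \<in> U \<Longrightarrow> (f has_derivative blinfun_apply (f' X)) (at X)" "continuous_on U f'"
  shows "Ck_on 1 U f"
  using assms by (intro Ck_on_1I has_C1_derivativeI)

lemma Ck_on_1E:
  assumes "Ck_on 1 U f" obtains f' where "has_C1_derivative U f f'"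
  using assms Ck_on_1_iff by blast

lemma Ck_on_1_continuous:
  assumes "Ck_on 1 U f" shows "continuous_on U f"
  using Ck_on_mono[OF assms, of 0] by (simp add: Ck_on_0)

lemma Ck_on_1_cong:
  assumes "Ck_on 1 U f" "open U" "\<And>X. X \<in> U \<Longrightarrow> f X = g X"
  shows "Ck_on 1 U g"
proof -
  obtain f' where f': "has_C1_derivative U f f'" using assms(1) by (rule Ck_on_1E)
  have "(g has_derivative f' X) (at X)" if "X \<in> U" for X
    by (rule has_derivative_transform_within_open[OF has_C1_derivativeD(1)[OF f' that] assms(2) that])
       (use assms(3) in auto)
  then show ?thesis
    using has_C1_derivativeD(2)[OF f'] by (rule Ck_on_1_derivI)
qed

lemma Ck_on_1_Un:
  assumes "Ck_on 1 U f" "Ck_on 1 W f" "open U" "open W"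
  shows "Ck_on 1 (U \<union> W) f"
  using Ck_on_1_canonical[OF assms(1)] Ck_on_1_canonical[OF assms(2)] assms(3,4)
  by (intro Ck_on_1I[of _ _ "\<lambda>X. Blinfun (frechet_derivative f (at X))"])
     (auto simp: has_C1_derivative_def intro: continuous_on_open_Un)

lemma Ck_on_1_const: "Ck_on 1 U (\<lambda>X. c)"
  by (rule Ck_on_1I[of _ _ "\<lambda>_. 0"]) (auto simp: has_C1_derivative_def zero_blinfun.rep_eq)

lemma Ck_on_1_id: "Ck_on 1 U (\<lambda>X. X)"
  by (rule Ck_on_1I[of _ _ "\<lambda>_. id_blinfun"]) (auto simp: has_C1_derivative_def id_def)

lemma Ck_on_1_compose:
  assumes "Ck_on 1 U f" "Ck_on 1 W g" "f ` U \<subseteq> W"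
  shows "Ck_on 1 U (\<lambda>X. g (f X))"
proof -
  obtain f' where f': "has_C1_derivative U f f'" using assms(1) by (rule Ck_on_1E)
  obtain g' where g': "has_C1_derivative W g g'" using assms(2) by (rule Ck_on_1E)
  have "((\<lambda>X. g (f X)) has_derivative (g' (f X) o\<^sub>L f' X)) (at X)" if "X \<in> U" for X
    using diff_chain_at[OF has_C1_derivativeD(1)[OF f' that] has_C1_derivativeD(1)[OF g', of "f X"]]
      assms(3) that by (simp add: blinfun_compose.rep_eq image_subset_iff comp_def)
  moreover have "continuous_on U (\<lambda>X. g' (f X) o\<^sub>L f' X)"
    by (intro continuous_intros has_C1_derivativeD(2)[OF f']
        continuous_on_compose2[OF has_C1_derivativeD(2)[OF g'] Ck_on_1_continuous[OF assms(1)] assms(3)])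
  ultimately show ?thesis
    by (rule Ck_on_1_derivI)
qed

lemma Ck_on_1_bounded_linear:
  assumes "bounded_linear L" "Ck_on 1 U f"
  shows "Ck_on 1 U (\<lambda>X. L (f X))"
proof -
  obtain f' where f': "has_C1_derivative U f f'" using assms(2) by (rule Ck_on_1E)
  have L: "blinfun_apply (Blinfun L) = L" by (simp add: bounded_linear_Blinfun_apply assms)
  have "((\<lambda>X. L (f X)) has_derivative (Blinfun L o\<^sub>L f' X)) (at X)" if "X \<in> U" for X
    using bounded_linear.has_derivative[OF assms(1) has_C1_derivativeD(1)[OF f' that]]
    by (simp add: L blinfun_compose.rep_eq comp_def)
  moreover have "continuous_on U (\<lambda>X. Blinfun L o\<^sub>L f' X)"
    by (intro continuous_intros has_C1_derivativeD(2)[OF f'])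
  ultimately show ?thesis
    by (rule Ck_on_1_derivI)
qed

lemma Ck_on_1_add:
  assumes "Ck_on 1 U f" "Ck_on 1 U g"
  shows "Ck_on 1 U (\<lambda>X. f X + g X)"
proof -
  obtain f' where f': "has_C1_derivative U f f'" using assms(1) by (rule Ck_on_1E)
  obtain g' where g': "has_C1_derivative U g g'" using assms(2) by (rule Ck_on_1E)
  have "((\<lambda>X. f X + g X) has_derivative (f' X + g' X)) (at X)" if "X \<in> U" for X
    using has_derivative_add[OF has_C1_derivativeD(1)[OF f' that] has_C1_derivativeD(1)[OF g' that]]
    by (simp add: plus_blinfun.rep_eq)
  moreover have "continuous_on U (\<lambda>X. f' X + g' X)"
    by (intro continuous_intros has_C1_derivativeD(2)[OF f'] has_C1_derivativeD(2)[OF g'])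
  ultimately show ?thesis
    by (rule Ck_on_1_derivI)
qed

lemma Ck_on_1_bilinear:
  assumes "bounded_bilinear p" "Ck_on 1 U f" "Ck_on 1 U g"
  shows "Ck_on 1 U (\<lambda>X. p (f X) (g X))"
proof -
  interpret p: bounded_bilinear p by fact
  obtain f' where f': "has_C1_derivative U f f'" using assms(2) by (rule Ck_on_1E)
  obtain g' where g': "has_C1_derivative U g g'" using assms(3) by (rule Ck_on_1E)
  let ?L = "\<lambda>y. Blinfun (\<lambda>a. p a y)" and ?R = "\<lambda>a. Blinfun (p a)"
  let ?D = "\<lambda>X. (?R (f X) o\<^sub>L g' X) + (?L (g X) o\<^sub>L f' X)"
  have L: "blinfun_apply (?L y) = (\<lambda>a. p a y)" and R: "blinfun_apply (?R a) = p a" for a y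
    by (simp_all add: bounded_linear_Blinfun_apply p.bounded_linear_left p.bounded_linear_right)
  obtain K where K: "\<And>a b. norm (p a b) \<le> norm a * norm b * K" "K \<ge> 0"
    using p.nonneg_bounded by blast
  have bL: "bounded_linear ?L"
  proof (rule bounded_linear_intro[of _ K])
    show "norm (?L y) \<le> norm y * K" for y
      by (rule norm_blinfun_bound) (use K in \<open>auto simp: L mult_ac\<close>)
  qed (auto intro!: blinfun_eqI simp: L plus_blinfun.rep_eq scaleR_blinfun.rep_eq 
      p.add_right[symmetric] p.scaleR_right[symmetric])
  have bR: "bounded_linear ?R"
  proof (rule bounded_linear_intro[of _ K])
    show "norm (?R a) \<le> norm a * K" for a
      by (rule norm_blinfun_bound) (use K in \<open>auto simp: R mult_ac\<close>)
  qed (auto intro!: blinfun_eqI simp: R plus_blinfun.rep_eq scaleR_blinfun.rep_eq p.add_left p.scaleR_left)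
  have "((\<lambda>X. p (f X) (g X)) has_derivative ?D X) (at X)" if "X \<in> U" for X
    using p.FDERIV[OF has_C1_derivativeD(1)[OF f' that] has_C1_derivativeD(1)[OF g' that]]
    by (simp add: plus_blinfun.rep_eq blinfun_compose.rep_eq comp_def L R)
  moreover have "continuous_on U ?D"
    by (intro continuous_intros has_C1_derivativeD(2)[OF f'] has_C1_derivativeD(2)[OF g']
        bounded_linear.continuous_on[OF bL] bounded_linear.continuous_on[OF bR]
        Ck_on_1_continuous assms)
  ultimately show ?thesis
    by (rule Ck_on_1_derivI)
qed

lemmas Ck_on_1_scaleR = Ck_on_1_bilinear[OF bounded_bilinear_scaleR]
  and Ck_on_1_inner = Ck_on_1_bilinear[OF bounded_bilinear_inner]

lemma Ck_on_1_diff: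
  assumes "Ck_on 1 U f" "Ck_on 1 U g"
  shows "Ck_on 1 U (\<lambda>X. f X - g X)"
  using Ck_on_1_add[OF assms(1) Ck_on_1_bounded_linear[OF bounded_linear_minus[OF bounded_linear_ident] assms(2)]]
  by simp

lemma Ck_on_1_sum:
  assumes "\<And>i. i \<in> I \<Longrightarrow> Ck_on 1 U (f i)"
  shows "Ck_on 1 U (\<lambda>X. \<Sum>i\<in>I. f i X)"
  using assms
  by (induction I rule: infinite_finite_induct)
     (simp_all add: Ck_on_1_const[simplified] Ck_on_1_add[simplified])

lemma Ck_on_1_field_derivative:
  fixes g :: "real \<Rightarrow> real"
  assumes "\<And>s. s \<in> W \<Longrightarrow> (g has_real_derivative g' s) (at s)" "continuous_on W g'"
  shows "Ck_on 1 W g"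
  by (rule Ck_on_1I[of _ _ "\<lambda>s. blinfun_mult_right (g' s)"])
     (use assms in \<open>auto intro!: has_C1_derivativeI continuous_intros simp: has_field_derivative_def\<close>)

lemma Ck_on_1_inverse:
  assumes "Ck_on 1 U f" "\<And>X. X \<in> U \<Longrightarrow> f X \<noteq> (0::real)"
  shows "Ck_on 1 U (\<lambda>X. inverse (f X))"
proof (rule Ck_on_1_compose[OF assms(1), of "- {0}"])
  show "Ck_on 1 (- {0}) (inverse :: real \<Rightarrow> real)"
    by (rule Ck_on_1_field_derivative[where g' = "\<lambda>s. - (inverse s ^ 2)"])
       (auto intro!: derivative_eq_intros continuous_intros simp: power2_eq_square)
qed (use assms in auto)

lemma Ck_on_1_sgn:
  assumes "Ck_on 1 U f" "\<And>X. X \<in> U \<Longrightarrow> f X \<noteq> (0::'b::euclidean_space)"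
  shows "Ck_on 1 U (\<lambda>X. sgn (f X))"
proof -
  have "Ck_on 1 U (\<lambda>X. sqrt (f X \<bullet> f X))"
  proof (rule Ck_on_1_compose[OF Ck_on_1_inner[OF assms(1,1)], of "{0<..}"])
    show "Ck_on 1 {0<..} sqrt"
      by (rule Ck_on_1_field_derivative[where g' = "\<lambda>s. inverse (sqrt s) / 2"])
         (auto intro!: derivative_eq_intros continuous_intros)
  qed (use assms in auto)
  then show ?thesis
    unfolding sgn_div_norm norm_eq_sqrt_inner
    by (intro Ck_on_1_scaleR Ck_on_1_inverse assms(1)) (use assms(2) in auto)
qed

text \<open>Reduces class \<open>C\<^sup>2\<close> to class \<open>C\<^sup>1\<close> of the derivative. The derivative is assembled from its columns, the partial
derivatives, by constant linear maps, so it inherits their regularity.\<close>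

lemma Ck_on_2E:
  fixes f :: "'a::euclidean_space \<Rightarrow> 'b::real_normed_vector"
  assumes "Ck_on 2 U f" "open U"
  obtains f' where "has_C1_derivative U f f'" "Ck_on 1 U f'"
proof
  let ?f' = "\<lambda>X. Blinfun (frechet_derivative f (at X))"
  show f': "has_C1_derivative U f ?f'"
    using Ck_on_mono[OF assms(1), of 1 U] Ck_on_1_canonical by auto
  \<comment> \<open>\<open>?L b y\<close> is the rank-one map \<open>h \<mapsto> (h \<bullet> b) y\<close>, so the sum over the basis rebuilds a linear map from its columns.\<close>
  let ?L = "\<lambda>b y. blinfun_scaleR_left y o\<^sub>L blinfun_inner_left b"
  have eq: "(\<Sum>b\<in>Basis. ?L b (frechet_derivative f (at X) b)) = ?f' X" if "X \<in> U" for X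
  proof (rule blinfun_euclidean_eqI)
    fix i :: 'a assume i: "i \<in> Basis"
    have "f differentiable at X"
      using has_C1_derivativeD(1)[OF f' that] by (auto simp: differentiable_def)
    note [simp] = blinfun_apply_Blinfun_frechet[OF this]
    show "(\<Sum>b\<in>Basis. ?L b (frechet_derivative f (at X) b)) i = ?f' X i"
      using i by (simp add: blinfun.sum_left inner_Basis if_distrib[where f="\<lambda>r. r *\<^sub>R _"] cong: if_cong)
  qed
  have "Ck_on 1 U (\<lambda>X. frechet_derivative f (at X) b)" if b: "b \<in> Basis" for b
    unfolding Ck_on_def
  proof (intro allI impI)
    fix bs :: "'a list" assume bs: "set bs \<subseteq> Basis"
    have "dpartial bs (\<lambda>X. frechet_derivative f (at X) b) = dpartial (bs @ [b]) f"
      by (induction bs) auto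
    then show "(length bs < 1 \<longrightarrow> (\<forall>X\<in>U. dpartial bs (\<lambda>X. frechet_derivative f (at X) b) differentiable at X)) \<and>
      (length bs \<le> 1 \<longrightarrow> continuous_on U (dpartial bs (\<lambda>X. frechet_derivative f (at X) b)))"
      using assms(1)[unfolded Ck_on_def, rule_format, of "bs @ [b]"] bs b by auto
  qed
  moreover have "bounded_linear (?L b)" for b :: 'a
    by (intro bounded_linear_intros)
  ultimately have "Ck_on 1 U (\<lambda>X. \<Sum>b\<in>Basis. ?L b (frechet_derivative f (at X) b))"
    by (intro Ck_on_1_sum) (rule Ck_on_1_bounded_linear)
  then show "Ck_on 1 U ?f'"
    by (rule Ck_on_1_cong[OF _ assms(2) eq])
qed

section \<open>Symmetry of second derivatives\<close>

text \<open>The second difference over the parallelogram spanned by \<open>s h\<close> and \<open>s k\<close> is symmetric in \<open>h\<close> and \<open>k\<close>. The mean value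
theorem in the direction \<open>h\<close> turns it into an increment of \<open>f' h\<close> in the direction \<open>s k\<close>, so after division by \<open>s\<^sup>2\<close> its limit is a mixed second
derivative; exchanging \<open>h\<close> and \<open>k\<close> then yields the symmetry.\<close>

lemma second_difference_quotient:
  fixes f :: "'a::real_normed_vector \<Rightarrow> real"
  assumes "open U" "X \<in> U"
    and f: "\<And>Y. Y \<in> U \<Longrightarrow> (f has_derivative f' Y) (at Y)"
    and f'': "((\<lambda>Y. f' Y h) has_derivative g) (at X)"
  shows "((\<lambda>s. (f (X + s *\<^sub>R h + s *\<^sub>R k) - f (X + s *\<^sub>R h) - f (X + s *\<^sub>R k) + f X) / s\<^sup>2) \<longlongrightarrow> g k)
           (at_right 0)"
proof (rule tendstoI)
  fix e :: real assume e: "e > 0"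
  define C where "C = 2 * (norm h + norm k) + 1"
  have C: "C > 0" "C \<ge> 1" by (simp_all add: C_def add_nonneg_pos)
  have hkC: "norm h + norm k < C"
    using norm_ge_zero[of h] norm_ge_zero[of k] unfolding C_def by argo
  interpret g: bounded_linear g using f'' by (rule has_derivative_bounded_linear)
  have "e / (2 * C) > 0" using e C by simp
  then obtain d where d: "d > 0"
    "\<And>Y. norm (Y - X) < d \<Longrightarrow> norm (f' Y h - f' X h - g (Y - X)) \<le> e / (2 * C) * norm (Y - X)"
    using f'' unfolding has_derivative_at_alt by meson
  obtain r where r: "r > 0" "ball X r \<subseteq> U" using assms(1,2) openE by blast
  define s0 where "s0 = min d r / C"
  have s0: "s0 > 0" using d(1) r(1) C by (simp add: s0_def)
  have "\<bar>(f (X + s *\<^sub>R h + s *\<^sub>R k) - f (X + s *\<^sub>R h) - f (X + s *\<^sub>R k) + f X) / s\<^sup>2 - g k\<bar> < e"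
    if s: "0 < s" "s < s0" for s
  proof -
    have "s * C < min d r"
      using s(2) pos_less_divide_eq[OF C(1), of s "min d r"] by (simp only: s0_def)
    then have sC: "s * C < d" "s * C < r" by simp_all
    have near: "norm (a *\<^sub>R h + b *\<^sub>R k) < s * C" if "0 \<le> a" "a \<le> s" "0 \<le> b" "b \<le> s" for a b
    proof -
      have "norm (a *\<^sub>R h + b *\<^sub>R k) \<le> a * norm h + b * norm k"
        using norm_triangle_ineq[of "a *\<^sub>R h" "b *\<^sub>R k"] that by simp
      also have "\<dots> \<le> s * norm h + s * norm k" using that by (intro add_mono mult_right_mono) auto
      also have "\<dots> = s * (norm h + norm k)" by (rule distrib_left[symmetric])
      also have "\<dots> < s * C"
        by (rule mult_strict_left_mono[OF hkC s(1)])
      finally show ?thesis .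
    qed
    have inU: "X + (a *\<^sub>R h + b *\<^sub>R k) \<in> U" if "0 \<le> a" "a \<le> s" "0 \<le> b" "b \<le> s" for a b
    proof -
      have "dist (X + (a *\<^sub>R h + b *\<^sub>R k)) X < r"
        using near[OF that] sC(2) by (simp add: dist_norm)
      then show ?thesis using r(2) by (auto simp: subset_iff dist_commute)
    qed
    define G where "G a = f (X + (a *\<^sub>R h + s *\<^sub>R k)) - f (X + a *\<^sub>R h)" for a
    have dG: "(G has_real_derivative
        f' (X + (a *\<^sub>R h + s *\<^sub>R k)) h - f' (X + (a *\<^sub>R h + 0 *\<^sub>R k)) h) (at a)"
      if "0 \<le> a" "a \<le> s" for a
    proof -
      have 1: "X + (a *\<^sub>R h + s *\<^sub>R k) \<in> U" "X + (a *\<^sub>R h + 0 *\<^sub>R k) \<in> U"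
        using inU[of a s] inU[of a 0] that s by simp_all
      have lin: "linear (f' Y)" if "Y \<in> U" for Y
        using f[OF that] has_derivative_linear by blast
      have "((\<lambda>a. X + (a *\<^sub>R h + b *\<^sub>R k)) has_derivative (\<lambda>t. t *\<^sub>R h)) (at a)" for b
        by (auto intro!: derivative_eq_intros)
      from has_derivative_compose[OF this f[OF 1(1)]] has_derivative_compose[OF this f[OF 1(2)]]
      have "(G has_derivative (\<lambda>t. f' (X + (a *\<^sub>R h + s *\<^sub>R k)) (t *\<^sub>R h)
               - f' (X + (a *\<^sub>R h + 0 *\<^sub>R k)) (t *\<^sub>R h))) (at a)"
        unfolding G_def by (auto intro!: has_derivative_diff)
      then show ?thesis
        using lin[OF 1(1)] lin[OF 1(2)]
        unfolding has_field_derivative_def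
        by (elim has_derivative_eq_rhs) (simp add: linear_scale algebra_simps fun_eq_iff)
    qed
    have "\<exists>a>0. a < s \<and> G s - G 0 = (s - 0) *
       (f' (X + (a *\<^sub>R h + s *\<^sub>R k)) h - f' (X + (a *\<^sub>R h + 0 *\<^sub>R k)) h)"
      by (rule MVT2[OF s(1) dG]) auto
    then obtain a where a: "0 < a" "a < s" and mvt: "G s - G 0 = s *
       (f' (X + (a *\<^sub>R h + s *\<^sub>R k)) h - f' (X + (a *\<^sub>R h + 0 *\<^sub>R k)) h)" by auto
    define E where "E Y = f' Y h - f' X h - g (Y - X)" for Y
    have E: "\<bar>E (X + (a *\<^sub>R h + b *\<^sub>R k))\<bar> < s * e / 2" if "0 \<le> b" "b \<le> s" for b
    proof -
      have n: "norm (a *\<^sub>R h + b *\<^sub>R k) < s * C" using near[of a b] a that by simp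
      then have "\<bar>E (X + (a *\<^sub>R h + b *\<^sub>R k))\<bar> \<le> e / (2 * C) * norm (a *\<^sub>R h + b *\<^sub>R k)"
        using d(2)[of "X + (a *\<^sub>R h + b *\<^sub>R k)"] sC by (simp add: E_def)
      also have "\<dots> < e / (2 * C) * (s * C)"
        using e C by (intro mult_strict_left_mono n) auto
      finally show ?thesis using C by (simp add: mult.commute)
    qed
    have "f' (X + (a *\<^sub>R h + s *\<^sub>R k)) h - f' (X + (a *\<^sub>R h + 0 *\<^sub>R k)) h
       = s * g k + E (X + (a *\<^sub>R h + s *\<^sub>R k)) - E (X + (a *\<^sub>R h + 0 *\<^sub>R k))"
      by (simp add: E_def g.add g.scaleR)
    then have "G s - G 0 = s\<^sup>2 * g k + s * (E (X + (a *\<^sub>R h + s *\<^sub>R k)) - E (X + (a *\<^sub>R h + 0 *\<^sub>R k)))"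
      using mvt by (simp only: power2_eq_square ring_distribs right_diff_distrib mult.assoc)
    then have eq: "(G s - G 0) / s\<^sup>2 - g k = (E (X + (a *\<^sub>R h + s *\<^sub>R k)) - E (X + (a *\<^sub>R h + 0 *\<^sub>R k))) / s"
      using s(1) by (simp add: power2_eq_square divide_simps)
    have "\<bar>E (X + (a *\<^sub>R h + s *\<^sub>R k)) - E (X + (a *\<^sub>R h + 0 *\<^sub>R k))\<bar> < e * s"
      using E[of s] E[of 0] s(1) by (simp add: mult.commute)
    then have "\<bar>(G s - G 0) / s\<^sup>2 - g k\<bar> < e"
      using s(1) unfolding eq by (simp add: abs_divide pos_divide_less_eq)
    then show ?thesis by (simp add: G_def algebra_simps)
  qed
  then show "\<forall>\<^sub>F s in at_right 0. dist ((f (X + s *\<^sub>R h + s *\<^sub>R k) - f (X + s *\<^sub>R h) - f (X + s *\<^sub>R k) + f X) / s\<^sup>2) (g k) < e"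
    unfolding dist_real_def eventually_at_right_field using s0 by blast
qed

lemma second_derivative_symmetric:
  fixes f :: "'a::euclidean_space \<Rightarrow> real" and f' :: "'a \<Rightarrow> 'a \<Rightarrow>\<^sub>L real"
  assumes "open U" "X \<in> U"
    and f: "\<And>Y. Y \<in> U \<Longrightarrow> (f has_derivative f' Y) (at Y)"
    and f'': "(f' has_derivative H) (at X)"
  shows "blinfun_apply (H h) k = blinfun_apply (H k) h"
proof -
  let ?Q = "\<lambda>h k s. (f (X + s *\<^sub>R h + s *\<^sub>R k) - f (X + s *\<^sub>R h) - f (X + s *\<^sub>R k) + f X) / s\<^sup>2"
  have lim: "(?Q h k \<longlongrightarrow> H k h) (at_right 0)" for h k
  proof (rule second_difference_quotient[OF assms(1,2) f])
    show "((\<lambda>Y. blinfun_apply (f' Y) h) has_derivative (\<lambda>k. blinfun_apply (H k) h)) (at X)"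
      using bounded_linear.has_derivative[OF blinfun.bounded_linear_left f''] .
  qed
  have "?Q h k = ?Q k h" by (simp add: algebra_simps)
  then show ?thesis
    using tendsto_unique[OF trivial_limit_at_right_real lim[of k h] lim[of h k, unfolded \<open>?Q h k = ?Q k h\<close>]] by simp
qed

section \<open>Gluing local extensions\<close>

text \<open>The square makes the truncation continuously differentiable at \<open>0\<close>; composed with \<open>r\<^sup>2 - |Y - c|\<^sup>2\<close> it is a bump
function that is positive exactly on a ball.\<close>

lemma Ck_on_1_sqr_pos: "Ck_on 1 UNIV (\<lambda>s::real. (max 0 s)\<^sup>2)"
proof (rule Ck_on_1_field_derivative)
  show "continuous_on UNIV (\<lambda>s::real. 2 * max 0 s)" by (intro continuous_intros)
  fix s :: real
  consider "s > 0" | "s < 0" | "s = 0" by linarith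
  then show "((\<lambda>s. (max 0 s)\<^sup>2) has_real_derivative 2 * max 0 s) (at s)"
  proof cases
    case 1
    have "((\<lambda>s. s\<^sup>2) has_real_derivative 2 * max 0 s) (at s)"
      using 1 by (auto intro!: derivative_eq_intros)
    then show ?thesis
      by (rule DERIV_cong_ev[THEN iffD1, rotated -1, OF _ refl _ refl])
         (use eventually_nhds_in_open[of "{0<..}" s] 1 in \<open>auto elim!: eventually_mono\<close>)
  next
    case 2
    have "((\<lambda>s. 0) has_real_derivative 2 * max 0 s) (at s)"
      using 2 by (auto intro!: derivative_eq_intros)
    then show ?thesis
      by (rule DERIV_cong_ev[THEN iffD1, rotated -1, OF _ refl _ refl])
         (use eventually_nhds_in_open[of "{..<0}" s] 2 in \<open>auto elim!: eventually_mono\<close>)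
  next
    case 3
    have "((\<lambda>y::real. (max 0 y)\<^sup>2 / y) \<longlongrightarrow> 0) (at 0)"
    proof (rule Lim_null_comparison)
      show "\<forall>\<^sub>F y in at 0. norm ((max 0 y)\<^sup>2 / y) \<le> \<bar>y\<bar>"
        by (auto simp: max_def power2_eq_square)
      show "((\<lambda>y::real. \<bar>y\<bar>) \<longlongrightarrow> 0) (at 0)" by (simp add: tendsto_rabs_zero)
    qed
    then show ?thesis using 3 by (simp add: has_field_derivative_iff)
  qed
qed

text \<open>Finitely many balls cover \<open>\<Gamma>\<close>, and the local extensions are averaged with the bump functions of these balls as weights.
Near \<open>\<Gamma>\<close> the sum of the weights is positive, and on \<open>\<Gamma>\<close> all extensions that carry a positive weight agree with \<open>f\<close>.\<close>

lemma Ck_boundary_1_local: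
  fixes f :: "'a::euclidean_space \<Rightarrow> 'b::real_normed_vector"
  assumes "compact \<Gamma>"
    and loc: "\<And>X. X \<in> \<Gamma> \<Longrightarrow> \<exists>U F. open U \<and> X \<in> U \<and> Ck_on 1 U F \<and> (\<forall>Y\<in>\<Gamma> \<inter> U. F Y = f Y)"
  shows "Ck_boundary 1 \<Gamma> f"
proof -
  obtain U F where UF: "\<And>X. X \<in> \<Gamma> \<Longrightarrow> open (U X)" "\<And>X. X \<in> \<Gamma> \<Longrightarrow> X \<in> U X"
      "\<And>X. X \<in> \<Gamma> \<Longrightarrow> Ck_on 1 (U X) (F X)" "\<And>X Y. X \<in> \<Gamma> \<Longrightarrow> Y \<in> \<Gamma> \<Longrightarrow> Y \<in> U X \<Longrightarrow> F X Y = f Y"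
    using loc by (metis IntI)
  have "\<exists>r>0. cball X r \<subseteq> U X" if "X \<in> \<Gamma>" for X
    using UF(1,2)[OF that] open_contains_cball by blast
  then obtain r where r: "\<And>X. X \<in> \<Gamma> \<Longrightarrow> r X > 0" "\<And>X. X \<in> \<Gamma> \<Longrightarrow> cball X (r X) \<subseteq> U X" by metis
  obtain I where I: "I \<subseteq> \<Gamma>" "finite I" "\<Gamma> \<subseteq> (\<Union>c\<in>I. ball c (r c))"
    by (rule compactE_image[OF \<open>compact \<Gamma>\<close>, of \<Gamma> "\<lambda>c. ball c (r c)"]) (use r in force)+
  define \<psi> where "\<psi> c Y = (max 0 ((r c)\<^sup>2 - (Y - c) \<bullet> (Y - c)))\<^sup>2" for c Y
  have \<psi>1: "Ck_on 1 UNIV (\<psi> c)" for c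
    unfolding \<psi>_def
    by (rule Ck_on_1_compose[OF _ Ck_on_1_sqr_pos]) (auto intro!: Ck_on_1_diff Ck_on_1_inner Ck_on_1_const Ck_on_1_id simp del: One_nat_def)
  have \<psi>0: "\<psi> c Y \<ge> 0" for c Y by (simp add: \<psi>_def)
  have nrm: "(Y - c) \<bullet> (Y - c) = (dist c Y)\<^sup>2" for c Y
    by (simp add: dist_norm norm_minus_commute power2_norm_eq_inner)
  have \<psi>ball: "\<psi> c Y \<noteq> 0 \<longleftrightarrow> Y \<in> ball c (r c)" if "c \<in> I" for c Y
  proof -
    have "r c > 0" using r I that by auto
    then have "(dist c Y)\<^sup>2 < (r c)\<^sup>2 \<longleftrightarrow> dist c Y < r c"
      by (meson linorder_not_le order_less_imp_le power_mono_iff pos2 zero_le_dist)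
    then show ?thesis by (auto simp: \<psi>_def nrm max_def)
  qed
  have summand: "Ck_on 1 UNIV (\<lambda>Y. \<psi> c Y *\<^sub>R F c Y)" if c: "c \<in> I" for c
  proof -
    have cG: "c \<in> \<Gamma>" using c I by auto
    have "Ck_on 1 (U c) (\<lambda>Y. \<psi> c Y *\<^sub>R F c Y)"
      by (intro Ck_on_1_scaleR UF cG Ck_on_mono[OF \<psi>1]) auto
    moreover have "Ck_on 1 (- cball c (r c)) (\<lambda>Y. \<psi> c Y *\<^sub>R F c Y)"
    proof (rule Ck_on_1_cong[OF Ck_on_1_const[of _ 0]])
      fix Y assume "Y \<in> - cball c (r c)"
      then show "0 = \<psi> c Y *\<^sub>R F c Y" using \<psi>ball[OF c, of Y] by auto
    qed auto
    \<comment> \<open>The extension \<open>F c\<close> is arbitrary off \<open>U c\<close>, but there its weight vanishes; two open sets cover the space.\<close>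
    ultimately have "Ck_on 1 (U c \<union> - cball c (r c)) (\<lambda>Y. \<psi> c Y *\<^sub>R F c Y)"
      by (rule Ck_on_1_Un) (use UF cG in auto)
    moreover have "U c \<union> - cball c (r c) = UNIV" using r(2)[OF cG] by auto
    ultimately show ?thesis by simp
  qed
  let ?W = "\<Union>c\<in>I. ball c (r c)"
  have pos: "(\<Sum>c\<in>I. \<psi> c Y) > 0" if Y: "Y \<in> ?W" for Y
  proof -
    obtain c where "c \<in> I" "Y \<in> ball c (r c)" using Y by auto
    then show ?thesis
      using \<psi>ball[of c Y] \<psi>0 by (intro sum_pos2[of _ c] I) (auto simp: less_le)
  qed
  let ?G = "\<lambda>Y. inverse (\<Sum>c\<in>I. \<psi> c Y) *\<^sub>R (\<Sum>c\<in>I. \<psi> c Y *\<^sub>R F c Y)"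
  have "Ck_on 1 ?W (\<lambda>Y. \<Sum>c\<in>I. \<psi> c Y *\<^sub>R F c Y)" "Ck_on 1 ?W (\<lambda>Y. \<Sum>c\<in>I. \<psi> c Y)"
    by (intro Ck_on_1_sum, rule Ck_on_mono[OF summand] Ck_on_mono[OF \<psi>1]; simp)+
  then have "Ck_on 1 ?W ?G"
    by (intro Ck_on_1_scaleR Ck_on_1_inverse) (use pos in force)+
  moreover have "?G Y = f Y" if Y: "Y \<in> \<Gamma>" for Y
  proof -
    have "\<psi> c Y *\<^sub>R F c Y = \<psi> c Y *\<^sub>R f Y" if c: "c \<in> I" for c
    proof (cases "\<psi> c Y = 0")
      case False
      then have "Y \<in> cball c (r c)" using \<psi>ball[OF c] by auto
      then show ?thesis using r(2) UF(4)[of c Y] Y c I(1) by (auto simp: subset_iff)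
    qed simp
    then have "(\<Sum>c\<in>I. \<psi> c Y *\<^sub>R F c Y) = (\<Sum>c\<in>I. \<psi> c Y) *\<^sub>R f Y"
      unfolding scaleR_sum_left by (rule sum.cong[OF refl])
    moreover have "(\<Sum>c\<in>I. \<psi> c Y) > 0" using pos[of Y] I(3) Y by blast
    ultimately show ?thesis by simp
  qed
  ultimately show ?thesis
    using I(3) unfolding Ck_boundary_def Ck_extension_def
    by (intro exI[of _ ?G] conjI exI[of _ ?W]) auto
qed

section \<open>Short-time estimates for ordinary differential equations\<close>

lemma norm_diff_le_vector_derivative:
  fixes u :: "real \<Rightarrow> 'b::real_normed_vector"
  assumes "\<And>s. s \<in> {0..\<tau>} \<Longrightarrow> (u has_vector_derivative u' s) (at s within {0..\<tau>})"
    and "\<And>s. s \<in> {0..\<tau>} \<Longrightarrow> norm (u' s) \<le> B" and t: "t \<in> {0..\<tau>}"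
  shows "norm (u t - u 0) \<le> B * t"
proof -
  have "norm (u t - u 0) \<le> B * norm (t - 0)"
  proof (rule differentiable_bound[of "{0..\<tau>}" u "\<lambda>s r. r *\<^sub>R u' s"])
    fix s assume s: "s \<in> {0..\<tau>}"
    show "(u has_derivative (\<lambda>r. r *\<^sub>R u' s)) (at s within {0..\<tau>})"
      using assms(1)[OF s] by (simp add: has_vector_derivative_def)
    have "norm (r *\<^sub>R u' s) \<le> B * norm r" for r
      using mult_left_mono[OF assms(2)[OF s], of "\<bar>r\<bar>"] by (simp add: mult.commute)
    then show "onorm (\<lambda>r. r *\<^sub>R u' s) \<le> B"
      by (rule onorm_bound[OF order_trans[OF norm_ge_zero assms(2)[OF s]]])
  qed (use t in simp_all)
  then show ?thesis using t by simp
qed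

text \<open>The interval is so short that \<open>K \<tau> \<le> 1/2\<close>. At a maximum point of \<open>|u|\<close> the mean value inequality
bounds the maximum \<open>m\<close> by \<open>|u 0| + m / 2 + \<tau> c\<close>, and the term \<open>m / 2\<close> is absorbed.\<close>

lemma short_time_gronwall:
  fixes u :: "real \<Rightarrow> 'b::real_normed_vector"
  assumes deriv: "\<And>t. t \<in> {0..\<tau>} \<Longrightarrow> (u has_vector_derivative u' t) (at t within {0..\<tau>})"
    and bound: "\<And>t. t \<in> {0..\<tau>} \<Longrightarrow> norm (u' t) \<le> K * norm (u t) + c"
    and "K * \<tau> \<le> 1/2" "K \<ge> 0" "c \<ge> 0" and t: "t \<in> {0..\<tau>}"
  shows "norm (u t) \<le> 2 * (norm (u 0) + \<tau> * c)"
proof -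
  have "\<tau> \<ge> 0" using t by auto
  have "continuous_on {0..\<tau>} u"
    using deriv has_vector_derivative_continuous continuous_on_eq_continuous_within by blast
  then have "continuous_on {0..\<tau>} (\<lambda>t. norm (u t))" by (rule continuous_on_norm)
  then obtain t0 where t0: "t0 \<in> {0..\<tau>}" "\<And>s. s \<in> {0..\<tau>} \<Longrightarrow> norm (u s) \<le> norm (u t0)"
    using continuous_attains_sup[of "{0..\<tau>}" "\<lambda>t. norm (u t)"] \<open>\<tau> \<ge> 0\<close> by auto
  define m where "m = norm (u t0)"
  have "norm (u t0 - u 0) \<le> (K * m + c) * t0"
  proof (rule norm_diff_le_vector_derivative[OF deriv _ t0(1)])
    fix s assume s: "s \<in> {0..\<tau>}"
    show "norm (u' s) \<le> K * m + c"
      using bound[OF s] mult_left_mono[OF t0(2)[OF s] \<open>K \<ge> 0\<close>] by (simp add: m_def)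
  qed
  also have "\<dots> \<le> (K * m + c) * \<tau>"
    using t0(1) \<open>K \<ge> 0\<close> \<open>c \<ge> 0\<close> by (intro mult_left_mono) (auto simp: m_def)
  also have "\<dots> = (K * \<tau>) * m + \<tau> * c" by (simp add: algebra_simps)
  also have "\<dots> \<le> 1/2 * m + \<tau> * c"
    using \<open>K * \<tau> \<le> 1/2\<close> by (intro add_right_mono mult_right_mono) (auto simp: m_def)
  finally have "norm (u t0 - u 0) \<le> 1/2 * m + \<tau> * c" .
  moreover have "m \<le> norm (u t0 - u 0) + norm (u 0)"
    unfolding m_def using norm_triangle_ineq[of "u t0 - u 0" "u 0"] by simp
  ultimately have "m \<le> 2 * (norm (u 0) + \<tau> * c)" by simp
  then show ?thesis using t0(2)[OF t] by (simp add: m_def)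
qed

text \<open>The Picard operator \<open>m \<mapsto> id + \<integral> A m\<close> contracts by the factor \<open>1/2\<close> in the supremum norm. To work in the Banach space of
bounded continuous functions on the whole line, time is clamped to the interval by the map \<open>J\<close>.\<close>

lemma linear_ode_exists:
  fixes A :: "real \<Rightarrow> 'a::euclidean_space \<Rightarrow>\<^sub>L 'a"
  assumes contA: "continuous_on {0..\<tau>} A" and bdA: "\<And>t. t \<in> {0..\<tau>} \<Longrightarrow> norm (A t) \<le> K"
    and "K * \<tau> \<le> 1/2" "\<tau> > 0"
  obtains M where "M 0 = id_blinfun"
    "\<And>t. t \<in> {0..\<tau>} \<Longrightarrow> (M has_vector_derivative A t o\<^sub>L M t) (at t within {0..\<tau>})"
proof -
  have "K \<ge> 0" using order_trans[OF norm_ge_zero bdA[of 0]] \<open>\<tau> > 0\<close> by simp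
  define J where "J t = max 0 (min \<tau> t)" for t
  have J: "J t \<in> {0..\<tau>}" for t using \<open>\<tau> > 0\<close> by (auto simp: J_def)
  have contJ: "continuous_on UNIV J" unfolding J_def by (intro continuous_intros)
  define P :: "(real \<Rightarrow>\<^sub>C ('a \<Rightarrow>\<^sub>L 'a)) \<Rightarrow> real \<Rightarrow> 'a \<Rightarrow>\<^sub>L 'a" where
    "P m t = integral {0..t} (\<lambda>s. A s o\<^sub>L m s)" for m t
  have contI: "continuous_on {0..\<tau>} (\<lambda>s. A s o\<^sub>L m s)" for m :: "real \<Rightarrow>\<^sub>C ('a \<Rightarrow>\<^sub>L 'a)"
    by (intro continuous_intros contA continuous_on_apply_bcontfun)
  have derP: "(P m has_vector_derivative A t o\<^sub>L m t) (at t within {0..\<tau>})" if "t \<in> {0..\<tau>}" for m t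
    unfolding P_def by (rule integral_has_vector_derivative[OF contI that])
  have P0: "P m 0 = 0" for m by (simp add: P_def)
  have contP: "continuous_on {0..\<tau>} (P m)" for m
    using derP has_vector_derivative_continuous continuous_on_eq_continuous_within by blast
  define T where "T m = Bcontfun (\<lambda>t. id_blinfun + P m (J t))" for m
  have T: "apply_bcontfun (T m) t = id_blinfun + P m (J t)" for m t
  proof -
    have "compact (P m ` {0..\<tau>})" by (intro compact_continuous_image contP) auto
    then obtain b where b: "\<And>s. s \<in> {0..\<tau>} \<Longrightarrow> norm (P m s) \<le> b"
      using compact_imp_bounded bounded_iff by (metis imageI)
    have "(\<lambda>t. id_blinfun + P m (J t)) \<in> bcontfun"
    proof (rule bcontfun_normI)
      show "continuous_on UNIV (\<lambda>t. id_blinfun + P m (J t))"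
        using J by (intro continuous_intros continuous_on_compose2[OF contP contJ]) auto
      show "norm (id_blinfun + P m (J t)) \<le> norm (id_blinfun :: 'a \<Rightarrow>\<^sub>L 'a) + b" for t
        by (intro norm_triangle_le add_left_mono b J)
    qed
    then show ?thesis by (simp add: T_def Bcontfun_inverse)
  qed
  have "\<exists>!m. T m = m"
  proof (rule banach_fix_type)
    show "\<forall>m1 m2. dist (T m1) (T m2) \<le> 1/2 * dist m1 m2"
    proof (intro allI dist_bound)
      fix m1 m2 :: "real \<Rightarrow>\<^sub>C ('a \<Rightarrow>\<^sub>L 'a)" and t
      let ?B = "K * dist m1 m2"
      have "norm ((P m1 (J t) - P m2 (J t)) - (P m1 0 - P m2 0)) \<le> ?B * J t"
      proof (rule norm_diff_le_vector_derivative[OF has_vector_derivative_diff[OF derP derP] _ J])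
        fix s assume s: "s \<in> {0..\<tau>}"
        have "norm (A s o\<^sub>L (m1 s - m2 s)) \<le> K * dist m1 m2"
          using dist_bounded[of m1 s m2] bdA[OF s] \<open>K \<ge> 0\<close>
          by (intro order_trans[OF norm_blinfun_compose] mult_mono) (auto simp: dist_norm)
        then show "norm ((A s o\<^sub>L m1 s) - (A s o\<^sub>L m2 s)) \<le> ?B"
          by (simp add: bounded_bilinear.diff_right[OF bounded_bilinear_blinfun_compose])
      qed
      also have "\<dots> \<le> ?B * \<tau>"
        using J[of t] \<open>K \<ge> 0\<close> by (intro mult_left_mono) auto
      also have "\<dots> = (K * \<tau>) * dist m1 m2" by simp
      also have "\<dots> \<le> 1/2 * dist m1 m2"
        by (intro mult_right_mono \<open>K * \<tau> \<le> 1/2\<close>) auto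
      finally show "dist (T m1 t) (T m2 t) \<le> 1/2 * dist m1 m2"
        by (simp add: T dist_norm P0)
    qed
  qed auto
  then obtain m where m: "T m = m" by blast
  have m_eq: "m t = id_blinfun + P m (J t)" for t using T[of m t] m by simp
  have Jid: "J t = t" if "t \<in> {0..\<tau>}" for t using that by (auto simp: J_def)
  show thesis
  proof (rule that[of "apply_bcontfun m"])
    show "m 0 = id_blinfun" using m_eq[of 0] \<open>\<tau> > 0\<close> by (simp add: Jid P0)
    fix t assume t: "t \<in> {0..\<tau>}"
    have "((\<lambda>t. id_blinfun + P m t) has_vector_derivative A t o\<^sub>L m t) (at t within {0..\<tau>})"
      by (rule has_vector_derivative_eq_rhs[OF has_vector_derivative_add[OF has_vector_derivative_const derP[OF t]]]) simp
    then show "(m has_vector_derivative A t o\<^sub>L m t) (at t within {0..\<tau>})"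
      by (rule has_vector_derivative_transform[OF t, rotated]) (simp add: m_eq Jid)
  qed
qed

section \<open>Differentiability of the flow\<close>

text \<open>Let \<open>m X\<close> solve the equation linearised along the trajectory from \<open>X\<close>. The remainder
\<open>x t Y - x t X - m X t (Y - X)\<close> satisfies a linear differential inequality whose inhomogeneity is quadratic in \<open>|Y - X|\<close>
by Taylor's formula, so it is itself quadratic: \<open>m X t\<close> is the derivative of the flow. The same comparison shows that \<open>m X t\<close> is
Lipschitz continuous in \<open>X\<close>, and integrating the linearised equation once more gives its first-order expansion in time.\<close>

lemma flow_derivative:
  fixes W :: "real \<Rightarrow> 'a::euclidean_space \<Rightarrow> 'a" and W' :: "real \<Rightarrow> 'a \<Rightarrow> 'a \<Rightarrow>\<^sub>L 'a"
  assumes der: "\<And>t X. t \<in> {0..\<tau>} \<Longrightarrow> (W t has_derivative W' t X) (at X)"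
    and bdW: "\<And>t X. t \<in> {0..\<tau>} \<Longrightarrow> norm (W t X) \<le> K"
    and bd: "\<And>t X. t \<in> {0..\<tau>} \<Longrightarrow> norm (W' t X) \<le> K"
    and lip: "\<And>t X Y. t \<in> {0..\<tau>} \<Longrightarrow> norm (W' t X - W' t Y) \<le> K * norm (X - Y)"
    and unif: "\<And>t. t \<in> {0..\<tau>} \<Longrightarrow> uniform_limit UNIV W' (W' t) (at t within {0..\<tau>})"
    and K\<tau>: "K * \<tau> \<le> 1/4" and "\<tau> > 0"
    and x0: "\<And>X. x 0 X = X"
    and flow: "\<And>t X. t \<in> {0..\<tau>} \<Longrightarrow> ((\<lambda>s. x s X) has_vector_derivative W t (x t X)) (at t within {0..\<tau>})"
  obtains M where
    "\<And>t X. t \<in> {0..\<tau>} \<Longrightarrow> (x t has_derivative blinfun_apply (M t X)) (at X)"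
    "\<And>t. t \<in> {0..\<tau>} \<Longrightarrow> continuous_on UNIV (M t)"
    "\<And>t X. t \<in> {0..\<tau>} \<Longrightarrow> norm (M t X - id_blinfun) \<le> 1/2"
    "uniform_limit UNIV (\<lambda>t X. (M t X - id_blinfun) /\<^sub>R t) (W' 0) (at_right 0)"
proof -
  have "K \<ge> 0" using order_trans[OF norm_ge_zero bd[of 0]] \<open>\<tau> > 0\<close> by simp
  have K2: "K * \<tau> \<le> 1/2" using K\<tau> by simp
  have Wlip: "norm (W t a - W t b) \<le> K * norm (a - b)" if "t \<in> {0..\<tau>}" for t a b
    by (rule differentiable_bound[of UNIV "W t" "\<lambda>X. blinfun_apply (W' t X)"])
       (use der[OF that] bd[OF that] in \<open>auto simp: norm_blinfun.rep_eq[symmetric]\<close>)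
  have Wtaylor: "norm (W t a - W t b - W' t b (a - b)) \<le> norm (a - b) * (K * norm (a - b))"
    if t: "t \<in> {0..\<tau>}" for t a b
  proof (rule differentiable_bound_linearization[of b a "closed_segment b a" _ "\<lambda>X. blinfun_apply (W' t X)"])
    show "b + s *\<^sub>R (a - b) \<in> closed_segment b a" if "s \<in> {0..1}" for s
      unfolding closed_segment_def using that by (intro CollectI exI[of _ s]) (simp add: algebra_simps)
    show "onorm (blinfun_apply (W' t y) - blinfun_apply (W' t b)) \<le> K * norm (a - b)"
      if "y \<in> closed_segment b a" for y
    proof -
      have "onorm (blinfun_apply (W' t y - W' t b)) \<le> K * norm (y - b)"
        using lip[OF t, of y b] by (simp add: norm_blinfun.rep_eq)
      also have "\<dots> \<le> K * norm (a - b)"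
        using segment_bound(1)[OF that] \<open>K \<ge> 0\<close> by (intro mult_left_mono)
      finally show ?thesis by (simp add: minus_blinfun.rep_eq fun_diff_def)
    qed
    show "(W t has_derivative blinfun_apply (W' t y)) (at y within closed_segment b a)" for y
      by (rule has_derivative_at_withinI[OF der[OF t]])
  qed simp
  have xlip: "norm (x t X - x t Y) \<le> 2 * norm (X - Y)" if "t \<in> {0..\<tau>}" for t X Y
    using short_time_gronwall[of \<tau> "\<lambda>t. x t X - x t Y" "\<lambda>t. W t (x t X) - W t (x t Y)" K 0 t]
      Wlip K2 \<open>K \<ge> 0\<close> that
    by (simp add: x0 has_vector_derivative_diff flow)
  have xnear: "norm (x t X - X) \<le> K * t" if t: "t \<in> {0..\<tau>}" for t X
    using norm_diff_le_vector_derivative[OF flow bdW t] by (simp add: x0)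
  have xcont: "continuous_on {0..\<tau>} (\<lambda>s. x s X)" for X
    using flow has_vector_derivative_continuous continuous_on_eq_continuous_within by blast
  have Acont: "continuous_on {0..\<tau>} (\<lambda>s. W' s (x s X))" for X
    unfolding continuous_on_def
  proof
    fix t assume t: "t \<in> {0..\<tau>}"
    have "((\<lambda>s. W' s (x s X) - W' t (x s X)) \<longlongrightarrow> 0) (at t within {0..\<tau>})"
    proof (rule tendstoI)
      fix e :: real assume "e > 0"
      then show "\<forall>\<^sub>F s in at t within {0..\<tau>}. dist (W' s (x s X) - W' t (x s X)) 0 < e"
        using uniform_limitD[OF unif[OF t], of e] by (auto simp: dist_norm elim!: eventually_mono)
    qed
    moreover have "((\<lambda>s. W' t (x s X) - W' t (x t X)) \<longlongrightarrow> 0) (at t within {0..\<tau>})"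
    proof (rule Lim_null_comparison[where g = "\<lambda>s. K * norm (x s X - x t X)"])
      have "((\<lambda>s. x s X) \<longlongrightarrow> x t X) (at t within {0..\<tau>})"
        using xcont t by (auto simp: continuous_on_def)
      then have "((\<lambda>s. K * norm (x s X - x t X)) \<longlongrightarrow> K * norm (x t X - x t X)) (at t within {0..\<tau>})"
        by (intro tendsto_intros)
      then show "((\<lambda>s. K * norm (x s X - x t X)) \<longlongrightarrow> 0) (at t within {0..\<tau>})" by simp
    qed (use lip[OF t] in auto)
    ultimately have "((\<lambda>s. (W' s (x s X) - W' t (x s X)) + (W' t (x s X) - W' t (x t X))) \<longlongrightarrow> 0 + 0)
        (at t within {0..\<tau>})" by (rule tendsto_add)
    then show "((\<lambda>s. W' s (x s X)) \<longlongrightarrow> W' t (x t X)) (at t within {0..\<tau>})"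
      by (simp add: LIM_zero_iff)
  qed
  have "\<exists>m. m 0 = id_blinfun \<and> (\<forall>t\<in>{0..\<tau>}. (m has_vector_derivative W' t (x t X) o\<^sub>L m t) (at t within {0..\<tau>}))" for X
    using linear_ode_exists[OF Acont bd K2 \<open>\<tau> > 0\<close>, of X] by metis
  then obtain m where m0: "\<And>X. m X 0 = id_blinfun"
    and m: "\<And>X t. t \<in> {0..\<tau>} \<Longrightarrow> (m X has_vector_derivative W' t (x t X) o\<^sub>L m X t) (at t within {0..\<tau>})"
    by metis
  have prodbd: "norm (W' t Y o\<^sub>L B) \<le> K * norm B" if "t \<in> {0..\<tau>}" for t Y and B :: "'a \<Rightarrow>\<^sub>L 'a"
    using bd[OF that] by (intro order_trans[OF norm_blinfun_compose] mult_right_mono) auto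
  have m2: "norm (m X t) \<le> 2" if t: "t \<in> {0..\<tau>}" for X t
  proof -
    have "norm (m X t) \<le> 2 * (norm (m X 0) + \<tau> * 0)"
      by (rule short_time_gronwall[OF m _ K2 \<open>K \<ge> 0\<close> _ t]) (use prodbd in auto)
    then show ?thesis using norm_blinfun_id_le[where 'a='a] by (simp add: m0)
  qed
  have mdiff: "norm (m X t - id_blinfun) \<le> 2 * K * t" if t: "t \<in> {0..\<tau>}" for t X
  proof -
    have "norm (W' s (x s X) o\<^sub>L m X s) \<le> 2 * K" if s: "s \<in> {0..\<tau>}" for s
      using order_trans[OF prodbd[OF s] mult_left_mono[OF m2[OF s] \<open>K \<ge> 0\<close>]] by (simp add: mult.commute)
    from norm_diff_le_vector_derivative[OF m this t] show ?thesis by (simp add: m0)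
  qed
  have mlip: "norm (m X t - m Y t) \<le> (8 * \<tau> * K) * norm (X - Y)" if t: "t \<in> {0..\<tau>}" for t X Y
  proof -
    let ?c = "4 * K * norm (X - Y)"
    have "norm (m X t - m Y t) \<le> 2 * (norm (m X 0 - m Y 0) + \<tau> * ?c)"
    proof (rule short_time_gronwall[OF has_vector_derivative_diff[OF m m] _ K2 \<open>K \<ge> 0\<close> _ t])
      fix s assume s: "s \<in> {0..\<tau>}"
      have "(W' s (x s X) o\<^sub>L m X s) - (W' s (x s Y) o\<^sub>L m Y s) =
          (W' s (x s X) o\<^sub>L (m X s - m Y s)) + ((W' s (x s X) - W' s (x s Y)) o\<^sub>L m Y s)"
        by (simp add: bounded_bilinear.diff_left[OF bounded_bilinear_blinfun_compose] bounded_bilinear.diff_right[OF bounded_bilinear_blinfun_compose])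
      also have "norm \<dots> \<le> K * norm (m X s - m Y s) + norm (W' s (x s X) - W' s (x s Y)) * norm (m Y s)"
        by (intro norm_triangle_le add_mono prodbd s norm_blinfun_compose)
      finally have 1: "norm ((W' s (x s X) o\<^sub>L m X s) - (W' s (x s Y) o\<^sub>L m Y s))
        \<le> K * norm (m X s - m Y s) + norm (W' s (x s X) - W' s (x s Y)) * norm (m Y s)" .
      have "norm (W' s (x s X) - W' s (x s Y)) * norm (m Y s) \<le> (K * (2 * norm (X - Y))) * 2"
        using lip[OF s, of "x s X" "x s Y"] mult_left_mono[OF xlip[OF s, of X Y] \<open>K \<ge> 0\<close>]
        by (intro mult_mono m2 s) (auto intro: \<open>K \<ge> 0\<close> mult_nonneg_nonneg)
      with 1 show "norm ((W' s (x s X) o\<^sub>L m X s) - (W' s (x s Y) o\<^sub>L m Y s)) \<le> K * norm (m X s - m Y s) + ?c"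
        by simp
    qed (use \<open>K \<ge> 0\<close> in auto)
    then show ?thesis by (simp add: m0 algebra_simps)
  qed
  have xderiv: "(x t has_derivative blinfun_apply (m X t)) (at X)" if t: "t \<in> {0..\<tau>}" for t X
  proof -
    have est: "norm (x t Y - x t X - m X t (Y - X)) \<le> (8 * \<tau> * K) * (norm (Y - X))\<^sup>2" for Y
    proof -
      let ?c = "4 * K * (norm (Y - X))\<^sup>2"
      have "norm (x t Y - x t X - m X t (Y - X)) \<le> 2 * (norm (x 0 Y - x 0 X - m X 0 (Y - X)) + \<tau> * ?c)"
      proof (rule short_time_gronwall[where u = "\<lambda>t. x t Y - x t X - m X t (Y - X)"
          and u' = "\<lambda>s. W s (x s Y) - W s (x s X) - (W' s (x s X) o\<^sub>L m X s) (Y - X)",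
          OF _ _ K2 \<open>K \<ge> 0\<close> _ t])
        fix s assume s: "s \<in> {0..\<tau>}"
        show "((\<lambda>t. x t Y - x t X - m X t (Y - X)) has_vector_derivative
            W s (x s Y) - W s (x s X) - (W' s (x s X) o\<^sub>L m X s) (Y - X)) (at s within {0..\<tau>})"
          by (intro has_vector_derivative_diff flow s
              bounded_linear.has_vector_derivative[OF blinfun.bounded_linear_left m[OF s]])
        let ?a = "x s Y" and ?b = "x s X"
        have "W s ?a - W s ?b - (W' s ?b o\<^sub>L m X s) (Y - X) =
          (W s ?a - W s ?b - W' s ?b (?a - ?b)) + W' s ?b (?a - ?b - m X s (Y - X))"
          by (simp add: blinfun.diff_right)
        also have "norm \<dots> \<le> norm (?a - ?b) * (K * norm (?a - ?b)) + K * norm (?a - ?b - m X s (Y - X))"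
          using Wtaylor[OF s] order_trans[OF norm_blinfun mult_right_mono[OF bd[OF s]]]
          by (intro norm_triangle_le add_mono) auto
        finally have 1: "norm (W s ?a - W s ?b - (W' s ?b o\<^sub>L m X s) (Y - X))
          \<le> norm (?a - ?b) * (K * norm (?a - ?b)) + K * norm (?a - ?b - m X s (Y - X))" .
        have "norm (?a - ?b) * (K * norm (?a - ?b)) \<le> (2 * norm (Y - X)) * (K * (2 * norm (Y - X)))"
          using xlip[OF s, of Y X] \<open>K \<ge> 0\<close> by (intro mult_mono mult_left_mono) auto
        moreover have "(2 * norm (Y - X)) * (K * (2 * norm (Y - X))) = ?c"
          by (simp add: power2_eq_square)
        ultimately show "norm (W s ?a - W s ?b - (W' s ?b o\<^sub>L m X s) (Y - X)) \<le> K * norm (?a - ?b - m X s (Y - X)) + ?c"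
          using 1 by linarith
      qed (use \<open>K \<ge> 0\<close> in auto)
      then show ?thesis by (simp add: m0 x0 algebra_simps)
    qed
    show ?thesis
      unfolding has_derivative_at_alt
    proof (intro conjI allI impI)
      show "bounded_linear (blinfun_apply (m X t))" by (rule blinfun.bounded_linear_right)
      fix e :: real assume e: "e > 0"
      define C where "C = 8 * \<tau> * K + 1"
      have C: "C > 0" using \<open>K \<ge> 0\<close> \<open>\<tau> > 0\<close> by (simp add: C_def add_nonneg_pos)
      show "\<exists>d>0. \<forall>Y. norm (Y - X) < d \<longrightarrow> norm (x t Y - x t X - m X t (Y - X)) \<le> e * norm (Y - X)"
      proof (intro exI[of _ "e / C"] conjI allI impI)
        fix Y assume Y: "norm (Y - X) < e / C"
        have "(8 * \<tau> * K) * (norm (Y - X))\<^sup>2 \<le> C * (norm (Y - X))\<^sup>2"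
          by (intro mult_right_mono) (auto simp: C_def)
        also have "\<dots> = (C * norm (Y - X)) * norm (Y - X)" by (simp add: power2_eq_square)
        also have "\<dots> \<le> e * norm (Y - X)"
          using Y C by (intro mult_right_mono) (auto simp: pos_less_divide_eq mult.commute)
        finally show "norm (x t Y - x t X - m X t (Y - X)) \<le> e * norm (Y - X)"
          using est[of Y] by linarith
      qed (use e C in auto)
    qed
  qed
  have lim: "uniform_limit UNIV (\<lambda>t X. (m X t - id_blinfun) /\<^sub>R t) (W' 0) (at_right 0)"
  proof (rule uniform_limitI)
    fix e :: real assume e: "e > 0"
    have "\<forall>\<^sub>F s in at 0 within {0..\<tau>}. \<forall>X\<in>UNIV. dist (W' s X) (W' 0 X) < e / 8"
      using uniform_limitD[OF unif[of 0], of "e / 8"] e \<open>\<tau> > 0\<close> by simp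
    then obtain d where d: "d > 0" "\<And>s X. s \<in> {0..\<tau>} \<Longrightarrow> s \<noteq> 0 \<Longrightarrow> s < d \<Longrightarrow> norm (W' s X - W' 0 X) < e / 8"
      unfolding eventually_at by (auto simp: dist_norm)
    define C where "C = 4 * K * K + 1"
    have C: "C > 0" by (simp add: C_def add_nonneg_pos)
    define r where "r = min (min d \<tau>) (e / (2 * C))"
    have r: "r > 0" "r \<le> d" "r \<le> \<tau>" "r \<le> e / (2 * C)" using d e C \<open>\<tau> > 0\<close> by (auto simp: r_def)
    have "dist ((m X t - id_blinfun) /\<^sub>R t) (W' 0 X) < e" if t: "0 < t" "t < r" for t X
    proof -
      have t\<tau>: "t \<in> {0..\<tau>}" using t r by auto
      let ?B = "e / 4 + 4 * K * K * t"
      have "norm ((m X t - t *\<^sub>R W' 0 X) - (m X 0 - 0 *\<^sub>R W' 0 X)) \<le> ?B * t"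
      proof (rule norm_diff_le_vector_derivative[where \<tau> = t and u = "\<lambda>s. m X s - s *\<^sub>R W' 0 X"
          and u' = "\<lambda>s. (W' s (x s X) o\<^sub>L m X s) - W' 0 X"])
        fix s assume s: "s \<in> {0..t}"
        then have s\<tau>: "s \<in> {0..\<tau>}" "0 \<le> s" "s \<le> t" using t\<tau> by auto
        have "((\<lambda>s. s *\<^sub>R W' 0 X) has_vector_derivative W' 0 X) (at s within {0..\<tau>})"
          by (auto simp: has_vector_derivative_def intro!: derivative_eq_intros)
        from has_vector_derivative_diff[OF m[OF s\<tau>(1), of X] this]
        show "((\<lambda>s. m X s - s *\<^sub>R W' 0 X) has_vector_derivative (W' s (x s X) o\<^sub>L m X s) - W' 0 X) (at s within {0..t})"
          by (rule has_vector_derivative_within_subset) (use t\<tau> in auto)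
        \<comment> \<open>Three sources of error: the dependence of the velocity on time, the displacement of the trajectory, and \<open>m X s \<noteq> id\<close>.\<close>
        have eq: "(W' s (x s X) o\<^sub>L m X s) - W' 0 X = ((W' s (x s X) - W' 0 (x s X)) o\<^sub>L m X s)
            + ((W' 0 (x s X) - W' 0 X) o\<^sub>L m X s) + (W' 0 X o\<^sub>L (m X s - id_blinfun))"
          by (simp add: bounded_bilinear.diff_left[OF bounded_bilinear_blinfun_compose] bounded_bilinear.diff_right[OF bounded_bilinear_blinfun_compose] blinfun_eqI)
        have 1: "norm ((W' s (x s X) - W' 0 (x s X)) o\<^sub>L m X s) \<le> e / 8 * 2"
        proof (intro order_trans[OF norm_blinfun_compose] mult_mono m2 s\<tau>)
          show "norm (W' s (x s X) - W' 0 (x s X)) \<le> e / 8"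
            using d(2)[OF s\<tau>(1), of "x s X"] s\<tau> t r e by (cases "s = 0") auto
        qed (use e in auto)
        have "norm ((W' 0 (x s X) - W' 0 X) o\<^sub>L m X s) \<le> (K * (K * s)) * 2"
        proof (intro order_trans[OF norm_blinfun_compose] mult_mono m2 s\<tau>)
          show "norm (W' 0 (x s X) - W' 0 X) \<le> K * (K * s)"
            using lip[of 0 "x s X" X] mult_left_mono[OF xnear[OF s\<tau>(1)] \<open>K \<ge> 0\<close>] \<open>\<tau> > 0\<close>
            by (auto intro: order_trans)
        qed (use \<open>K \<ge> 0\<close> s\<tau> in auto)
        moreover have "norm (W' 0 X o\<^sub>L (m X s - id_blinfun)) \<le> K * (2 * K * s)"
          using \<open>\<tau> > 0\<close> \<open>K \<ge> 0\<close> by (intro order_trans[OF prodbd] mult_left_mono mdiff s\<tau>) auto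
        ultimately have "norm ((W' s (x s X) o\<^sub>L m X s) - W' 0 X) \<le> e / 4 + 4 * K * K * s"
          unfolding eq using 1
            norm_triangle_ineq[of "((W' s (x s X) - W' 0 (x s X)) o\<^sub>L m X s)
            + ((W' 0 (x s X) - W' 0 X) o\<^sub>L m X s)" "W' 0 X o\<^sub>L (m X s - id_blinfun)"]
            norm_triangle_ineq[of "(W' s (x s X) - W' 0 (x s X)) o\<^sub>L m X s"
            "(W' 0 (x s X) - W' 0 X) o\<^sub>L m X s"]
          by linarith
        also have "\<dots> \<le> ?B" using s\<tau> \<open>K \<ge> 0\<close> by (intro add_left_mono mult_left_mono) auto
        finally show "norm ((W' s (x s X) o\<^sub>L m X s) - W' 0 X) \<le> ?B" .
      qed (use t in auto)
      then have "norm (m X t - id_blinfun - t *\<^sub>R W' 0 X) \<le> ?B * t"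
        using t by (simp add: m0 algebra_simps)
      moreover have "m X t - id_blinfun - t *\<^sub>R W' 0 X = t *\<^sub>R ((m X t - id_blinfun) /\<^sub>R t - W' 0 X)"
        using t by (simp add: scaleR_diff_right)
      ultimately have "norm ((m X t - id_blinfun) /\<^sub>R t - W' 0 X) * t \<le> ?B * t"
        using t(1) by (simp add: mult.commute)
      then have "norm ((m X t - id_blinfun) /\<^sub>R t - W' 0 X) \<le> ?B"
        using t(1) by (rule mult_right_le_imp_le)
      moreover have "C * t = 4 * K * K * t + t" by (simp add: C_def distrib_right)
      moreover have "C * t < e / 2"
      proof -
        have "t < e / (2 * C)" using t r by linarith
        then show ?thesis using C by (simp add: pos_less_divide_eq mult_ac)
      qed
      ultimately show ?thesis using e t(1) unfolding dist_norm by linarith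
    qed
    then show "\<forall>\<^sub>F t in at_right 0. \<forall>X\<in>UNIV. dist ((m X t - id_blinfun) /\<^sub>R t) (W' 0 X) < e"
      unfolding eventually_at_right_field using r(1) by blast
  qed
  show thesis
  proof (rule that[of "\<lambda>t X. m X t"])
    show "continuous_on UNIV (\<lambda>X. m X t)" if t: "t \<in> {0..\<tau>}" for t
    proof (rule lipschitz_on_continuous_on)
      show "(8 * \<tau> * K)-lipschitz_on UNIV (\<lambda>X. m X t)"
        using mlip[OF t] \<open>K \<ge> 0\<close> \<open>\<tau> > 0\<close> by (intro lipschitz_onI) (auto simp: dist_norm)
    qed
    show "norm (m X t - id_blinfun) \<le> 1/2" if t: "t \<in> {0..\<tau>}" for t X
    proof -
      have "K * t \<le> K * \<tau>" using t \<open>K \<ge> 0\<close> by (intro mult_left_mono) auto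
      then show ?thesis using mdiff[OF t, of X] K\<tau> by linarith
    qed
  qed (fact xderiv lim)+
qed

text \<open>At time \<open>0\<close> the derivatives up to order two are bounded, being continuous with compact support; uniform convergence
carries the bounds over to small times, and second derivatives bound the Lipschitz constant of the first. The same
constant \<open>K\<close> serves for all bounds, and \<open>\<tau>\<close> is then shrunk to meet \<open>K \<tau> \<le> 1/4\<close>.\<close>

lemma velocity_field_estimates:
  fixes V :: "real \<Rightarrow> 'a::euclidean_space \<Rightarrow> 'a"
  defines "V' \<equiv> \<lambda>t X. Blinfun (frechet_derivative (V t) (at X))"
  assumes vf: "velocity_field 2 \<epsilon> D V" and "\<epsilon> > 0"
  obtains \<tau> K where "\<tau> > 0" "\<tau> \<le> \<epsilon>" "K * \<tau> \<le> 1/4"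
    "\<And>t X. t \<in> {0..\<tau>} \<Longrightarrow> (V t has_derivative V' t X) (at X)"
    "\<And>t X. t \<in> {0..\<tau>} \<Longrightarrow> norm (V t X) \<le> K"
    "\<And>t X. t \<in> {0..\<tau>} \<Longrightarrow> norm (V' t X) \<le> K"
    "\<And>t X Y. t \<in> {0..\<tau>} \<Longrightarrow> norm (V' t X - V' t Y) \<le> K * norm (X - Y)"
    "\<And>t. t \<in> {0..\<tau>} \<Longrightarrow> uniform_limit UNIV V' (V' t) (at t within {0..\<tau>})"
proof -
  define N where "N = real DIM('a)"
  have "N \<ge> 0" by (simp add: N_def)
  have Ck: "Ck_on 2 UNIV (V t)" if "t \<in> {0..\<epsilon>}" for t
    using vf that by (auto simp: velocity_field_def Vspace_def)
  have diff: "dpartial bs (V t) differentiable at X"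
    if "t \<in> {0..\<epsilon>}" "set bs \<subseteq> Basis" "length bs < 2" for t bs X
    using Ck[OF that(1)] that(2,3) unfolding Ck_on_def by blast
  have der: "(V t has_derivative V' t X) (at X)" if "t \<in> {0..\<epsilon>}" for t X
    using has_C1_derivativeD(1)[OF Ck_on_1_canonical[OF Ck_on_mono[OF Ck[OF that], of 1 UNIV]]]
    by (simp add: V'_def)
  have V'_apply: "V' t X b = dpartial [b] (V t) X" if "t \<in> {0..\<epsilon>}" for t X b
    using frechet_derivative_at[OF der[OF that]] by simp
  define L where "L = {bs. set bs \<subseteq> (Basis :: 'a set) \<and> length bs \<le> 2}"
  have finL: "finite L" unfolding L_def by (rule finite_lists_length_le) simp
  have L: "bs \<in> L \<longleftrightarrow> set bs \<subseteq> Basis \<and> length bs \<le> 2" for bs by (simp add: L_def)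
  have "\<exists>B d. d > 0 \<and> (\<forall>t\<in>{0..\<epsilon>}. t < d \<longrightarrow> (\<forall>X. norm (dpartial bs (V t) X) \<le> B))" if bs: "bs \<in> L" for bs
  proof -
    let ?f = "dpartial bs (V 0)"
    have 0: "0 \<in> {0..\<epsilon>}" using \<open>\<epsilon> > 0\<close> by simp
    have c: "continuous_on UNIV ?f" and k: "compact (closure {X. ?f X \<noteq> 0})"
      using Ck[OF 0] vf 0 bs by (auto simp: L Ck_on_def velocity_field_def Vspace_def)
    have "compact (?f ` closure {X. ?f X \<noteq> 0})"
      by (rule compact_continuous_image[OF continuous_on_subset[OF c] k]) simp
    then obtain B where B: "\<And>X. X \<in> closure {X. ?f X \<noteq> 0} \<Longrightarrow> norm (?f X) \<le> B"
      using compact_imp_bounded bounded_iff by (metis imageI)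
    have Bf: "norm (?f X) \<le> max B 0" for X
      using B[of X] closure_subset[of "{X. ?f X \<noteq> 0}"] by (cases "?f X = 0") auto
    have "\<forall>\<^sub>F s in at 0 within {0..\<epsilon>}. \<forall>X\<in>UNIV. dist (dpartial bs (V s) X) (?f X) < 1"
      using vf 0 bs by (intro uniform_limitD) (auto simp: L velocity_field_def)
    then obtain d where d: "d > 0" "\<And>t X. t \<in> {0..\<epsilon>} \<Longrightarrow> t \<noteq> 0 \<Longrightarrow> t < d \<Longrightarrow> dist (dpartial bs (V t) X) (?f X) < 1"
      unfolding eventually_at by auto
    have "norm (dpartial bs (V t) X) \<le> max B 0 + 1" if t: "t \<in> {0..\<epsilon>}" "t < d" for t X
    proof (cases "t = 0")
      case True
      then show ?thesis using Bf[of X] by simp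
    next
      case False
      have "norm (dpartial bs (V t) X) \<le> norm (?f X) + dist (dpartial bs (V t) X) (?f X)"
        by (metis dist_norm norm_triangle_sub)
      then show ?thesis using d(2)[OF t(1) False t(2), of X] Bf[of X] by linarith
    qed
    then show ?thesis using d(1) by blast
  qed
  then obtain Bf df where Bd: "\<And>bs. bs \<in> L \<Longrightarrow> df bs > 0"
    "\<And>bs t X. bs \<in> L \<Longrightarrow> t \<in> {0..\<epsilon>} \<Longrightarrow> t < df bs \<Longrightarrow> norm (dpartial bs (V t) X) \<le> Bf bs"
    by metis
  define d where "d = Min (df ` L)"
  define B where "B = Max (Bf ` L)"
  have neL: "[] \<in> L" by (simp add: L)
  have "df ` L \<noteq> {}" using neL by auto
  then have "d \<in> df ` L" unfolding d_def by (rule Min_in[OF finite_imageI[OF finL]])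
  then have d: "d > 0" using Bd(1) by (elim imageE) simp
  have dle: "d \<le> df bs" if "bs \<in> L" for bs using finL that by (simp add: d_def)
  have Ble: "Bf bs \<le> B" if "bs \<in> L" for bs using finL that by (simp add: B_def)
  have bdd: "norm (dpartial bs (V t) X) \<le> B" if "bs \<in> L" "t \<in> {0..\<epsilon>}" "t < d" for bs t X
    using Bd(2)[OF that(1,2), of X] dle[OF that(1)] Ble[OF that(1)] that(3) by linarith
  have "B \<ge> 0" using order_trans[OF norm_ge_zero bdd[OF neL, of 0]] \<open>\<epsilon> > 0\<close> d by simp
  define K where "K = B + N * B + N * (N * B)"
  have NB: "0 \<le> N * B" "0 \<le> N * (N * B)" using \<open>B \<ge> 0\<close> \<open>N \<ge> 0\<close> by simp_all
  have KB: "B \<le> K" "N * B \<le> K" "N * (N * B) \<le> K" using NB \<open>B \<ge> 0\<close> by (simp_all add: K_def)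
  define \<tau> where "\<tau> = min (min \<epsilon> (d / 2)) (1 / (4 * (K + 1)))"
  have "K \<ge> 0" using KB \<open>B \<ge> 0\<close> by simp
  have \<tau>: "\<tau> > 0" "\<tau> \<le> \<epsilon>" "\<tau> < d" "\<tau> \<le> 1 / (4 * (K + 1))"
    using \<open>\<epsilon> > 0\<close> d \<open>K \<ge> 0\<close> by (auto simp: \<tau>_def min_less_iff_disj)
  have t\<tau>: "t \<in> {0..\<epsilon>}" "t < d" if "t \<in> {0..\<tau>}" for t using that \<tau> by auto
  have col: "norm f \<le> N * c" if "\<And>b. b \<in> Basis \<Longrightarrow> norm (blinfun_apply f b) \<le> c"
    for f :: "'a \<Rightarrow>\<^sub>L 'a" and c
    using order_trans[OF norm_blinfun_euclidean_le[of f] sum_mono[OF that]] by (simp add: N_def)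
  show thesis
  proof (rule that[of \<tau> K])
    have "K * \<tau> \<le> (K + 1) * (1 / (4 * (K + 1)))"
      using \<tau> \<open>K \<ge> 0\<close> by (intro mult_mono) auto
    also have "\<dots> = 1/4" using \<open>K \<ge> 0\<close> by (simp add: divide_simps)
    finally show "K * \<tau> \<le> 1/4" .
    fix t assume t: "t \<in> {0..\<tau>}"
    show "(V t has_derivative V' t X) (at X)" for X by (rule der[OF t\<tau>(1)[OF t]])
    show "norm (V t X) \<le> K" for X using bdd[OF neL t\<tau>[OF t], of X] KB by simp
    have "norm (V' t X) \<le> N * B" for X
      by (rule col) (use bdd[OF _ t\<tau>[OF t], of "[_]"] in \<open>auto simp: L V'_apply[OF t\<tau>(1)[OF t]]\<close>)
    then show "norm (V' t X) \<le> K" for X using KB(2) by (meson order_trans)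
    show "norm (V' t X - V' t Y) \<le> K * norm (X - Y)" for X Y
    proof -
      have "norm (V' t X - V' t Y) \<le> N * (N * B * norm (X - Y))"
      proof (rule col)
        fix b :: 'a assume b: "b \<in> Basis"
        have "norm (dpartial [b] (V t) X - dpartial [b] (V t) Y) \<le> N * B * norm (X - Y)"
        proof (rule differentiable_bound[of UNIV _ "\<lambda>X. frechet_derivative (dpartial [b] (V t)) (at X)"])
          fix Z
          let ?g = "frechet_derivative (dpartial [b] (V t)) (at Z)"
          have dif: "dpartial [b] (V t) differentiable at Z" using diff[OF t\<tau>(1)[OF t], of "[b]"] b by simp
          then show "(dpartial [b] (V t) has_derivative ?g) (at Z)"
            using frechet_derivative_works by blast
          have "norm (Blinfun ?g) \<le> N * B"
          proof (rule col)
            fix c :: 'a assume "c \<in> Basis"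
            then show "norm (blinfun_apply (Blinfun ?g) c) \<le> B"
              using bdd[OF _ t\<tau>[OF t], of "[c, b]" Z] b blinfun_apply_Blinfun_frechet[OF dif] by (simp add: L)
          qed
          then show "onorm ?g \<le> N * B"
            using blinfun_apply_Blinfun_frechet[OF dif] by (simp add: norm_blinfun.rep_eq)
        qed auto
        then show "norm (blinfun_apply (V' t X - V' t Y) b) \<le> N * B * norm (X - Y)"
          by (simp add: blinfun.diff_left V'_apply[OF t\<tau>(1)[OF t]])
      qed
      also have "\<dots> = N * (N * B) * norm (X - Y)" by simp
      also have "\<dots> \<le> K * norm (X - Y)" using KB(3) by (rule mult_right_mono) simp
      finally show ?thesis .
    qed
    show "uniform_limit UNIV V' (V' t) (at t within {0..\<tau>})"
    proof (rule uniform_limitI)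
      fix e :: real assume e: "e > 0"
      have e': "e / (N + 1) > 0" using e \<open>N \<ge> 0\<close> by simp
      have "\<forall>\<^sub>F s in at t within {0..\<epsilon>}. \<forall>X\<in>UNIV. dist (dpartial [b] (V s) X) (dpartial [b] (V t) X) < e / (N + 1)"
        if "b \<in> Basis" for b
      proof (rule uniform_limitD[OF _ e'])
        show "uniform_limit UNIV (\<lambda>s. dpartial [b] (V s)) (dpartial [b] (V t)) (at t within {0..\<epsilon>})"
          using vf t\<tau>(1)[OF t] that unfolding velocity_field_def by (elim conjE ballE[of _ _ t] allE[of _ "[b]"]) auto
      qed
      then have "\<forall>\<^sub>F s in at t within {0..\<epsilon>}. \<forall>b\<in>Basis. \<forall>X\<in>UNIV.
          dist (dpartial [b] (V s) X) (dpartial [b] (V t) X) < e / (N + 1)"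
        by (intro eventually_ball_finite) auto
      then have "\<forall>\<^sub>F s in at t within {0..\<tau>}. \<forall>b\<in>Basis. \<forall>X\<in>UNIV.
          dist (dpartial [b] (V s) X) (dpartial [b] (V t) X) < e / (N + 1)"
        using at_le[of "{0..\<tau>}" "{0..\<epsilon>}" t] \<tau> by (auto simp: le_filter_def)
      moreover have "\<forall>\<^sub>F s in at t within {0..\<tau>}. s \<in> {0..\<tau>}"
        by (auto simp: eventually_at_filter)
      ultimately show "\<forall>\<^sub>F s in at t within {0..\<tau>}. \<forall>X\<in>UNIV. dist (V' s X) (V' t X) < e"
      proof eventually_elim
        case (elim s)
        show ?case
        proof
          fix X
          have "norm (V' s X - V' t X) \<le> N * (e / (N + 1))"
            by (rule col) (use elim(1) in \<open>auto simp: blinfun.diff_left V'_apply[OF t\<tau>(1)[OF t]]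
              V'_apply[OF t\<tau>(1)[OF elim(2)]] dist_norm less_imp_le\<close>)
          also have "\<dots> < e" using e \<open>N \<ge> 0\<close> by (simp add: pos_divide_less_eq)
          finally show "dist (V' s X) (V' t X) < e" by (simp add: dist_norm)
        qed
      qed
    qed
  qed (use \<tau> in auto)
qed

lemma flow_near_identity:
  fixes V :: "real \<Rightarrow> 'a::euclidean_space \<Rightarrow> 'a"
  assumes vf: "velocity_field 2 \<epsilon> D V" and "\<epsilon> > 0" and fl: "is_flow \<epsilon> V x"
  obtains \<tau> M where "\<tau> > 0"
    "\<And>t. t \<in> {0..\<tau>} \<Longrightarrow> has_C1_derivative UNIV (x t) (M t)"
    "\<And>t X. t \<in> {0..\<tau>} \<Longrightarrow> norm (M t X - id_blinfun) \<le> 1/2"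
    "uniform_limit UNIV (\<lambda>t X. (M t X - id_blinfun) /\<^sub>R t)
       (\<lambda>X. Blinfun (frechet_derivative (V 0) (at X))) (at_right 0)"
    "bounded (range (\<lambda>X. Blinfun (frechet_derivative (V 0) (at X))))"
proof -
  let ?V' = "\<lambda>t X. Blinfun (frechet_derivative (V t) (at X))"
  obtain \<tau> K where \<tau>: "\<tau> > 0" "\<tau> \<le> \<epsilon>" "K * \<tau> \<le> 1/4"
    and est: "\<And>t X. t \<in> {0..\<tau>} \<Longrightarrow> (V t has_derivative ?V' t X) (at X)"
    "\<And>t X. t \<in> {0..\<tau>} \<Longrightarrow> norm (V t X) \<le> K"
    "\<And>t X. t \<in> {0..\<tau>} \<Longrightarrow> norm (?V' t X) \<le> K"
    "\<And>t X Y. t \<in> {0..\<tau>} \<Longrightarrow> norm (?V' t X - ?V' t Y) \<le> K * norm (X - Y)"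
    "\<And>t. t \<in> {0..\<tau>} \<Longrightarrow> uniform_limit UNIV ?V' (?V' t) (at t within {0..\<tau>})"
    using velocity_field_estimates[OF vf \<open>\<epsilon> > 0\<close>] by blast
  have fl': "((\<lambda>s. x s X) has_vector_derivative V t (x t X)) (at t within {0..\<tau>})" if "t \<in> {0..\<tau>}" for t X
  proof (rule has_vector_derivative_within_subset)
    show "((\<lambda>s. x s X) has_vector_derivative V t (x t X)) (at t within {0..\<epsilon>})"
      using fl that \<tau> by (auto simp: is_flow_def)
  qed (use \<tau> in auto)
  have x0: "x 0 X = X" for X using fl by (simp add: is_flow_def)
  obtain M where M:
    "\<And>t X. t \<in> {0..\<tau>} \<Longrightarrow> (x t has_derivative blinfun_apply (M t X)) (at X)"
    "\<And>t. t \<in> {0..\<tau>} \<Longrightarrow> continuous_on UNIV (M t)"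
    "\<And>t X. t \<in> {0..\<tau>} \<Longrightarrow> norm (M t X - id_blinfun) \<le> 1/2"
    "uniform_limit UNIV (\<lambda>t X. (M t X - id_blinfun) /\<^sub>R t) (?V' 0) (at_right 0)"
    using flow_derivative[OF est \<tau>(3,1) x0 fl'] by blast
  show thesis
  proof (rule that[OF \<tau>(1)])
    show "has_C1_derivative UNIV (x t) (M t)" if "t \<in> {0..\<tau>}" for t
      using M(1,2)[OF that] by (auto simp: has_C1_derivative_def)
    show "bounded (range (?V' 0))"
      using est(3)[of 0] \<tau>(1) by (auto simp: bounded_iff)
  qed (fact M(3,4))+
qed

text \<open>The map \<open>X \<mapsto> X - T X\<close> is a contraction with constant \<open>1/2\<close>. Hence \<open>T\<close> shrinks distances by at most the factor \<open>1/2\<close>, and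
\<open>T X = Y\<close> is solved by the fixed point of \<open>X \<mapsto> Y + (X - T X)\<close>. The same lower bound makes the derivatives invertible, with
inverses of norm at most \<open>2\<close> that depend continuously on the point.\<close>

lemma near_identity_diffeomorphism:
  fixes T :: "'a::euclidean_space \<Rightarrow> 'a"
  assumes T: "has_C1_derivative UNIV T A" and near: "\<And>X. norm (A X - id_blinfun) \<le> 1/2"
  obtains S A' where "\<And>X. S (T X) = X" "\<And>Y. T (S Y) = Y" "has_C1_derivative UNIV S A'"
    "\<And>X. A' (T X) o\<^sub>L A X = id_blinfun" "\<And>X. A X o\<^sub>L A' (T X) = id_blinfun" "\<And>Y. norm (A' Y) \<le> 2"
proof -
  note derT = has_C1_derivativeD(1)[OF T UNIV_I] and contA = has_C1_derivativeD(2)[OF T]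
  define g where "g X = X - T X" for X
  have g: "norm (g X - g Y) \<le> 1/2 * norm (X - Y)" for X Y
  proof (rule differentiable_bound[of UNIV g "\<lambda>X. blinfun_apply (id_blinfun - A X)"])
    fix X
    show "(g has_derivative blinfun_apply (id_blinfun - A X)) (at X)"
      unfolding g_def by (auto intro!: derivative_eq_intros derT simp: blinfun.diff_left)
    show "onorm (blinfun_apply (id_blinfun - A X)) \<le> 1/2"
      using near[of X] by (simp add: norm_blinfun.rep_eq[symmetric] norm_minus_commute)
  qed auto
  have expand: "norm (X - Y) \<le> 2 * norm (T X - T Y)" for X Y
    using g[of X Y] norm_triangle_ineq[of "g X - g Y" "T X - T Y"] by (simp add: g_def)
  have surj: "\<exists>X. T X = Y" for Y
  proof -
    have "\<exists>!X. Y + g X = X"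
      by (rule banach_fix_type[of "1/2"]) (use g in \<open>auto simp: dist_norm\<close>)
    then obtain X where "Y + g X = X" by blast
    then have "T X = Y" by (simp add: g_def algebra_simps)
    then show ?thesis by blast
  qed
  then obtain S where TS: "\<And>Y. T (S Y) = Y" by metis
  have ST: "S (T X) = X" for X using expand[of "S (T X)" X] by (simp add: TS)
  have Slip: "2-lipschitz_on UNIV S"
    using expand[of "S _" "S _"] by (intro lipschitz_onI) (auto simp: TS dist_norm)
  then have contS: "continuous_on UNIV S" by (rule lipschitz_on_continuous_on)
  have low: "norm h \<le> 2 * norm (A X h)" for X h
  proof -
    have "norm ((id_blinfun - A X) h) \<le> 1/2 * norm h"
      using norm_blinfun[of "id_blinfun - A X" h] mult_right_mono[OF near[of X] norm_ge_zero[of h]]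
      by (simp add: norm_minus_commute)
    then show ?thesis using norm_triangle_ineq[of "(id_blinfun - A X) h" "A X h"] by (simp add: blinfun.diff_left)
  qed
  have "\<exists>B. B o\<^sub>L A X = id_blinfun \<and> A X o\<^sub>L B = id_blinfun" for X
  proof -
    have lin: "linear (blinfun_apply (A X))" using bounded_linear.linear blinfun.bounded_linear_right by blast
    moreover have "inj (blinfun_apply (A X))"
      unfolding linear_injective_0[OF lin] using low[where X = X] by (metis mult_zero_right norm_le_zero_iff norm_zero)
    ultimately obtain f where f: "linear f" "\<And>h. f (A X h) = h" "\<And>h. A X (f h) = h"
      using linear_injective_isomorphism by metis
    have "blinfun_apply (Blinfun f) = f"
      by (rule bounded_linear_Blinfun_apply) (simp add: f(1) linear_conv_bounded_linear[symmetric])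
    then have "Blinfun f o\<^sub>L A X = id_blinfun" "A X o\<^sub>L Blinfun f = id_blinfun"
      by (auto intro!: blinfun_eqI simp: f)
    then show ?thesis by blast
  qed
  then obtain I where I: "\<And>X. I X o\<^sub>L A X = id_blinfun" "\<And>X. A X o\<^sub>L I X = id_blinfun" by metis
  have AI: "A X (I X h) = h" and IA: "I X (A X h) = h" for X h
    using arg_cong[OF I(2)[of X], of "\<lambda>f. blinfun_apply f h"] arg_cong[OF I(1)[of X], of "\<lambda>f. blinfun_apply f h"] by simp_all
  have I2: "norm (I X) \<le> 2" for X
    using low[of "I X _" X] by (intro norm_blinfun_bound) (auto simp: AI)
  have Icont: "continuous_on UNIV I"
    unfolding continuous_on_def
  proof
    fix X
    have "((\<lambda>Y. I Y - I X) \<longlongrightarrow> 0) (at X)"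
    proof (rule Lim_null_comparison[where g = "\<lambda>Y. 4 * norm (A Y - A X)"])
      have "((\<lambda>Y. 4 * norm (A Y - A X)) \<longlongrightarrow> 4 * norm (A X - A X)) (at X)"
        using contA by (intro tendsto_intros) (auto simp: continuous_on_def)
      then show "((\<lambda>Y. 4 * norm (A Y - A X)) \<longlongrightarrow> 0) (at X)" by simp
      have "norm (I Y - I X) \<le> 4 * norm (A Y - A X)" for Y
      proof -
        \<comment> \<open>The resolvent identity reduces continuity of the inverse to continuity of \<open>A\<close>.\<close>
        have "I Y - I X = I Y o\<^sub>L ((A X - A Y) o\<^sub>L I X)"
          by (rule blinfun_eqI) (simp add: blinfun.diff_left blinfun.diff_right AI IA)
        also have "norm \<dots> \<le> norm (I Y) * (norm (A X - A Y) * norm (I X))"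
          by (intro order_trans[OF norm_blinfun_compose] mult_left_mono norm_blinfun_compose) auto
        also have "\<dots> \<le> 2 * (norm (A X - A Y) * 2)"
          by (intro mult_mono I2 mult_left_mono) auto
        finally show ?thesis by (simp add: norm_minus_commute)
      qed
      then show "\<forall>\<^sub>F Y in at X. norm (I Y - I X) \<le> 4 * norm (A Y - A X)" by simp
    qed
    then show "(I \<longlongrightarrow> I X) (at X)" by (simp add: LIM_zero_iff)
  qed
  show thesis
  proof (rule that[of S "\<lambda>Y. I (S Y)"])
    show "has_C1_derivative UNIV S (\<lambda>Y. I (S Y))"
    proof (rule has_C1_derivativeI)
      show "continuous_on UNIV (\<lambda>Y. I (S Y))"
        by (rule continuous_on_compose2[OF Icont contS]) auto
      show "(S has_derivative blinfun_apply (I (S Y))) (at Y)" for Y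
      proof (rule has_derivative_inverse_basic[OF derT, where T = UNIV])
        show "blinfun_apply (I (S Y)) \<circ> blinfun_apply (A (S Y)) = id" by (auto simp: IA)
        show "continuous (at Y) S" using contS by (simp add: continuous_on_eq_continuous_at)
      qed (auto simp: TS blinfun.bounded_linear_right)
    qed
  qed (simp_all add: ST TS I I2)
qed

section \<open>Normals and independence of extensions\<close>

text \<open>It depends on the line spanned by \<open>\<nu>\<close> only, so the normal, its negative and the gradient of a
defining function all give the same projection.\<close>

definition orth_part :: "'a::real_inner \<Rightarrow> 'a \<Rightarrow> 'a" where
  "orth_part \<nu> y = y - ((\<nu> \<bullet> y) / (\<nu> \<bullet> \<nu>)) *\<^sub>R \<nu>"

lemma orth_part_scaleR: "c \<noteq> 0 \<Longrightarrow> orth_part (c *\<^sub>R \<nu>) = orth_part \<nu>"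
  by (auto simp: orth_part_def fun_eq_iff)

lemma orth_part_add_multiple: "orth_part \<nu> (y + c *\<^sub>R \<nu>) = orth_part \<nu> y"
  by (cases "\<nu> = 0") (auto simp: orth_part_def inner_add_right add_divide_distrib scaleR_add_left)

lemma orth_part_inner_swap: "orth_part \<nu> a \<bullet> b = a \<bullet> orth_part \<nu> b"
  by (simp add: orth_part_def inner_diff_left inner_diff_right inner_commute)

lemma orth_part_orthogonal: "\<nu> \<bullet> orth_part \<nu> y = 0"
  by (cases "\<nu> = 0") (auto simp: orth_part_def inner_diff_right)

lemma orth_part_id: "\<nu> \<bullet> y = 0 \<Longrightarrow> orth_part \<nu> y = y"
  by (simp add: orth_part_def)

lemma orth_part_unit: "norm \<nu> = 1 \<Longrightarrow> orth_part \<nu> y = y - (\<nu> \<bullet> y) *\<^sub>R \<nu>"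
  by (simp add: orth_part_def dot_square_norm)

lemma multiple_if_annihilates_orthogonal:
  assumes "\<And>h. a \<bullet> h = 0 \<Longrightarrow> b \<bullet> h = 0"
  shows "b = ((a \<bullet> b) / (a \<bullet> a)) *\<^sub>R a"
proof -
  have "b \<bullet> orth_part a b = 0" by (rule assms[OF orth_part_orthogonal])
  then have "orth_part a b \<bullet> orth_part a b = 0"
    by (simp add: orth_part_inner_swap orth_part_id[OF orth_part_orthogonal])
  then have "orth_part a b = 0" by simp
  then show ?thesis by (simp add: orth_part_def)
qed

lemma has_derivative_gradient:
  fixes F :: "'a::euclidean_space \<Rightarrow> real"
  assumes "(F has_derivative F') (at X)"
  shows "gradient F X \<bullet> h = F' h" and "gradient F X = (\<Sum>b\<in>Basis. F' b *\<^sub>R b)"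
proof -
  let ?D = "\<Sum>b\<in>Basis. F' b *\<^sub>R b"
  have lin: "linear F'" using assms has_derivative_linear by blast
  have F': "F' h = ?D \<bullet> h" for h
  proof -
    have "F' h = F' (\<Sum>b\<in>Basis. (h \<bullet> b) *\<^sub>R b)" by (simp add: euclidean_representation)
    also have "\<dots> = (\<Sum>b\<in>Basis. (h \<bullet> b) * F' b)"
      by (simp add: linear_sum[OF lin] linear_scale[OF lin])
    finally show ?thesis by (simp add: inner_sum_left inner_commute[of h] mult.commute)
  qed
  have "F' = (\<lambda>h. h \<bullet> ?D)" by (rule ext, subst inner_commute, rule F')
  then have G: "GDERIV F X :> ?D"
    using assms unfolding gderiv_def by (rule has_derivative_eq_rhs[rotated])
  have "D = ?D" if "GDERIV F X :> D" for D
  proof -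
    have "(\<lambda>h. h \<bullet> D) = (\<lambda>h. h \<bullet> ?D)"
      using has_derivative_unique[OF that[unfolded gderiv_def] G[unfolded gderiv_def]] .
    then have "\<forall>h. h \<bullet> D = h \<bullet> ?D" by (rule fun_cong[THEN allI])
    then show ?thesis by (rule vector_eq_ldot[THEN iffD1])
  qed
  then show *: "gradient F X = ?D" unfolding gradient_def using G by (rule the_equality[rotated])
  show "gradient F X \<bullet> h = F' h" unfolding * by (rule F'[symmetric])
qed

lemma Ck_on_1_gradient:
  assumes f': "has_C1_derivative U F f'" "Ck_on 1 U f'" and "open U"
  shows "Ck_on 1 U (gradient F)"
proof -
  have "bounded_linear (\<lambda>L :: 'a \<Rightarrow>\<^sub>L real. \<Sum>b\<in>Basis. blinfun_apply L b *\<^sub>R b)"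
    by (intro bounded_linear_intros)
  from Ck_on_1_bounded_linear[OF this f'(2)] show ?thesis
    by (rule Ck_on_1_cong[OF _ \<open>open U\<close>])
       (simp add: has_derivative_gradient(2)[OF has_C1_derivativeD(1)[OF f'(1)]])
qed

text \<open>A tangent vector \<open>h\<close> is approximated by secants of the zero set. Let \<open>k\<close> be
transversal, \<open>\<phi>' k = 1\<close>. For small \<open>t\<close> the function \<open>\<phi>\<close> changes sign along the segment \<open>X + t (h + s k)\<close>,
\<open>|s| \<le> \<delta>\<close>, so it has a zero there, and \<open>F\<close> vanishes at that zero. Hence \<open>F' h\<close> is at most of the order of \<open>\<delta>\<close>, and \<open>\<delta>\<close>
is arbitrarily small.\<close>

lemma derivative_vanishes_on_tangent:
  fixes \<phi> :: "'a::real_normed_vector \<Rightarrow> real" and F :: "'a \<Rightarrow> 'b::real_normed_vector"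
  assumes "open U" "X \<in> U" "continuous_on U \<phi>" "\<phi> X = 0"
    and \<phi>': "(\<phi> has_derivative \<phi>') (at X)" and "\<phi>' \<nu> \<noteq> 0"
    and F': "(F has_derivative F') (at X)"
    and F0: "\<And>Y. Y \<in> U \<Longrightarrow> \<phi> Y = 0 \<Longrightarrow> F Y = 0"
    and "\<phi>' h = 0"
  shows "F' h = 0"
proof (rule ccontr)
  assume "F' h \<noteq> 0"
  interpret \<phi>': bounded_linear \<phi>' using \<phi>' by (rule has_derivative_bounded_linear)
  interpret F': bounded_linear F' using F' by (rule has_derivative_bounded_linear)
  define k where "k = \<nu> /\<^sub>R \<phi>' \<nu>"
  have k: "\<phi>' k = 1" using \<open>\<phi>' \<nu> \<noteq> 0\<close> by (simp add: k_def \<phi>'.scaleR)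
  define \<eta> where "\<eta> = norm (F' h)"
  have \<eta>: "\<eta> > 0" using \<open>F' h \<noteq> 0\<close> by (simp add: \<eta>_def)
  \<comment> \<open>So small that the transversal part contributes at most a quarter of \<open>|F' h|\<close>.\<close>
  define \<delta> where "\<delta> = min 1 (\<eta> / (4 * (norm (F' k) + 1)))"
  have p: "norm (F' k) + 1 > 0" by (simp add: add_nonneg_pos)
  have \<delta>: "\<delta> > 0" "\<delta> \<le> 1" "\<delta> * norm (F' k) \<le> \<eta> / 4"
  proof -
    show "\<delta> > 0" "\<delta> \<le> 1" using \<eta> p by (auto simp: \<delta>_def)
    have "\<delta> * norm (F' k) \<le> (\<eta> / (4 * (norm (F' k) + 1))) * (norm (F' k) + 1)"
      using \<eta> p by (intro mult_mono) (auto simp: \<delta>_def)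
    also have "\<dots> = \<eta> / 4" using p by (simp add: divide_simps)
    finally show "\<delta> * norm (F' k) \<le> \<eta> / 4" .
  qed
  define c where "c = norm h + norm k + 1"
  have c: "c > 0" by (simp add: c_def add_nonneg_pos)
  have "\<delta> / (2 * c) > 0" using \<delta> c by simp
  then obtain d1 where d1: "d1 > 0"
    "\<And>Y. norm (Y - X) < d1 \<Longrightarrow> norm (\<phi> Y - \<phi> X - \<phi>' (Y - X)) \<le> \<delta> / (2 * c) * norm (Y - X)"
    using \<phi>' unfolding has_derivative_at_alt by meson
  have "\<eta> / (4 * c) > 0" using \<eta> c by simp
  then obtain d2 where d2: "d2 > 0"
    "\<And>Y. norm (Y - X) < d2 \<Longrightarrow> norm (F Y - F X - F' (Y - X)) \<le> \<eta> / (4 * c) * norm (Y - X)"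
    using F' unfolding has_derivative_at_alt by meson
  obtain r where r: "r > 0" "ball X r \<subseteq> U" using assms(1,2) openE by blast
  define t where "t = min r (min d1 d2) / (2 * c)"
  have m: "min r (min d1 d2) > 0" using r d1 d2 by simp
  have t: "t > 0" using m c by (simp add: t_def)
  have "t * c = min r (min d1 d2) / 2" using c by (simp add: t_def)
  then have tc: "t * c < r" "t * c < d1" "t * c < d2" using m by linarith+
  define Y where "Y s = X + t *\<^sub>R (h + s *\<^sub>R k)" for s
  have nY: "norm (Y s - X) \<le> t * c" if "\<bar>s\<bar> \<le> \<delta>" for s
  proof -
    have "norm (h + s *\<^sub>R k) \<le> norm h + \<bar>s\<bar> * norm k"
      using norm_triangle_ineq[of h "s *\<^sub>R k"] by simp
    also have "\<bar>s\<bar> * norm k \<le> 1 * norm k" using that \<delta> by (intro mult_right_mono) auto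
    finally have "norm (h + s *\<^sub>R k) \<le> c" by (simp add: c_def)
    then show ?thesis using t by (simp add: Y_def)
  qed
  have YU: "Y s \<in> U" if "\<bar>s\<bar> \<le> \<delta>" for s
    using nY[OF that] tc(1) r(2) by (auto simp: subset_iff dist_norm norm_minus_commute)
  have \<phi>Y: "\<bar>\<phi> (Y s) - t * s\<bar> \<le> t * \<delta> / 2" if "\<bar>s\<bar> \<le> \<delta>" for s
  proof -
    have "\<bar>\<phi> (Y s) - t * s\<bar> = norm (\<phi> (Y s) - \<phi> X - \<phi>' (Y s - X))"
      by (simp add: Y_def \<phi>'.scaleR \<phi>'.add k \<open>\<phi>' h = 0\<close> \<open>\<phi> X = 0\<close>)
    also have "\<dots> \<le> \<delta> / (2 * c) * norm (Y s - X)" using nY[OF that] tc(2) by (intro d1(2)) simp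
    also have "\<dots> \<le> \<delta> / (2 * c) * (t * c)" using \<delta> c by (intro mult_left_mono nY that) auto
    also have "\<dots> = t * \<delta> / 2" using c by simp
    finally show ?thesis .
  qed
  have "\<exists>s\<ge>-\<delta>. s \<le> \<delta> \<and> \<phi> (Y s) = 0"
  proof (rule IVT')
    have "t * \<delta> > 0" using t \<delta> by simp
    moreover have "\<bar>\<phi> (Y \<delta>) - t * \<delta>\<bar> \<le> t * \<delta> / 2" "\<bar>\<phi> (Y (- \<delta>)) + t * \<delta>\<bar> \<le> t * \<delta> / 2"
      using \<phi>Y[of \<delta>] \<phi>Y[of "- \<delta>"] \<delta> by simp_all
    ultimately show "\<phi> (Y (- \<delta>)) \<le> 0" "0 \<le> \<phi> (Y \<delta>)" by linarith+
    show "continuous_on {- \<delta>..\<delta>} (\<lambda>s. \<phi> (Y s))"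
      by (rule continuous_on_compose2[OF \<open>continuous_on U \<phi>\<close>])
         (auto simp: Y_def[abs_def] intro!: continuous_intros YU[unfolded Y_def])
  qed (use \<delta> in simp)
  then obtain s where s: "\<bar>s\<bar> \<le> \<delta>" "\<phi> (Y s) = 0" by (metis abs_le_iff minus_le_iff)
  have "F (Y s) = 0" "F X = 0" using F0 YU[OF s(1)] s(2) assms(2,4) by auto
  then have "norm (F' (Y s - X)) \<le> \<eta> / (4 * c) * norm (Y s - X)"
    using d2(2)[of "Y s"] nY[OF s(1)] tc(3) by simp
  also have "\<dots> \<le> \<eta> / (4 * c) * (t * c)" using \<eta> c by (intro mult_left_mono nY s) auto
  also have "\<dots> = t * (\<eta> / 4)" using c by simp
  also have "norm (F' (Y s - X)) = t * norm (F' h + s *\<^sub>R F' k)"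
    using t by (simp add: Y_def F'.scaleR F'.add)
  finally have "norm (F' h + s *\<^sub>R F' k) \<le> \<eta> / 4" using t by (rule mult_left_le_imp_le)
  moreover have "norm (s *\<^sub>R F' k) \<le> \<eta> / 4"
    using order_trans[OF mult_right_mono[OF s(1) norm_ge_zero] \<delta>(3)] by simp
  moreover have "\<eta> \<le> norm (F' h + s *\<^sub>R F' k) + norm (s *\<^sub>R F' k)"
    unfolding \<eta>_def using norm_triangle_ineq4[of "F' h + s *\<^sub>R F' k" "s *\<^sub>R F' k"] by simp
  ultimately show False using \<eta> by linarith
qed

lemma local_definingD:
  assumes "local_defining 1 \<Omega> X U \<phi>"
  shows "open U" "X \<in> U" "continuous_on U \<phi>" "Ck_on 1 U \<phi>"
    "\<And>Y. Y \<in> U \<Longrightarrow> gradient \<phi> Y \<noteq> 0"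
    "\<And>Y. Y \<in> U \<Longrightarrow> (\<phi> has_derivative (\<lambda>h. gradient \<phi> Y \<bullet> h)) (at Y)"
    "\<And>Y. Y \<in> U \<Longrightarrow> Y \<in> \<Omega> \<longleftrightarrow> \<phi> Y < 0" "\<And>Y. Y \<in> U \<Longrightarrow> Y \<in> frontier \<Omega> \<longleftrightarrow> \<phi> Y = 0"
proof -
  note d = assms[unfolded local_defining_def]
  show "open U" "X \<in> U" and C: "Ck_on 1 U \<phi>" and "\<And>Y. Y \<in> U \<Longrightarrow> gradient \<phi> Y \<noteq> 0"
    using d by auto
  show "continuous_on U \<phi>" by (rule Ck_on_1_continuous[OF C])
  show "Y \<in> U \<Longrightarrow> (\<phi> has_derivative (\<lambda>h. gradient \<phi> Y \<bullet> h)) (at Y)" for Y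
    using has_C1_derivativeD(1)[OF Ck_on_1_canonical[OF C]] has_derivative_gradient(1)
    by (metis (no_types, lifting) ext)
  show "Y \<in> U \<Longrightarrow> Y \<in> \<Omega> \<longleftrightarrow> \<phi> Y < 0" "Y \<in> U \<Longrightarrow> Y \<in> frontier \<Omega> \<longleftrightarrow> \<phi> Y = 0" for Y
    using d by blast+
qed

lemma local_defining_2_imp_1: "local_defining 2 \<Omega> X U \<phi> \<Longrightarrow> local_defining 1 \<Omega> X U \<phi>"
  by (auto simp: local_defining_def intro: Ck_on_mono)

lemma derivative_vanishes_on_tangent_boundary:
  assumes loc: "local_defining 1 \<Omega> X U \<phi>" and X: "X \<in> frontier \<Omega>"
    and F': "(F has_derivative F') (at X)"
    and "open W" "X \<in> W" and F0: "\<And>Y. Y \<in> W \<Longrightarrow> Y \<in> frontier \<Omega> \<Longrightarrow> F Y = 0"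
    and h: "gradient \<phi> X \<bullet> h = 0"
  shows "F' h = 0"
proof (rule derivative_vanishes_on_tangent[where U = "U \<inter> W" and \<nu> = "gradient \<phi> X"])
  note d = local_definingD[OF loc]
  show "open (U \<inter> W)" "X \<in> U \<inter> W" using d assms by auto
  show "continuous_on (U \<inter> W) \<phi>" using d(3) continuous_on_subset by blast
  show "\<phi> X = 0" using d(8)[OF d(2)] X by simp
  show "(\<phi> has_derivative (\<lambda>h. gradient \<phi> X \<bullet> h)) (at X)" using d by blast
  show "gradient \<phi> X \<bullet> gradient \<phi> X \<noteq> 0" using d(5)[OF d(2)] by simp
  show "F Y = 0" if "Y \<in> U \<inter> W" "\<phi> Y = 0" for Y using F0 d(8) that by auto
qed (fact F' h)+

lemma defining_gradients_parallel:
  assumes 1: "local_defining 1 \<Omega> X U \<phi>" and 2: "local_defining 1 \<Omega>' X U' \<psi>"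
    and fr: "frontier \<Omega>' = frontier \<Omega>" and X: "X \<in> frontier \<Omega>"
  obtains c where "c \<noteq> 0" "gradient \<psi> X = c *\<^sub>R gradient \<phi> X"
proof -
  note d = local_definingD[OF 2]
  have par: "gradient \<psi> X = ((gradient \<phi> X \<bullet> gradient \<psi> X) / (gradient \<phi> X \<bullet> gradient \<phi> X)) *\<^sub>R gradient \<phi> X"
  proof (rule multiple_if_annihilates_orthogonal)
    fix h assume h: "gradient \<phi> X \<bullet> h = 0"
    show "gradient \<psi> X \<bullet> h = 0"
      by (rule derivative_vanishes_on_tangent_boundary[OF 1 X, where F = \<psi> and F' = "\<lambda>h. gradient \<psi> X \<bullet> h",
            OF d(6)[OF d(2)] d(1,2)])
         (use d fr h in auto)
  qed
  with d(5)[OF d(2)] show thesis by (intro that) auto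
qed

text \<open>Gradients of two defining functions of the same domain are parallel. They point in the same direction, for otherwise
moving from \<open>X\<close> against one gradient would enter \<open>\<Omega>\<close> according to one function and leave it according to the other.\<close>

lemma outward_normal_eq:
  assumes 1: "local_defining 1 \<Omega> X U \<phi>" and X: "X \<in> frontier \<Omega>"
  shows "outward_normal \<Omega> X = sgn (gradient \<phi> X)"
  unfolding outward_normal_def
proof (rule the_equality)
  fix n assume "\<exists>U \<phi>. local_defining 1 \<Omega> X U \<phi> \<and> n = sgn (gradient \<phi> X)"
  then obtain U' \<psi> where 2: "local_defining 1 \<Omega> X U' \<psi>" and n: "n = sgn (gradient \<psi> X)" by blast
  note d = local_definingD[OF 1] and e = local_definingD[OF 2]
  obtain c where c: "c \<noteq> 0" "gradient \<psi> X = c *\<^sub>R gradient \<phi> X"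
    using defining_gradients_parallel[OF 1 2 refl X] .
  let ?g = "gradient \<phi> X"
  have g: "?g \<bullet> ?g > 0" using d(5)[OF d(2)] by simp
  have X0: "\<phi> X = 0" "\<psi> X = 0" using d(2,8) e(2,8) X by auto
  have "c > 0"
  proof (rule ccontr)
    assume "\<not> c > 0"
    then have "c < 0" using c by simp
    have line: "((\<lambda>t. X - t *\<^sub>R ?g) \<longlongrightarrow> X - 0 *\<^sub>R ?g) (at_right 0)" by (intro tendsto_intros)
    have slope: "\<forall>\<^sub>F t in at_right 0. f (X - t *\<^sub>R ?g) * s < 0"
      if f: "(f has_derivative (\<lambda>h. (s *\<^sub>R ?g) \<bullet> h)) (at X)" "f X = 0" "s \<noteq> 0" for f :: "'a \<Rightarrow> real" and s
    proof -
      have "((\<lambda>t. X - t *\<^sub>R ?g) has_derivative (\<lambda>t. - (t *\<^sub>R ?g))) (at 0)"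
        by (auto intro!: derivative_eq_intros)
      from has_derivative_compose[OF this, of f "\<lambda>h. (s *\<^sub>R ?g) \<bullet> h"] f(1)
      have "((\<lambda>t. f (X - t *\<^sub>R ?g)) has_derivative (\<lambda>t. (s *\<^sub>R ?g) \<bullet> - (t *\<^sub>R ?g))) (at 0)" by simp
      then have "((\<lambda>t. f (X - t *\<^sub>R ?g)) has_real_derivative (- s * (?g \<bullet> ?g))) (at 0)"
        unfolding has_field_derivative_def
        by (rule has_derivative_eq_rhs) (simp_all add: fun_eq_iff mult_ac)
      then have "((\<lambda>t. f (X - t *\<^sub>R ?g) * s) has_real_derivative (- s * (?g \<bullet> ?g)) * s) (at 0)"
        by (rule DERIV_cmult_right)
      moreover have "(- s * (?g \<bullet> ?g)) * s < 0"
      proof -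
        have "(s * s) * (?g \<bullet> ?g) > 0" using g f(3) by (metis mult_pos_pos not_real_square_gt_zero)
        then show ?thesis by (simp add: mult_ac)
      qed
      ultimately have "\<exists>d>0. \<forall>t>0. t < d \<longrightarrow> f (X - (0 + t) *\<^sub>R ?g) * s < f (X - 0 *\<^sub>R ?g) * s"
        by (rule DERIV_neg_dec_right)
      then show ?thesis unfolding eventually_at_right_field using f(2) by simp
    qed
    have "\<forall>\<^sub>F t in at_right 0. \<phi> (X - t *\<^sub>R ?g) * 1 < 0"
      using d(6)[OF d(2)] X0 by (intro slope) auto
    moreover have "\<forall>\<^sub>F t in at_right 0. \<psi> (X - t *\<^sub>R ?g) * c < 0"
      using e(6)[OF e(2)] X0 c by (intro slope) auto
    moreover have "\<forall>\<^sub>F t in at_right 0. X - t *\<^sub>R ?g \<in> U \<inter> U'"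
      using line d(1,2) e(1,2) by (intro topological_tendstoD[OF line]) auto
    ultimately have "\<forall>\<^sub>F t :: real in at_right 0. False"
    proof eventually_elim
      case (elim t)
      then have "\<psi> (X - t *\<^sub>R ?g) > 0" using \<open>c < 0\<close> by (simp add: mult_less_0_iff)
      then show False using elim d(7)[of "X - t *\<^sub>R ?g"] e(7)[of "X - t *\<^sub>R ?g"] by auto
    qed
    then show False by simp
  qed
  then show "n = sgn ?g" by (simp add: n c sgn_scaleR)
qed (use 1 in blast)

lemma enclosed_domain:
  assumes "Ck_domain 1 \<Omega>"
  shows "Ck_domain 1 (enclosed_domain (frontier \<Omega>))"
    "frontier (enclosed_domain (frontier \<Omega>)) = frontier \<Omega>"
  using someI[of "\<lambda>\<Omega>'. Ck_domain 1 \<Omega>' \<and> frontier \<Omega>' = frontier \<Omega>" \<Omega>] assms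
  unfolding enclosed_domain_def by auto

text \<open>The enclosed domain is a choice and might differ from \<open>\<Omega>\<close>. It has the same boundary, so its normal is parallel to the
gradient of a defining function of \<open>\<Omega>\<close>; its sign is irrelevant for the projection.\<close>

lemma normal_parallel_gradient:
  assumes "Ck_domain 1 \<Omega>" and loc: "local_defining 1 \<Omega> X U \<phi>" and X: "X \<in> frontier \<Omega>"
  shows "norm (normal (frontier \<Omega>) X) = 1"
    "orth_part (normal (frontier \<Omega>) X) = orth_part (gradient \<phi> X)"
proof -
  let ?E = "enclosed_domain (frontier \<Omega>)"
  note E = enclosed_domain[OF assms(1)]
  obtain U' \<psi> where 2: "local_defining 1 ?E X U' \<psi>"
    using E X unfolding Ck_domain_def by metis
  have n: "normal (frontier \<Omega>) X = sgn (gradient \<psi> X)"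
    by (rule outward_normal_eq[OF 2]) (use E X in simp)
  have nz: "gradient \<psi> X \<noteq> 0" using local_definingD[OF 2] by blast
  obtain c where c: "c \<noteq> 0" "gradient \<psi> X = c *\<^sub>R gradient \<phi> X"
    using defining_gradients_parallel[OF loc 2 E(2) X] .
  show "norm (normal (frontier \<Omega>) X) = 1" by (simp add: n norm_sgn nz)
  have "sgn (gradient \<psi> X) = (inverse (norm (gradient \<psi> X)) * c) *\<^sub>R gradient \<phi> X"
    by (simp add: sgn_div_norm c)
  moreover have "inverse (norm (gradient \<psi> X)) * c \<noteq> 0" using nz c by simp
  ultimately show "orth_part (normal (frontier \<Omega>) X) = orth_part (gradient \<phi> X)"
    by (simp add: n orth_part_scaleR)
qed

lemma Ck_extension_some:
  assumes "Ck_boundary k \<Gamma> f"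
  shows "Ck_extension k \<Gamma> f (SOME F. Ck_extension k \<Gamma> f F)"
  using assms unfolding Ck_boundary_def by (rule someI_ex)

lemma Ck_extension_1_derivative:
  assumes "Ck_extension 1 \<Gamma> f F" "X \<in> \<Gamma>"
  shows "(F has_derivative frechet_derivative F (at X)) (at X)"
proof -
  obtain U where "open U" "\<Gamma> \<subseteq> U" "Ck_on 1 U F" using assms by (auto simp: Ck_extension_def)
  then obtain f' where "has_C1_derivative U F f'" using Ck_on_1E by blast
  then have "F differentiable at X" using \<open>\<Gamma> \<subseteq> U\<close> assms(2) has_C1_derivativeD(1) by (metis differentiable_def subsetD)
  then show ?thesis by (simp add: frechet_derivative_works)
qed

text \<open>The difference of the chosen extension and \<open>W\<close> vanishes on the boundary near \<open>X\<close>, hence so does its derivative on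
tangent vectors. As \<open>W\<close> extends \<open>w\<close> only near \<open>X\<close>, the formula covers local extensions such as
\<open>\<nabla>\<phi> / |\<nabla>\<phi>|\<close> for the normal.\<close>

lemma tderiv_eq:
  assumes dom: "Ck_domain 1 \<Omega>" and loc: "local_defining 1 \<Omega> X U \<phi>" and X: "X \<in> frontier \<Omega>"
    and w: "Ck_boundary 1 (frontier \<Omega>) w"
    and W': "(W has_derivative W') (at X)"
    and O: "open O'" "X \<in> O'" "\<And>Y. Y \<in> O' \<Longrightarrow> Y \<in> frontier \<Omega> \<Longrightarrow> W Y = w Y"
  shows "tderiv (frontier \<Omega>) w X h = W' (orth_part (gradient \<phi> X) h)"
proof -
  define E where "E = (SOME W. Ck_extension 1 (frontier \<Omega>) w W)"
  let ?D = "frechet_derivative E (at X)"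
  have E: "Ck_extension 1 (frontier \<Omega>) w E" unfolding E_def by (rule Ck_extension_some[OF w])
  have D: "(E has_derivative ?D) (at X)" by (rule Ck_extension_1_derivative[OF E X])
  interpret D: bounded_linear ?D using D by (rule has_derivative_bounded_linear)
  note n = normal_parallel_gradient[OF dom loc X]
  let ?n = "normal (frontier \<Omega>) X"
  have "tderiv (frontier \<Omega>) w X h = ?D (orth_part ?n h)"
    unfolding tderiv_def Let_def E_def[symmetric] orth_part_unit[OF n(1)]
    by (simp add: D.diff D.scaleR)
  also have "\<dots> = ?D (orth_part (gradient \<phi> X) h)" by (simp add: n(2))
  also have "(\<lambda>h. ?D h - W' h) (orth_part (gradient \<phi> X) h) = 0"
    by (rule derivative_vanishes_on_tangent_boundary[OF loc X has_derivative_diff[OF D W'] O(1,2)])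
       (use E O in \<open>auto simp: Ck_extension_def orth_part_orthogonal\<close>)
  then have "?D (orth_part (gradient \<phi> X) h) = W' (orth_part (gradient \<phi> X) h)" by simp
  finally show ?thesis .
qed

lemma tgrad_inner_eq_tderiv:
  assumes "Ck_domain 1 \<Omega>" "X \<in> frontier \<Omega>" "Ck_boundary 1 (frontier \<Omega>) f"
  shows "tgrad (frontier \<Omega>) f X \<bullet> h = tderiv (frontier \<Omega>) f X h"
proof -
  define E where "E = (SOME F. Ck_extension 1 (frontier \<Omega>) f F)"
  have E: "Ck_extension 1 (frontier \<Omega>) f E" unfolding E_def by (rule Ck_extension_some[OF assms(3)])
  note D = has_derivative_gradient(1)[OF Ck_extension_1_derivative[OF E assms(2)]]
  show ?thesis
    unfolding tderiv_def tgrad_def Let_def E_def[symmetric] outer_def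
    by (simp add: D[symmetric] inner_diff_left inner_commute[of "normal (frontier \<Omega>) X" "gradient E X"])
qed

lemma tgrad_eq:
  assumes dom: "Ck_domain 1 \<Omega>" and loc: "local_defining 1 \<Omega> X U \<phi>" and X: "X \<in> frontier \<Omega>"
    and f: "Ck_boundary 1 (frontier \<Omega>) f"
    and F: "F differentiable (at X)"
    and O: "open O'" "X \<in> O'" "\<And>Y. Y \<in> O' \<Longrightarrow> Y \<in> frontier \<Omega> \<Longrightarrow> F Y = f Y"
  shows "tgrad (frontier \<Omega>) f X = orth_part (gradient \<phi> X) (gradient F X)"
proof (rule vector_eq_rdot[THEN iffD1], rule allI)
  fix h
  have F': "(F has_derivative frechet_derivative F (at X)) (at X)"
    using F frechet_derivative_works by blast
  have "tgrad (frontier \<Omega>) f X \<bullet> h = frechet_derivative F (at X) (orth_part (gradient \<phi> X) h)"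
    using tgrad_inner_eq_tderiv[OF dom X f] tderiv_eq[OF dom loc X f F' O] by simp
  then show "tgrad (frontier \<Omega>) f X \<bullet> h = orth_part (gradient \<phi> X) (gradient F X) \<bullet> h"
    by (simp add: orth_part_inner_swap has_derivative_gradient(1)[OF F'])
qed

section \<open>Tangential calculus on a fixed boundary\<close>

lemma compact_frontier_Ck_domain: "Ck_domain k \<Omega> \<Longrightarrow> compact (frontier \<Omega>)"
  by (simp add: Ck_domain_def compact_frontier_bounded)

lemma Ck_domain_2_imp_1: "Ck_domain 2 \<Omega> \<Longrightarrow> Ck_domain 1 \<Omega>"
  unfolding Ck_domain_def by (meson local_defining_2_imp_1)

lemma Ck_domainE:
  assumes "Ck_domain k \<Omega>" "X \<in> frontier \<Omega>"
  obtains U \<phi> where "local_defining k \<Omega> X U \<phi>"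
  using assms unfolding Ck_domain_def by metis

lemma local_defining_shift:
  "local_defining k \<Omega> X U \<phi> \<Longrightarrow> Y \<in> U \<Longrightarrow> local_defining k \<Omega> Y U \<phi>"
  by (simp add: local_defining_def)

lemma outward_normal_near:
  assumes "local_defining 1 \<Omega> X U \<phi>" "Y \<in> U" "Y \<in> frontier \<Omega>"
  shows "outward_normal \<Omega> Y = sgn (gradient \<phi> Y)"
  using outward_normal_eq[OF local_defining_shift] assms by blast

lemma outward_normal_unit:
  assumes "Ck_domain 1 \<Omega>" "X \<in> frontier \<Omega>"
  shows "norm (outward_normal \<Omega> X) = 1"
proof -
  obtain U \<phi> where loc: "local_defining 1 \<Omega> X U \<phi>" using assms by (rule Ck_domainE)
  then show ?thesis
    using local_definingD(5)[OF loc local_definingD(2)[OF loc]]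
    by (simp add: outward_normal_eq[OF loc assms(2)] norm_sgn)
qed

lemma orth_part_outward_normal:
  assumes loc: "local_defining 1 \<Omega> X U \<phi>" "X \<in> frontier \<Omega>"
  shows "orth_part (outward_normal \<Omega> X) = orth_part (gradient \<phi> X)"
proof -
  have "gradient \<phi> X \<noteq> 0" using local_definingD[OF loc(1)] by blast
  then have "inverse (norm (gradient \<phi> X)) \<noteq> 0" by simp
  then show ?thesis
    unfolding outward_normal_eq[OF assms] sgn_div_norm by (rule orth_part_scaleR)
qed

lemma tderiv_normal:
  assumes dom: "Ck_domain 1 \<Omega>" and X: "X \<in> frontier \<Omega>"
    and "Ck_boundary 1 (frontier \<Omega>) w" "(W has_derivative W') (at X)"
      "open O'" "X \<in> O'" "\<And>Y. Y \<in> O' \<Longrightarrow> Y \<in> frontier \<Omega> \<Longrightarrow> W Y = w Y"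
  shows "tderiv (frontier \<Omega>) w X h = W' (orth_part (outward_normal \<Omega> X) h)"
proof -
  obtain U \<phi> where loc: "local_defining 1 \<Omega> X U \<phi>" using dom X by (rule Ck_domainE)
  show ?thesis
    unfolding orth_part_outward_normal[OF loc X] by (rule tderiv_eq[OF dom loc X assms(3-)])
qed

lemma tderiv_extension:
  assumes dom: "Ck_domain 1 \<Omega>" and X: "X \<in> frontier \<Omega>"
    and W: "Ck_extension 1 (frontier \<Omega>) w W"
  shows "tderiv (frontier \<Omega>) w X h = frechet_derivative W (at X) (orth_part (outward_normal \<Omega> X) h)"
  by (rule tderiv_normal[OF dom X _ Ck_extension_1_derivative[OF W X], of _ UNIV])
     (use W in \<open>auto simp: Ck_boundary_def Ck_extension_def\<close>)

lemma tgrad_extension: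
  assumes dom: "Ck_domain 1 \<Omega>" and X: "X \<in> frontier \<Omega>"
    and F: "Ck_extension 1 (frontier \<Omega>) f F"
  shows "tgrad (frontier \<Omega>) f X = orth_part (outward_normal \<Omega> X) (gradient F X)"
proof (rule vector_eq_rdot[THEN iffD1], rule allI)
  fix h
  have "Ck_boundary 1 (frontier \<Omega>) f" using F by (auto simp: Ck_boundary_def)
  from tgrad_inner_eq_tderiv[OF dom X this]
  show "tgrad (frontier \<Omega>) f X \<bullet> h = orth_part (outward_normal \<Omega> X) (gradient F X) \<bullet> h"
    using tderiv_extension[OF dom X F]
    by (simp add: orth_part_inner_swap has_derivative_gradient(1)[OF Ck_extension_1_derivative[OF F X]])
qed

lemma tgrad_orthogonal:
  assumes dom: "Ck_domain 1 \<Omega>" and X: "X \<in> frontier \<Omega>" and f: "Ck_boundary 1 (frontier \<Omega>) f"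
  shows "outward_normal \<Omega> X \<bullet> tgrad (frontier \<Omega>) f X = 0"
  using tgrad_extension[OF dom X Ck_extension_some[OF f]] by (simp add: orth_part_orthogonal)

lemma tgrad_cong:
  assumes "\<And>X. X \<in> \<Gamma> \<Longrightarrow> f X = f' X"
  shows "tgrad \<Gamma> f = tgrad \<Gamma> f'"
proof -
  have "Ck_extension 1 \<Gamma> f = Ck_extension 1 \<Gamma> f'"
    using assms by (auto simp: Ck_extension_def fun_eq_iff)
  then show ?thesis by (simp add: tgrad_def fun_eq_iff)
qed

lemma Ck_extension_add_scaleR:
  assumes "Ck_extension 1 \<Gamma> f F" "Ck_extension 1 \<Gamma> g G"
  shows "Ck_extension 1 \<Gamma> (\<lambda>X. f X + c *\<^sub>R g X) (\<lambda>X. F X + c *\<^sub>R G X)"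
proof -
  obtain U W where "open U" "\<Gamma> \<subseteq> U" "Ck_on 1 U F" "open W" "\<Gamma> \<subseteq> W" "Ck_on 1 W G"
    using assms by (auto simp: Ck_extension_def)
  moreover from this have "Ck_on 1 (U \<inter> W) (\<lambda>X. F X + c *\<^sub>R G X)"
    by (intro Ck_on_1_add Ck_on_1_scaleR Ck_on_1_const) (auto intro: Ck_on_mono)
  ultimately show ?thesis
    using assms unfolding Ck_extension_def by (intro conjI exI[of _ "U \<inter> W"]) auto
qed

lemma tgrad_add_scaleR:
  assumes dom: "Ck_domain 1 \<Omega>" and X: "X \<in> frontier \<Omega>"
    and "Ck_boundary 1 (frontier \<Omega>) f" "Ck_boundary 1 (frontier \<Omega>) g"
  shows "tgrad (frontier \<Omega>) (\<lambda>X. f X + c *\<^sub>R g X) X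
       = tgrad (frontier \<Omega>) f X + c *\<^sub>R tgrad (frontier \<Omega>) g X"
proof -
  obtain F G where F: "Ck_extension 1 (frontier \<Omega>) f F" and G: "Ck_extension 1 (frontier \<Omega>) g G"
    using assms by (auto simp: Ck_boundary_def)
  note dF = Ck_extension_1_derivative[OF F X] and dG = Ck_extension_1_derivative[OF G X]
  have FG: "((\<lambda>X. F X + c *\<^sub>R G X) has_derivative
      (\<lambda>h. frechet_derivative F (at X) h + c *\<^sub>R frechet_derivative G (at X) h)) (at X)"
    by (intro derivative_intros dF dG)
  have "gradient (\<lambda>X. F X + c *\<^sub>R G X) X = gradient F X + c *\<^sub>R gradient G X"
  proof (rule vector_eq_rdot[THEN iffD1], rule allI)
    show "gradient (\<lambda>X. F X + c *\<^sub>R G X) X \<bullet> h = (gradient F X + c *\<^sub>R gradient G X) \<bullet> h" for h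
      unfolding inner_add_left inner_scaleR_left has_derivative_gradient(1)[OF FG]
        has_derivative_gradient(1)[OF dF] has_derivative_gradient(1)[OF dG] by simp
  qed
  then show ?thesis
    unfolding tgrad_extension[OF dom X Ck_extension_add_scaleR[OF F G]] tgrad_extension[OF dom X F]
      tgrad_extension[OF dom X G]
    by (simp add: orth_part_def inner_add_right add_divide_distrib algebra_simps)
qed

lemma continuous_on_locally:
  fixes f :: "'a::topological_space \<Rightarrow> 'b::topological_space"
  assumes "\<And>X. X \<in> \<Gamma> \<Longrightarrow> \<exists>U. open U \<and> X \<in> U \<and> continuous_on (\<Gamma> \<inter> U) f"
  shows "continuous_on \<Gamma> f"
  unfolding continuous_on_def
proof
  fix X assume X: "X \<in> \<Gamma>"
  then obtain U where U: "open U" "X \<in> U" "continuous_on (\<Gamma> \<inter> U) f" using assms by blast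
  then have "(f \<longlongrightarrow> f X) (at X within \<Gamma> \<inter> U)" using X by (auto simp: continuous_on_def)
  moreover have "at X within \<Gamma> \<inter> U = at X within \<Gamma>" using U by (intro at_within_nhd[of X U]) auto
  ultimately show "(f \<longlongrightarrow> f X) (at X within \<Gamma>)" by simp
qed

lemma continuous_on_outward_normal:
  assumes "Ck_domain 1 \<Omega>"
  shows "continuous_on (frontier \<Omega>) (outward_normal \<Omega>)"
proof (rule continuous_on_locally)
  fix X assume X: "X \<in> frontier \<Omega>"
  obtain U \<phi> where loc: "local_defining 1 \<Omega> X U \<phi>" using assms X by (rule Ck_domainE)
  note d = local_definingD[OF loc]
  note fr = has_C1_derivativeD[OF Ck_on_1_canonical[OF d(4)]]
  have "continuous_on U (\<lambda>Y. \<Sum>b\<in>Basis. Blinfun (frechet_derivative \<phi> (at Y)) b *\<^sub>R b)"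
    by (intro continuous_intros fr(2))
  then have "continuous_on U (gradient \<phi>)"
    by (subst continuous_on_cong[OF refl]) (auto simp: has_derivative_gradient(2)[OF fr(1)])
  then have "continuous_on (frontier \<Omega> \<inter> U) (\<lambda>Y. sgn (gradient \<phi> Y))"
    using d(5) by (intro continuous_on_sgn) (auto intro: continuous_on_subset)
  then have "continuous_on (frontier \<Omega> \<inter> U) (outward_normal \<Omega>)"
    by (subst continuous_on_cong[OF refl]) (auto simp: outward_normal_near[OF loc])
  then show "\<exists>U. open U \<and> X \<in> U \<and> continuous_on (frontier \<Omega> \<inter> U) (outward_normal \<Omega>)"
    using d by blast
qed

lemma continuous_on_tgrad:
  assumes dom: "Ck_domain 1 \<Omega>" and f: "Ck_boundary 1 (frontier \<Omega>) f"
  shows "continuous_on (frontier \<Omega>) (tgrad (frontier \<Omega>) f)"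
proof -
  obtain F U where F: "Ck_extension 1 (frontier \<Omega>) f F" and U: "frontier \<Omega> \<subseteq> U" "Ck_on 1 U F"
    using f by (auto simp: Ck_boundary_def Ck_extension_def)
  note fr = has_C1_derivativeD[OF Ck_on_1_canonical[OF U(2)]]
  have "continuous_on U (\<lambda>Y. \<Sum>b\<in>Basis. Blinfun (frechet_derivative F (at Y)) b *\<^sub>R b)"
    by (intro continuous_intros fr(2))
  then have "continuous_on U (gradient F)"
    by (subst continuous_on_cong[OF refl]) (auto simp: has_derivative_gradient(2)[OF fr(1)])
  then have "continuous_on (frontier \<Omega>) (gradient F)" using U continuous_on_subset by blast
  then have "continuous_on (frontier \<Omega>) (\<lambda>X. gradient F X
      - (outward_normal \<Omega> X \<bullet> gradient F X) *\<^sub>R outward_normal \<Omega> X)"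
    by (intro continuous_intros continuous_on_outward_normal[OF dom])
  then show ?thesis
    by (subst continuous_on_cong[OF refl])
       (auto simp: tgrad_extension[OF dom _ F] orth_part_unit outward_normal_unit[OF dom])
qed

lemma Ck_boundary_0:
  fixes f :: "'a::euclidean_space \<Rightarrow> 'b::euclidean_space"
  assumes "closed \<Gamma>" "continuous_on \<Gamma> f"
  shows "Ck_boundary 0 \<Gamma> f"
proof -
  obtain g where g: "continuous_on UNIV g" "\<And>X. X \<in> \<Gamma> \<Longrightarrow> g X = f X"
    using Tietze_unbounded[of \<Gamma> f UNIV] assms closed_subset[of \<Gamma> UNIV] by auto
  then show ?thesis
    unfolding Ck_boundary_def Ck_extension_def Ck_on_0 by blast
qed

lemma outward_normal_local_extension:
  assumes loc: "local_defining 2 \<Omega> X U \<phi>"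
  shows "Ck_on 1 U (\<lambda>Y. sgn (gradient \<phi> Y))" "Ck_on 1 U (gradient \<phi>)"
proof -
  have U: "open U" "Ck_on 2 U \<phi>" using loc by (auto simp: local_defining_def)
  show "Ck_on 1 U (gradient \<phi>)"
    using Ck_on_2E[OF U(2,1)] Ck_on_1_gradient[OF _ _ U(1)] by metis
  then show "Ck_on 1 U (\<lambda>Y. sgn (gradient \<phi> Y))"
    by (rule Ck_on_1_sgn) (use loc in \<open>simp add: local_defining_def\<close>)
qed

lemma Ck_boundary_outward_normal:
  assumes "Ck_domain 2 \<Omega>"
  shows "Ck_boundary 1 (frontier \<Omega>) (outward_normal \<Omega>)"
proof (rule Ck_boundary_1_local[OF compact_frontier_Ck_domain[OF assms]])
  fix X assume X: "X \<in> frontier \<Omega>"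
  obtain U \<phi> where loc: "local_defining 2 \<Omega> X U \<phi>" using assms X by (rule Ck_domainE)
  show "\<exists>U F. open U \<and> X \<in> U \<and> Ck_on 1 U F \<and> (\<forall>Y\<in>frontier \<Omega> \<inter> U. F Y = outward_normal \<Omega> Y)"
    using outward_normal_local_extension(1)[OF loc] local_definingD(1,2)[OF local_defining_2_imp_1[OF loc]]
      outward_normal_near[OF local_defining_2_imp_1[OF loc]]
    by (intro exI[of _ U] exI[of _ "\<lambda>Y. sgn (gradient \<phi> Y)"]) auto
qed

text \<open>The Hessian as derivative of the gradient, with the symmetry of second derivatives in the form in which it is used.\<close>

lemma has_derivative_gradient_symmetric:
  assumes "Ck_on 2 U F" "open U" "X \<in> U"
  obtains H where "(gradient F has_derivative H) (at X)" "\<And>h k. H h \<bullet> k = H k \<bullet> h"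
proof -
  obtain f' where f': "has_C1_derivative U F f'" "Ck_on 1 U f'" using Ck_on_2E[OF assms(1,2)] .
  obtain f'' where f'': "has_C1_derivative U f' f''" using f'(2) by (rule Ck_on_1E)
  have "Ck_on 1 U (gradient F)" by (rule Ck_on_1_gradient[OF f' assms(2)])
  then obtain H where H: "(gradient F has_derivative blinfun_apply (H X)) (at X)"
    using has_C1_derivativeD(1) assms(3) Ck_on_1E by metis
  have eq: "H X h \<bullet> k = f'' X h k" for h k
  proof -
    have "((\<lambda>Y. gradient F Y \<bullet> k) has_derivative (\<lambda>h. H X h \<bullet> k)) (at X)"
      by (rule has_derivative_inner_left[OF H])
    moreover have "((\<lambda>Y. gradient F Y \<bullet> k) has_derivative (\<lambda>h. f'' X h k)) (at X)"
      using bounded_linear.has_derivative[OF blinfun.bounded_linear_left has_C1_derivativeD(1)[OF f'' assms(3)]]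
    proof (rule has_derivative_transform_within_open[OF _ assms(2,3)])
      show "f' Y k = gradient F Y \<bullet> k" if "Y \<in> U" for Y
        by (simp add: has_derivative_gradient(1)[OF has_C1_derivativeD(1)[OF f'(1) that]])
    qed
    ultimately show ?thesis using has_derivative_unique by metis
  qed
  have "f'' X h k = f'' X k h" for h k
    by (rule second_derivative_symmetric[OF assms(2,3) has_C1_derivativeD(1)[OF f'(1)] has_C1_derivativeD(1)[OF f'' assms(3)]])
  then show thesis by (intro that[OF H]) (simp add: eq)
qed

text \<open>The Weingarten map. It maps into the tangent space because \<open>n \<bullet> n = 1\<close>. For its symmetry, differentiate
\<open>\<nabla>\<phi> = |\<nabla>\<phi>| n\<close>: between tangent vectors the derivative of \<open>|\<nabla>\<phi>|\<close> contributes nothing, so \<open>|\<nabla>\<phi>|\<close> times the Weingarten map is the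
Hessian of \<open>\<phi>\<close>, which is symmetric.\<close>

lemma tderiv_normal_self_adjoint:
  assumes dom: "Ck_domain 2 \<Omega>" and X: "X \<in> frontier \<Omega>"
  defines "n \<equiv> outward_normal \<Omega>"
  defines "L \<equiv> tderiv (frontier \<Omega>) n X"
  shows "n X \<bullet> L h = 0" "L h \<bullet> k = L k \<bullet> h"
proof -
  note dom1 = Ck_domain_2_imp_1[OF dom]
  obtain U \<phi> where loc: "local_defining 2 \<Omega> X U \<phi>" using dom X by (rule Ck_domainE)
  note loc1 = local_defining_2_imp_1[OF loc]
  note d = local_definingD[OF loc1]
  let ?G = "gradient \<phi>" and ?N = "\<lambda>Y. sgn (gradient \<phi> Y)"
  let ?P = "orth_part (n X)"
  obtain N' where N': "(?N has_derivative blinfun_apply (N' X)) (at X)"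
    using outward_normal_local_extension(1)[OF loc] has_C1_derivativeD(1) d(2) Ck_on_1E by metis
  have "Ck_on 2 U \<phi>" using loc by (simp add: local_defining_def)
  then obtain H where H: "(?G has_derivative H) (at X)" "\<And>h k. H h \<bullet> k = H k \<bullet> h"
    using has_derivative_gradient_symmetric[OF _ d(1,2)] by metis
  have NX: "?N X = n X" using outward_normal_eq[OF loc1 X] by (simp add: n_def)
  have Lh: "L h = N' X (?P h)" for h
    unfolding L_def n_def
    by (rule tderiv_normal[OF dom1 X Ck_boundary_outward_normal[OF dom] N' d(1,2)])
       (simp add: outward_normal_near[OF loc1])
  have nN: "n X \<bullet> N' X h = 0" for h
  proof -
    have "((\<lambda>Y. ?N Y \<bullet> ?N Y) has_derivative (\<lambda>h. ?N X \<bullet> N' X h + N' X h \<bullet> ?N X)) (at X)"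
      by (intro has_derivative_inner N')
    moreover have "((\<lambda>Y. ?N Y \<bullet> ?N Y) has_derivative (\<lambda>h. 0)) (at X)"
      by (rule has_derivative_transform_within_open[OF has_derivative_const[of 1] d(1,2)])
         (simp add: dot_square_norm norm_sgn d(5))
    ultimately have "(\<lambda>h. ?N X \<bullet> N' X h + N' X h \<bullet> ?N X) = (\<lambda>h. 0)" by (rule has_derivative_unique)
    from fun_cong[OF this, of h] show ?thesis by (simp add: NX inner_commute)
  qed
  then show nL: "n X \<bullet> L h = 0" for h by (simp add: Lh)
  let ?r = "\<lambda>Y. norm (?G Y)"
  have r: "(?r has_derivative (\<lambda>h. sgn (?G X) \<bullet> H h)) (at X)"
  proof -
    have "(norm has_derivative (\<lambda>h. h \<bullet> sgn (?G X))) (at (?G X))"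
      by (rule has_derivative_norm) (rule d(5)[OF d(2)])
    from has_derivative_compose[OF H(1) this] show ?thesis by (simp add: inner_commute)
  qed
  have "((\<lambda>Y. ?r Y *\<^sub>R ?N Y) has_derivative (\<lambda>h. ?r X *\<^sub>R N' X h + (?N X \<bullet> H h) *\<^sub>R ?N X)) (at X)"
    by (intro has_derivative_scaleR r N')
  moreover have "(\<lambda>Y. ?r Y *\<^sub>R ?N Y) = ?G"
  proof
    show "?r Y *\<^sub>R ?N Y = ?G Y" for Y by (cases "?G Y = 0") (simp_all add: sgn_div_norm)
  qed
  ultimately have "(?G has_derivative (\<lambda>h. ?r X *\<^sub>R N' X h + (?N X \<bullet> H h) *\<^sub>R ?N X)) (at X)"
    by (simp only:)
  then have "H = (\<lambda>h. ?r X *\<^sub>R N' X h + (?N X \<bullet> H h) *\<^sub>R ?N X)"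
    by (rule has_derivative_unique[OF H(1)])
  then have Hh: "H h = ?r X *\<^sub>R N' X h + (n X \<bullet> H h) *\<^sub>R n X" for h
    unfolding NX[symmetric] by (rule fun_cong)
  have HP: "H h \<bullet> ?P k = ?r X * (N' X h \<bullet> ?P k)" for h k
    by (subst Hh) (simp add: inner_add_left orth_part_orthogonal)
  have LP: "?r X * (L h \<bullet> k) = H (?P h) \<bullet> ?P k" for h k
  proof -
    have "L h \<bullet> k = L h \<bullet> ?P k"
      using orth_part_id[OF nL, of h] by (metis orth_part_inner_swap)
    then show ?thesis by (simp add: HP Lh)
  qed
  have "?r X * (L h \<bullet> k) = ?r X * (L k \<bullet> h)" using H(2) by (simp add: LP)
  then show "L h \<bullet> k = L k \<bullet> h" using d(5)[OF d(2)] by simp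
qed

text \<open>With \<open>F\<close> extending \<open>f\<close> and \<open>N\<close> extending the normal, \<open>\<nabla>F - (N \<bullet> \<nabla>F) N\<close> extends the tangential gradient. All the
ingredients are returned, because the derivative of this extension is computed from them.\<close>

lemma tgrad_C1_extension:
  assumes dom: "Ck_domain 2 \<Omega>" and f: "Ck_boundary 2 (frontier \<Omega>) f"
  obtains F U N W where "open U" "frontier \<Omega> \<subseteq> U" "Ck_on 2 U F" "Ck_extension 1 (frontier \<Omega>) f F"
    "Ck_extension 1 (frontier \<Omega>) (outward_normal \<Omega>) N"
    "W = (\<lambda>Y. gradient F Y - (N Y \<bullet> gradient F Y) *\<^sub>R N Y)"
    "Ck_extension 1 (frontier \<Omega>) (tgrad (frontier \<Omega>) f) W"
proof -
  note dom1 = Ck_domain_2_imp_1[OF dom]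
  obtain F U where U: "open U" "frontier \<Omega> \<subseteq> U" "Ck_on 2 U F" and Ff: "\<And>X. X \<in> frontier \<Omega> \<Longrightarrow> F X = f X"
    using f by (auto simp: Ck_boundary_def Ck_extension_def)
  have F: "Ck_extension 1 (frontier \<Omega>) f F"
    using U Ff Ck_on_mono[OF U(3), of 1 U] by (auto simp: Ck_extension_def)
  obtain N where N: "Ck_extension 1 (frontier \<Omega>) (outward_normal \<Omega>) N"
    using Ck_boundary_outward_normal[OF dom] by (auto simp: Ck_boundary_def)
  then obtain O' where O: "open O'" "frontier \<Omega> \<subseteq> O'" "Ck_on 1 O' N" by (auto simp: Ck_extension_def)
  have G: "Ck_on 1 U (gradient F)" using Ck_on_2E[OF U(3,1)] Ck_on_1_gradient[OF _ _ U(1)] by metis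
  let ?W = "\<lambda>Y. gradient F Y - (N Y \<bullet> gradient F Y) *\<^sub>R N Y"
  have "Ck_on 1 (U \<inter> O') ?W"
    by (intro Ck_on_1_diff Ck_on_1_scaleR Ck_on_1_inner) (auto intro: Ck_on_mono[OF G] Ck_on_mono[OF O(3)])
  moreover have "?W X = tgrad (frontier \<Omega>) f X" if X: "X \<in> frontier \<Omega>" for X
    using N X by (simp add: tgrad_extension[OF dom1 X F] orth_part_unit[OF outward_normal_unit[OF dom1 X]] Ck_extension_def)
  ultimately have "Ck_extension 1 (frontier \<Omega>) (tgrad (frontier \<Omega>) f) ?W"
    using U O unfolding Ck_extension_def by (intro conjI exI[of _ "U \<inter> O'"]) auto
  then show thesis using that U F N by blast
qed

text \<open>Differentiating the extension of \<open>g\<close> gives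
\<open>D\<^sub>\<Gamma>g = P H P - n \<otimes> L g - (n \<bullet> \<nabla>F) L\<close> with the Hessian \<open>H\<close> and the Weingarten map \<open>L\<close>. The first and the last term are
symmetric, so the antisymmetric part comes from \<open>n \<otimes> L g\<close> alone.\<close>

lemma tderiv_tgrad_antisymmetric_part:
  assumes dom: "Ck_domain 2 \<Omega>" and X: "X \<in> frontier \<Omega>" and f: "Ck_boundary 2 (frontier \<Omega>) f"
  defines "n \<equiv> outward_normal \<Omega>" and "g \<equiv> tgrad (frontier \<Omega>) f"
  defines "L \<equiv> tderiv (frontier \<Omega>) n X" and "Dg \<equiv> tderiv (frontier \<Omega>) g X"
  shows "Dg h \<bullet> v - Dg v \<bullet> h = (n X \<bullet> h) * (v \<bullet> L (g X)) - (v \<bullet> n X) * (L (g X) \<bullet> h)"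
proof -
  note dom1 = Ck_domain_2_imp_1[OF dom]
  obtain F U N W where U: "open U" "frontier \<Omega> \<subseteq> U" "Ck_on 2 U F" and F: "Ck_extension 1 (frontier \<Omega>) f F"
    and N: "Ck_extension 1 (frontier \<Omega>) (outward_normal \<Omega>) N"
    and W_def: "W = (\<lambda>Y. gradient F Y - (N Y \<bullet> gradient F Y) *\<^sub>R N Y)"
    and W: "Ck_extension 1 (frontier \<Omega>) g W"
    by (rule tgrad_C1_extension[OF dom f, folded g_def])
  obtain H where H: "(gradient F has_derivative H) (at X)" "\<And>h k. H h \<bullet> k = H k \<bullet> h"
    using has_derivative_gradient_symmetric[OF U(3,1)] U(2) X by blast
  let ?G = "gradient F X" and ?P = "orth_part (n X)"
  let ?N' = "frechet_derivative N (at X)"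
  have N': "(N has_derivative ?N') (at X)" by (rule Ck_extension_1_derivative[OF N X])
  have NX: "N X = n X" using N X by (simp add: Ck_extension_def n_def)
  have unit: "norm (n X) = 1" unfolding n_def by (rule outward_normal_unit[OF dom1 X])
  have Lh: "L h = ?N' (?P h)" for h
    unfolding L_def n_def by (rule tderiv_extension[OF dom1 X N])
  note L0 = tderiv_normal_self_adjoint(1)[OF dom X, folded n_def, folded L_def]
  note Lsym = tderiv_normal_self_adjoint(2)[OF dom X, folded n_def, folded L_def]
  have gX: "g X = ?P ?G" unfolding g_def n_def by (rule tgrad_extension[OF dom1 X F])
  \<comment> \<open>As \<open>L h\<close> is tangential, \<open>\<nabla>F\<close> may be replaced by its tangential part \<open>g X\<close>; then \<open>L\<close> is moved to the other side.\<close>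
  have LG: "L h \<bullet> ?G = L (g X) \<bullet> h" for h
  proof -
    have "L h \<bullet> ?G = ?P (L h) \<bullet> ?G" by (simp add: orth_part_id[OF L0])
    then have "L h \<bullet> ?G = L h \<bullet> g X" by (simp add: gX orth_part_inner_swap)
    then show ?thesis by (simp add: Lsym)
  qed
  have W': "(W has_derivative (\<lambda>h. H h - ((N X \<bullet> ?G) *\<^sub>R ?N' h + (N X \<bullet> H h + ?N' h \<bullet> ?G) *\<^sub>R N X))) (at X)"
    unfolding W_def by (intro has_derivative_diff has_derivative_scaleR has_derivative_inner H(1) N')
  have Dg: "Dg h = H (?P h) - ((n X \<bullet> ?G) *\<^sub>R L h + (n X \<bullet> H (?P h) + L (g X) \<bullet> h) *\<^sub>R n X)" for h
  proof -
    have "Dg h = H (?P h) - ((N X \<bullet> ?G) *\<^sub>R ?N' (?P h) + (N X \<bullet> H (?P h) + ?N' (?P h) \<bullet> ?G) *\<^sub>R N X)"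
      unfolding Dg_def n_def
      by (rule tderiv_normal[OF dom1 X _ W', of _ UNIV]) (use W in \<open>auto simp: Ck_boundary_def Ck_extension_def\<close>)
    then show ?thesis by (simp add: NX Lh[symmetric] LG)
  qed
  have eq: "Dg h \<bullet> v = H (?P h) \<bullet> ?P v - (n X \<bullet> ?G) * (L h \<bullet> v) - (L (g X) \<bullet> h) * (n X \<bullet> v)" for h v
    unfolding Dg orth_part_unit[OF unit, of v] inner_diff_left inner_diff_right inner_add_left inner_scaleR_left
      inner_scaleR_right inner_commute[of "H _" "n X"] by (simp add: algebra_simps)
  show ?thesis
    unfolding eq H(2)[of "?P v" "?P h"] Lsym[of v h] inner_commute[of v "L (g X)"] inner_commute[of v "n X"]
    by (simp only: mult.commute)
qed

section \<open>Transport of boundaries by diffeomorphisms\<close>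

definition blinfun_adjoint :: "('a::euclidean_space \<Rightarrow>\<^sub>L 'a) \<Rightarrow> 'a \<Rightarrow>\<^sub>L 'a" where
  "blinfun_adjoint A = Blinfun (adjoint (blinfun_apply A))"

lemma blinfun_adjoint_inner: "blinfun_adjoint A y \<bullet> h = y \<bullet> blinfun_apply A h"
proof -
  have lin: "linear (blinfun_apply A)" using bounded_linear.linear blinfun.bounded_linear_right by blast
  have "blinfun_apply (blinfun_adjoint A) = adjoint (blinfun_apply A)"
    unfolding blinfun_adjoint_def
    by (rule bounded_linear_Blinfun_apply) (simp add: adjoint_linear[OF lin] linear_conv_bounded_linear[symmetric])
  then show ?thesis using adjoint_clauses(2)[OF lin] by simp
qed

lemma blinfun_adjoint_eqI: "(\<And>y h. blinfun_apply B y \<bullet> h = y \<bullet> blinfun_apply A h) \<Longrightarrow> blinfun_adjoint A = B"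
  by (rule blinfun_eqI, rule vector_eq_rdot[THEN iffD1]) (simp add: blinfun_adjoint_inner)

lemma bounded_linear_blinfun_adjoint: "bounded_linear blinfun_adjoint"
proof (rule bounded_linear_intro[of _ 1])
  show "blinfun_adjoint (A + B) = blinfun_adjoint A + blinfun_adjoint B" for A B :: "'a \<Rightarrow>\<^sub>L 'a"
    by (rule blinfun_adjoint_eqI) (simp add: blinfun.add_left inner_add_left inner_add_right blinfun_adjoint_inner)
  show "blinfun_adjoint (r *\<^sub>R A) = r *\<^sub>R blinfun_adjoint A" for r and A :: "'a \<Rightarrow>\<^sub>L 'a"
    by (rule blinfun_adjoint_eqI) (simp add: blinfun.scaleR_left blinfun_adjoint_inner)
  show "norm (blinfun_adjoint A) \<le> norm A * 1" for A :: "'a \<Rightarrow>\<^sub>L 'a"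
  proof (rule norm_blinfun_bound)
    fix y
    have "norm (blinfun_adjoint A y) * norm (blinfun_adjoint A y) = y \<bullet> A (blinfun_adjoint A y)"
      by (simp add: blinfun_adjoint_inner[symmetric] power2_norm_eq_inner[symmetric] power2_eq_square)
    also have "\<dots> \<le> norm y * (norm A * norm (blinfun_adjoint A y))"
      by (intro order_trans[OF norm_cauchy_schwarz] mult_left_mono norm_blinfun) auto
    finally have "norm (blinfun_adjoint A y) * norm (blinfun_adjoint A y) \<le> norm A * norm y * norm (blinfun_adjoint A y)" by (simp add: mult_ac)
    then show "norm (blinfun_adjoint A y) \<le> norm A * 1 * norm y"
      by (cases "blinfun_adjoint A y = 0") (auto dest: mult_right_le_imp_le)
  qed simp
qed

lemma blinfun_adjoint_id: "blinfun_adjoint id_blinfun = id_blinfun"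
  by (rule blinfun_adjoint_eqI) simp


text \<open>Gradients are covectors, so under composition they are transported by the adjoint of the derivative.\<close>

lemma gradient_compose:
  assumes "(F has_derivative F') (at X)" and "(S has_derivative blinfun_apply A) (at Y)" "S Y = X"
  shows "gradient (F \<circ> S) Y = blinfun_adjoint A (gradient F X)" "F \<circ> S differentiable (at Y)"
proof -
  have d: "(F \<circ> S has_derivative F' \<circ> blinfun_apply A) (at Y)"
    using diff_chain_at[OF assms(2)] assms(1,3) by simp
  show "gradient (F \<circ> S) Y = blinfun_adjoint A (gradient F X)"
    by (rule vector_eq_rdot[THEN iffD1], rule allI)
       (simp add: has_derivative_gradient(1)[OF d] blinfun_adjoint_inner has_derivative_gradient(1)[OF assms(1)])
  show "F \<circ> S differentiable (at Y)" using d by (auto simp: differentiable_def)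
qed

lemma frontier_homeomorphic_image:
  fixes T S :: "'a::topological_space \<Rightarrow> 'a"
  assumes ST: "\<And>X. S (T X) = X" and TS: "\<And>Y. T (S Y) = Y"
    and T: "continuous_on UNIV T" and S: "continuous_on UNIV S"
  shows "frontier (T ` A) = T ` frontier A"
proof -
  have vim: "T ` B = S -` B" for B
    using ST TS by (auto simp: image_iff) metis
  have cl: "closure (T ` B) = T ` closure B" for B
  proof
    have "closed (T ` closure B)" unfolding vim by (intro closed_vimage S) simp
    then show "closure (T ` B) \<subseteq> T ` closure B" by (intro closure_minimal image_mono closure_subset)
    show "T ` closure B \<subseteq> closure (T ` B)"
      by (rule image_closure_subset[OF continuous_on_subset[OF T]]) (auto intro: closure_subset[THEN subsetD])
  qed
  have "- (T ` A) = T ` (- A)" by (simp add: vim vimage_Compl)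
  then have "frontier (T ` A) = T ` closure A \<inter> T ` closure (- A)"
    by (simp add: frontier_closures cl)
  then show ?thesis by (simp add: frontier_closures vim)
qed

text \<open>If \<open>\<phi>\<close> defines \<open>\<Omega>\<close> locally, then \<open>\<phi> \<circ> S\<close> defines the image of \<open>\<Omega>\<close>, where \<open>S\<close> is the inverse of \<open>T\<close>. Its gradient is
the image of \<open>\<nabla>\<phi>\<close> under the adjoint of the derivative of \<open>S\<close>, and injectivity of that adjoint keeps it from vanishing.\<close>

lemma
  assumes T: "continuous_on UNIV T" and ST: "\<And>X. S (T X) = X" and TS: "\<And>Y. T (S Y) = Y"
    and S: "has_C1_derivative UNIV S A'" and A': "\<And>Y. inj (blinfun_apply (blinfun_adjoint (A' Y)))"
  shows local_defining_image: "local_defining 1 \<Omega> X U \<phi> \<Longrightarrow> local_defining 1 (T ` \<Omega>) (T X) (T ` U) (\<phi> \<circ> S)"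
    and Ck_domain_image: "Ck_domain 1 \<Omega> \<Longrightarrow> Ck_domain 1 (T ` \<Omega>)"
    and frontier_image: "frontier (T ` \<Omega>) = T ` frontier \<Omega>"
proof -
  have S1: "Ck_on 1 UNIV S" by (rule Ck_on_1I[OF S])
  have Sc: "continuous_on UNIV S" by (rule Ck_on_1_continuous[OF S1])
  have vim: "T ` B = S -` B" for B
    using ST TS by (auto simp: image_iff) metis
  have op: "open (T ` B)" if "open B" for B
    unfolding vim using that Sc by (rule open_vimage)
  show fr: "frontier (T ` \<Omega>) = T ` frontier \<Omega>" for \<Omega>
    by (rule frontier_homeomorphic_image[OF ST TS T Sc])
  show loc: "local_defining 1 (T ` \<Omega>) (T X) (T ` U) (\<phi> \<circ> S)" if d: "local_defining 1 \<Omega> X U \<phi>" for X U \<phi>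
    unfolding local_defining_def
  proof (intro conjI ballI)
    note d' = local_definingD[OF d]
    show "open (T ` U)" using d' op by blast
    show "T X \<in> T ` U" using d' by blast
    show "Ck_on 1 (T ` U) (\<phi> \<circ> S)"
      unfolding o_def by (rule Ck_on_1_compose[OF Ck_on_mono[OF S1] d'(4)]) (auto simp: ST)
    show "gradient (\<phi> \<circ> S) Y \<noteq> 0" if "Y \<in> T ` U" for Y
    proof -
      have SY: "S Y \<in> U" using that by (auto simp: ST)
      have "gradient (\<phi> \<circ> S) Y = blinfun_adjoint (A' Y) (gradient \<phi> (S Y))"
        by (rule gradient_compose(1)[OF d'(6)[OF SY] has_C1_derivativeD(1)[OF S] refl]) simp
      moreover have "blinfun_adjoint (A' Y) (gradient \<phi> (S Y)) \<noteq> blinfun_adjoint (A' Y) 0"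
        using inj_eq[OF A'] d'(5)[OF SY] by blast
      ultimately show ?thesis by (simp add: blinfun.zero_right)
    qed
    show "T ` \<Omega> \<inter> T ` U = {Y \<in> T ` U. (\<phi> \<circ> S) Y < 0}"
      using d'(7) unfolding vim by auto
    show "frontier (T ` \<Omega>) \<inter> T ` U = {Y \<in> T ` U. (\<phi> \<circ> S) Y = 0}"
      using d'(8) unfolding fr unfolding vim by auto
  qed
  show "Ck_domain 1 (T ` \<Omega>)" if dom: "Ck_domain 1 \<Omega>"
    unfolding Ck_domain_def
  proof (intro conjI ballI)
    show "open (T ` \<Omega>)" using dom op by (auto simp: Ck_domain_def)
    have "compact (T ` closure \<Omega>)"
      using dom by (intro compact_continuous_image continuous_on_subset[OF T]) (auto simp: Ck_domain_def)
    then show "bounded (T ` \<Omega>)"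
      by (meson bounded_subset closure_subset compact_imp_bounded image_mono)
    fix Y assume "Y \<in> frontier (T ` \<Omega>)"
    then obtain X where X: "X \<in> frontier \<Omega>" "Y = T X" unfolding fr by blast
    obtain U \<phi> where "local_defining 1 \<Omega> X U \<phi>" using dom X(1) by (rule Ck_domainE)
    from loc[OF this] show "\<exists>U \<psi>. local_defining 1 (T ` \<Omega>) Y U \<psi>" unfolding X(2) by blast
  qed
qed

text \<open>The gradient of an extension \<open>Z\<close> of \<open>f \<circ> T\<close> and the normal \<open>n\<close> are transported by the same linear map. As \<open>\<nabla>Z\<close> is the
tangential gradient plus a multiple of \<open>n\<close>, its image is the image of the tangential gradient plus a multiple of the
image of \<open>n\<close>, and projecting removes that multiple.\<close>

lemma
  assumes T: "continuous_on UNIV T" and ST: "\<And>X. S (T X) = X" and TS: "\<And>Y. T (S Y) = Y"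
    and S: "has_C1_derivative UNIV S A'" and A': "\<And>Y. inj (blinfun_apply (blinfun_adjoint (A' Y)))"
    and dom: "Ck_domain 1 \<Omega>" and f: "Ck_boundary 1 (frontier \<Omega>) (\<lambda>X. f (T X))"
  shows Ck_boundary_image: "Ck_boundary 1 (T ` frontier \<Omega>) f"
    and tgrad_image: "X \<in> frontier \<Omega> \<Longrightarrow> tgrad (T ` frontier \<Omega>) f (T X) =
      orth_part (blinfun_adjoint (A' (T X)) (outward_normal \<Omega> X)) (blinfun_adjoint (A' (T X)) (tgrad (frontier \<Omega>) (\<lambda>X. f (T X)) X))"
proof -
  have S1: "Ck_on 1 UNIV S" by (rule Ck_on_1I[OF S])
  have Sc: "continuous_on UNIV S" by (rule Ck_on_1_continuous[OF S1])
  obtain Z U where Z: "Ck_extension 1 (frontier \<Omega>) (\<lambda>X. f (T X)) Z" and U: "open U" "frontier \<Omega> \<subseteq> U" "Ck_on 1 U Z"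
    using f by (auto simp: Ck_boundary_def Ck_extension_def)
  have ZS: "(Z \<circ> S) Y = f Y" if "Y \<in> T ` frontier \<Omega>" for Y
    using Z that by (auto simp: Ck_extension_def ST)
  have "open (S -` U)" "Ck_on 1 (S -` U) (Z \<circ> S)"
    unfolding o_def by (rule open_vimage[OF U(1) Sc], rule Ck_on_1_compose[OF Ck_on_mono[OF S1] U(3)]) auto
  moreover have "T ` frontier \<Omega> \<subseteq> S -` U" using U by (auto simp: ST)
  ultimately show bd: "Ck_boundary 1 (T ` frontier \<Omega>) f"
    using ZS unfolding Ck_boundary_def Ck_extension_def by (intro exI[of _ "Z \<circ> S"]) blast
  assume X: "X \<in> frontier \<Omega>"
  let ?B = "blinfun_adjoint (A' (T X))" and ?n = "outward_normal \<Omega> X"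
  obtain U \<phi> where loc: "local_defining 1 \<Omega> X U \<phi>" using dom X by (rule Ck_domainE)
  note d = local_definingD[OF loc]
  note fr = frontier_image[OF T ST TS S A']
  have dS: "(S has_derivative blinfun_apply (A' (T X))) (at (T X))"
    using has_C1_derivativeD(1)[OF S] by simp
  have g\<phi>: "gradient (\<phi> \<circ> S) (T X) = ?B (gradient \<phi> X)"
    by (rule gradient_compose(1)[OF d(6)[OF d(2)] dS ST])
  note gZ = gradient_compose[OF Ck_extension_1_derivative[OF Z X] dS ST]
  have n: "gradient \<phi> X = norm (gradient \<phi> X) *\<^sub>R ?n"
    using d(5)[OF d(2)] by (simp add: outward_normal_eq[OF loc X] sgn_div_norm)
  have "?B (gradient \<phi> X) = norm (gradient \<phi> X) *\<^sub>R ?B ?n"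
    by (subst n) (simp add: blinfun.scaleR_right)
  then have op: "orth_part (?B (gradient \<phi> X)) = orth_part (?B ?n)"
    using d(5)[OF d(2)] by (simp add: orth_part_scaleR)
  have "gradient Z X = tgrad (frontier \<Omega>) (\<lambda>X. f (T X)) X + (?n \<bullet> gradient Z X) *\<^sub>R ?n"
    by (simp add: tgrad_extension[OF dom X Z] orth_part_unit[OF outward_normal_unit[OF dom X]])
  then have BZ: "?B (gradient Z X) = ?B (tgrad (frontier \<Omega>) (\<lambda>X. f (T X)) X) + (?n \<bullet> gradient Z X) *\<^sub>R ?B ?n"
    by (metis blinfun.add_right blinfun.scaleR_right)
  have "tgrad (T ` frontier \<Omega>) f (T X) = orth_part (gradient (\<phi> \<circ> S) (T X)) (gradient (Z \<circ> S) (T X))"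
    unfolding fr[symmetric]
    by (rule tgrad_eq[OF Ck_domain_image[OF T ST TS S A' dom] local_defining_image[OF T ST TS S A' loc] _ _ gZ(2), of _ UNIV])
       (use X bd ZS in \<open>auto simp: fr\<close>)
  then show "tgrad (T ` frontier \<Omega>) f (T X) = orth_part (?B ?n) (?B (tgrad (frontier \<Omega>) (\<lambda>X. f (T X)) X))"
    by (simp only: g\<phi> gZ(1) op BZ orth_part_add_multiple)
qed


section \<open>Limits of difference quotients\<close>

lemma uniform_limit_of_difference_quotient:
  fixes f :: "real \<Rightarrow> 'a \<Rightarrow> 'b::real_normed_vector"
  assumes lim: "uniform_limit \<Gamma> (\<lambda>t X. (f t X - f0 X) /\<^sub>R t) h (at_right 0)" and h: "bounded (h ` \<Gamma>)"
  shows "uniform_limit \<Gamma> f f0 (at_right 0)"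
proof -
  have t0: "uniform_limit \<Gamma> (\<lambda>(t :: real) X. t) (\<lambda>X. 0) (at_right 0)"
    by (rule uniform_limitI) (auto simp: eventually_at_right_field)
  have "uniform_limit \<Gamma> (\<lambda>t X. t *\<^sub>R ((f t X - f0 X) /\<^sub>R t)) (\<lambda>X. 0 *\<^sub>R h X) (at_right 0)"
    by (rule bounded_bilinear.bounded_uniform_limit[OF bounded_bilinear_scaleR t0 lim h])
       (simp add: image_constant_conv)
  then have "uniform_limit \<Gamma> (\<lambda>t X. f0 X + t *\<^sub>R ((f t X - f0 X) /\<^sub>R t)) (\<lambda>X. f0 X + 0 *\<^sub>R h X) (at_right 0)"
    by (rule uniform_limit_add[OF uniform_limit_const])
  moreover have "\<forall>\<^sub>F t in at_right 0. \<forall>X\<in>\<Gamma>. f0 X + t *\<^sub>R ((f t X - f0 X) /\<^sub>R t) = f t X"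
    by (auto simp: eventually_at_right_field intro!: exI[of _ 1])
  ultimately show ?thesis
    by (subst (asm) uniform_limit_cong) auto
qed

lemma bounded_bilinear_image:
  assumes "bounded_bilinear p" "bounded (f ` \<Gamma>)" "bounded (g ` \<Gamma>)"
  shows "bounded ((\<lambda>X. p (f X) (g X)) ` \<Gamma>)"
proof -
  interpret p: bounded_bilinear p by fact
  obtain K where K: "\<And>a b. norm (p a b) \<le> norm a * norm b * K" "K \<ge> 0" using p.nonneg_bounded by blast
  obtain a b where ab: "\<And>X. X \<in> \<Gamma> \<Longrightarrow> norm (f X) \<le> a" "\<And>X. X \<in> \<Gamma> \<Longrightarrow> norm (g X) \<le> b"
    using assms(2,3) by (auto simp: bounded_iff)
  have "norm (p (f X) (g X)) \<le> a * b * K" if "X \<in> \<Gamma>" for X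
    using ab[OF that] K(2) order_trans[OF norm_ge_zero ab(1)[OF that]]
    by (intro order_trans[OF K(1)] mult_right_mono mult_mono) auto
  then show ?thesis by (auto simp: bounded_iff)
qed

lemma bounded_add_image:
  fixes f g :: "'a \<Rightarrow> 'b::real_normed_vector"
  assumes "bounded (f ` \<Gamma>)" "bounded (g ` \<Gamma>)"
  shows "bounded ((\<lambda>X. f X + g X) ` \<Gamma>)"
proof -
  obtain a b where "\<And>X. X \<in> \<Gamma> \<Longrightarrow> norm (f X) \<le> a" "\<And>X. X \<in> \<Gamma> \<Longrightarrow> norm (g X) \<le> b"
    using assms by (auto simp: bounded_iff)
  then have "norm (f X + g X) \<le> a + b" if "X \<in> \<Gamma>" for X
    using that by (intro norm_triangle_le add_mono)
  then show ?thesis by (auto simp: bounded_iff)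
qed

lemma uniform_limit_sum_family:
  fixes c :: "'i \<Rightarrow> real \<Rightarrow> 'a \<Rightarrow> 'b::real_normed_vector"
  assumes "\<And>i. i \<in> I \<Longrightarrow> uniform_limit \<Gamma> (c i) (l i) \<F>"
  shows "uniform_limit \<Gamma> (\<lambda>t X. \<Sum>i\<in>I. c i t X) (\<lambda>X. \<Sum>i\<in>I. l i X) \<F>"
  using assms
  by (induction I rule: infinite_finite_induct) (auto intro!: uniform_limit_add uniform_limit_const)

text \<open>The derivative at \<open>t = 0\<close> of the part of \<open>y = B (g + t q)\<close> orthogonal to \<open>\<nu> = B n\<close>. The projection subtracts
\<open>((\<nu> \<bullet> y) / (\<nu> \<bullet> \<nu>)) \<nu>\<close>; as \<open>\<nu> \<bullet> y\<close> vanishes at \<open>t = 0\<close>, its derivative is the only one that matters in this term, the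
other factors being replaced by their limits.\<close>

lemma tangential_transport_limit:
  fixes B :: "real \<Rightarrow> 'a::euclidean_space \<Rightarrow> 'a \<Rightarrow>\<^sub>L 'a" and n g q0 :: "'a \<Rightarrow> 'a"
  assumes B: "uniform_limit \<Gamma> (\<lambda>t X. (B t X - id_blinfun) /\<^sub>R t) C (at_right 0)"
    and q: "uniform_limit \<Gamma> q q0 (at_right 0)"
    and bC: "bounded (C ` \<Gamma>)" and bq: "bounded (q0 ` \<Gamma>)" and bg: "bounded (g ` \<Gamma>)"
    and unit: "\<And>X. X \<in> \<Gamma> \<Longrightarrow> norm (n X) = 1" and ng: "\<And>X. X \<in> \<Gamma> \<Longrightarrow> n X \<bullet> g X = 0"
  shows "uniform_limit \<Gamma>
    (\<lambda>t X. (orth_part (B t X (n X)) (B t X (g X + t *\<^sub>R q t X)) - g X) /\<^sub>R t)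
    (\<lambda>X. (C X (g X) + q0 X) - (C X (n X) \<bullet> g X + n X \<bullet> (C X (g X) + q0 X)) *\<^sub>R n X) (at_right 0)"
proof -
  note bl = bounded_bilinear.bounded_uniform_limit
  note app = bounded_bilinear_blinfun_apply and inn = bounded_bilinear_inner and scl = bounded_bilinear_scaleR
  have pos: "\<forall>\<^sub>F t :: real in at_right 0. t > 0" by (simp add: eventually_at_right_less)
  have bn: "bounded (n ` \<Gamma>)" using unit by (auto simp: bounded_iff intro!: exI[of _ 1])
  have bid: "bounded ((\<lambda>X. id_blinfun) ` \<Gamma>)" by (simp add: image_constant_conv)
  have Blim: "uniform_limit \<Gamma> B (\<lambda>X. id_blinfun) (at_right 0)"
    by (rule uniform_limit_of_difference_quotient[OF B bC])
  let ?\<nu> = "\<lambda>t X. B t X (n X)" and ?y = "\<lambda>t X. B t X (g X + t *\<^sub>R q t X)"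
  let ?y' = "\<lambda>X. C X (g X) + q0 X"
  have N: "uniform_limit \<Gamma> (\<lambda>t X. (?\<nu> t X - n X) /\<^sub>R t) (\<lambda>X. C X (n X)) (at_right 0)"
    using bl[OF app B uniform_limit_const bn bC]
    by (simp add: blinfun.scaleR_left blinfun.diff_left)
  have Y: "uniform_limit \<Gamma> (\<lambda>t X. (?y t X - g X) /\<^sub>R t) ?y' (at_right 0)"
  proof -
    have "uniform_limit \<Gamma> (\<lambda>t X. ((B t X - id_blinfun) /\<^sub>R t) (g X) + B t X (q t X))
        (\<lambda>X. C X (g X) + id_blinfun (q0 X)) (at_right 0)"
      by (intro uniform_limit_add bl[OF app B uniform_limit_const bg bC] bl[OF app Blim q bq bid])
    then show ?thesis
    proof (rule uniform_limit_cong[THEN iffD1, rotated -1])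
      show "\<forall>\<^sub>F t in at_right 0. \<forall>X\<in>\<Gamma>. ((B t X - id_blinfun) /\<^sub>R t) (g X) + B t X (q t X) = (?y t X - g X) /\<^sub>R t"
        using pos by eventually_elim
          (simp add: blinfun.scaleR_left blinfun.diff_left blinfun.add_right blinfun.scaleR_right algebra_simps)
    qed simp
  qed
  have bCn: "bounded ((\<lambda>X. C X (n X)) ` \<Gamma>)" by (rule bounded_bilinear_image[OF app bC bn])
  have by': "bounded (?y' ` \<Gamma>)" by (intro bounded_add_image bounded_bilinear_image[OF app bC bg] bq)
  have \<nu>: "uniform_limit \<Gamma> ?\<nu> n (at_right 0)" by (rule uniform_limit_of_difference_quotient[OF N bCn])
  have y: "uniform_limit \<Gamma> ?y g (at_right 0)" by (rule uniform_limit_of_difference_quotient[OF Y by'])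
  let ?s = "\<lambda>X. C X (n X) \<bullet> g X + n X \<bullet> ?y' X"
  have S: "uniform_limit \<Gamma> (\<lambda>t X. (?\<nu> t X \<bullet> ?y t X) / t) ?s (at_right 0)"
  proof -
    have "uniform_limit \<Gamma> (\<lambda>t X. ((?\<nu> t X - n X) /\<^sub>R t) \<bullet> ?y t X + n X \<bullet> ((?y t X - g X) /\<^sub>R t)) ?s (at_right 0)"
      by (intro uniform_limit_add bl[OF inn N y bg bCn] bl[OF inn uniform_limit_const Y by' bn])
    then show ?thesis
    proof (rule uniform_limit_cong[THEN iffD1, rotated -1])
      show "\<forall>\<^sub>F t in at_right 0. \<forall>X\<in>\<Gamma>. ((?\<nu> t X - n X) /\<^sub>R t) \<bullet> ?y t X + n X \<bullet> ((?y t X - g X) /\<^sub>R t)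
          = (?\<nu> t X \<bullet> ?y t X) / t"
        using pos by eventually_elim (simp add: inner_diff_left inner_diff_right ng divide_inverse algebra_simps)
    qed simp
  qed
  have bs: "bounded (?s ` \<Gamma>)"
    by (intro bounded_add_image bounded_bilinear_image[OF inn bCn bg] bounded_bilinear_image[OF inn bn by'])
  have D: "uniform_limit \<Gamma> (\<lambda>t X. ?\<nu> t X \<bullet> ?\<nu> t X) (\<lambda>X. n X \<bullet> n X) (at_right 0)"
    by (rule bl[OF inn \<nu> \<nu> bn bn])
  have Q: "uniform_limit \<Gamma> (\<lambda>t X. ((?\<nu> t X \<bullet> ?y t X) / t) / (?\<nu> t X \<bullet> ?\<nu> t X)) (\<lambda>X. ?s X / (n X \<bullet> n X)) (at_right 0)"
    by (rule uniform_lim_divide[OF S D bs, of 1]) (simp_all add: dot_square_norm unit)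
  have Q': "uniform_limit \<Gamma> (\<lambda>t X. ((?\<nu> t X \<bullet> ?y t X) / t) / (?\<nu> t X \<bullet> ?\<nu> t X)) ?s (at_right 0)"
    using Q by (rule uniform_limit_cong'[THEN iffD1, rotated -1]) (simp_all add: dot_square_norm unit)
  have "uniform_limit \<Gamma> (\<lambda>t X. (?y t X - g X) /\<^sub>R t - (((?\<nu> t X \<bullet> ?y t X) / t) / (?\<nu> t X \<bullet> ?\<nu> t X)) *\<^sub>R ?\<nu> t X)
      (\<lambda>X. ?y' X - ?s X *\<^sub>R n X) (at_right 0)"
    by (intro uniform_limit_minus Y bl[OF scl Q' \<nu> bn bs])
  then show ?thesis
  proof (rule uniform_limit_cong'[THEN iffD1, rotated -1])
    fix t X
    have "(orth_part (?\<nu> t X) (?y t X) - g X) /\<^sub>R t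
        = (?y t X - g X) /\<^sub>R t - (inverse t * ((?\<nu> t X \<bullet> ?y t X) / (?\<nu> t X \<bullet> ?\<nu> t X))) *\<^sub>R ?\<nu> t X"
      unfolding orth_part_def scaleR_diff_right by (simp add: algebra_simps)
    also have "inverse t * ((?\<nu> t X \<bullet> ?y t X) / (?\<nu> t X \<bullet> ?\<nu> t X)) = ((?\<nu> t X \<bullet> ?y t X) / t) / (?\<nu> t X \<bullet> ?\<nu> t X)"
      by (simp add: divide_inverse mult_ac)
    finally show "(?y t X - g X) /\<^sub>R t - (((?\<nu> t X \<bullet> ?y t X) / t) / (?\<nu> t X \<bullet> ?\<nu> t X)) *\<^sub>R ?\<nu> t X
      = (orth_part (?\<nu> t X) (?y t X) - g X) /\<^sub>R t" by simp
  qed simp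
qed

lemma uniform_limit_tgrad:
  assumes dom: "Ck_domain 1 \<Omega>" and lim: "Ck_limit 1 (frontier \<Omega>) f f0 \<F>"
  shows "uniform_limit (frontier \<Omega>) (\<lambda>t. tgrad (frontier \<Omega>) (f t)) (tgrad (frontier \<Omega>) f0) \<F>"
proof -
  let ?\<Gamma> = "frontier \<Omega>"
  have f: "\<forall>\<^sub>F t in \<F>. Ck_boundary 1 ?\<Gamma> (f t)" and f0: "Ck_boundary 1 ?\<Gamma> f0"
    using lim by (auto simp: Ck_limit_def)
  have rep: "(\<Sum>b\<in>Basis. tderiv ?\<Gamma> h X b *\<^sub>R b) = tgrad ?\<Gamma> h X"
    if "Ck_boundary 1 ?\<Gamma> h" "X \<in> ?\<Gamma>" for h X
    using tgrad_inner_eq_tderiv[OF dom that(2,1)] euclidean_representation[of "tgrad ?\<Gamma> h X"] by simp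
  have "uniform_limit ?\<Gamma> (\<lambda>t X. \<Sum>b\<in>Basis. tderiv ?\<Gamma> (f t) X b *\<^sub>R b) (\<lambda>X. \<Sum>b\<in>Basis. tderiv ?\<Gamma> f0 X b *\<^sub>R b) \<F>"
  proof (rule uniform_limit_sum_family)
    fix b :: 'a assume b: "b \<in> Basis"
    have "uniform_limit ?\<Gamma> (\<lambda>t. tpartial ?\<Gamma> [b] (f t)) (tpartial ?\<Gamma> [b] f0) \<F>"
      using lim b unfolding Ck_limit_def by (elim conjE allE[of _ "[b]"]) simp
    then have "uniform_limit ?\<Gamma> (\<lambda>t X. tderiv ?\<Gamma> (f t) X b) (\<lambda>X. tderiv ?\<Gamma> f0 X b) \<F>" by simp
    from bounded_linear.uniform_limit[OF bounded_linear_scaleR_left this]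
    show "uniform_limit ?\<Gamma> (\<lambda>t X. tderiv ?\<Gamma> (f t) X b *\<^sub>R b) (\<lambda>X. tderiv ?\<Gamma> f0 X b *\<^sub>R b) \<F>" .
  qed
  then show ?thesis
  proof (rule uniform_limit_cong[THEN iffD1, rotated -1])
    show "\<forall>\<^sub>F t in \<F>. \<forall>X\<in>?\<Gamma>. (\<Sum>b\<in>Basis. tderiv ?\<Gamma> (f t) X b *\<^sub>R b) = tgrad ?\<Gamma> (f t) X"
      using f by eventually_elim (simp add: rep)
  qed (rule rep[OF f0])
qed

text \<open>The transport formula for the flow, with the expansion of its linear map. With \<open>J\<close> the inverse of the derivative \<open>M\<close> of
the flow, \<open>J - id = - J (M - id)\<close>; dividing by \<open>t\<close> and using \<open>J \<longlongrightarrow> id\<close> gives the limit \<open>- DV(0)\<close>, and the adjoint is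
continuous.\<close>

lemma flow_transport:
  fixes V :: "real \<Rightarrow> 'a::euclidean_space \<Rightarrow> 'a"
  assumes vf: "velocity_field 2 \<epsilon> D V" and "\<epsilon> > 0" and fl: "is_flow \<epsilon> V x" and dom: "Ck_domain 1 \<Omega>"
  defines "V' \<equiv> \<lambda>X. Blinfun (frechet_derivative (V 0) (at X))"
  obtains \<tau> B where "\<tau> > 0"
    "uniform_limit UNIV (\<lambda>t X. (B t X - id_blinfun) /\<^sub>R t) (\<lambda>X. - blinfun_adjoint (V' X)) (at_right 0)"
    "bounded (range (\<lambda>X. - blinfun_adjoint (V' X)))"
    "\<And>t f X. t \<in> {0..\<tau>} \<Longrightarrow> Ck_boundary 1 (frontier \<Omega>) (\<lambda>X. f (x t X)) \<Longrightarrow> X \<in> frontier \<Omega> \<Longrightarrow>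
       tgrad (x t ` frontier \<Omega>) f (x t X) =
         orth_part (B t X (outward_normal \<Omega> X)) (B t X (tgrad (frontier \<Omega>) (\<lambda>X. f (x t X)) X))"
    "\<And>t f. t \<in> {0..\<tau>} \<Longrightarrow> Ck_boundary 1 (frontier \<Omega>) (\<lambda>X. f (x t X)) \<Longrightarrow>
       continuous_on (frontier \<Omega>) (\<lambda>X. tgrad (x t ` frontier \<Omega>) f (x t X))"
proof -
  obtain \<tau> M where \<tau>: "\<tau> > 0"
    and M: "\<And>t. t \<in> {0..\<tau>} \<Longrightarrow> has_C1_derivative UNIV (x t) (M t)"
    "\<And>t X. t \<in> {0..\<tau>} \<Longrightarrow> norm (M t X - id_blinfun) \<le> 1/2"
    and Mlim: "uniform_limit UNIV (\<lambda>t X. (M t X - id_blinfun) /\<^sub>R t) V' (at_right 0)"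
    and bV': "bounded (range V')"
    using flow_near_identity[OF vf \<open>\<epsilon> > 0\<close> fl] unfolding V'_def by blast
  have "\<exists>S A'. (\<forall>X. S (x t X) = X) \<and> (\<forall>Y. x t (S Y) = Y) \<and> has_C1_derivative UNIV S A' \<and>
    (\<forall>X. A' (x t X) o\<^sub>L M t X = id_blinfun) \<and> (\<forall>X. M t X o\<^sub>L A' (x t X) = id_blinfun) \<and> (\<forall>Y. norm (A' Y) \<le> 2)"
    if "t \<in> {0..\<tau>}" for t
    by (rule near_identity_diffeomorphism[OF M(1)[OF that] M(2)[OF that]]) blast
  then obtain S A' where SA: "\<And>t X. t \<in> {0..\<tau>} \<Longrightarrow> S t (x t X) = X" "\<And>t Y. t \<in> {0..\<tau>} \<Longrightarrow> x t (S t Y) = Y"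
    "\<And>t. t \<in> {0..\<tau>} \<Longrightarrow> has_C1_derivative UNIV (S t) (A' t)"
    "\<And>t X. t \<in> {0..\<tau>} \<Longrightarrow> A' t (x t X) o\<^sub>L M t X = id_blinfun"
    "\<And>t Y. t \<in> {0..\<tau>} \<Longrightarrow> norm (A' t Y) \<le> 2"
    by metis
  have inj: "inj (blinfun_apply (blinfun_adjoint (A' t Y)))" if t: "t \<in> {0..\<tau>}" for t Y
  proof (rule injI)
    fix y1 y2 assume eq: "blinfun_adjoint (A' t Y) y1 = blinfun_adjoint (A' t Y) y2"
    have "A' t Y (M t (S t Y) h) = h" for h
      using arg_cong[OF SA(4)[OF t, of "S t Y"], of "\<lambda>f. blinfun_apply f h"] by (simp add: SA(2)[OF t])
    then have "y \<bullet> h = blinfun_adjoint (A' t Y) y \<bullet> M t (S t Y) h" for y h by (simp add: blinfun_adjoint_inner)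
    from this[of y1] this[of y2] have "\<forall>h. y1 \<bullet> h = y2 \<bullet> h" unfolding eq by metis
    then show "y1 = y2" by (rule vector_eq_rdot[THEN iffD1])
  qed
  have xc: "continuous_on UNIV (x t)" if "t \<in> {0..\<tau>}" for t
    by (rule Ck_on_1_continuous[OF Ck_on_1I[OF M(1)[OF that]]])
  let ?J = "\<lambda>t X. A' t (x t X)"
  let ?U = "\<lambda>t X. (M t X - id_blinfun) /\<^sub>R t"
  have small: "\<forall>\<^sub>F t in at_right 0. t \<in> {0<..\<tau>}"
    using \<tau> by (auto simp: eventually_at_right_field intro!: exI[of _ \<tau>])
  have Jlim: "uniform_limit UNIV ?J (\<lambda>X. id_blinfun) (at_right 0)"
  proof -
    have "uniform_limit UNIV M (\<lambda>X. id_blinfun) (at_right 0)"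
      by (rule uniform_limit_of_difference_quotient[OF Mlim bV'])
    then have "uniform_limit UNIV (\<lambda>t X. M t X - id_blinfun) (\<lambda>X. id_blinfun - id_blinfun) (at_right 0)"
      by (intro uniform_limit_minus uniform_limit_const)
    then have "uniform_limit UNIV (\<lambda>t X. 2 * norm (M t X - id_blinfun)) (\<lambda>X. 2 * norm (id_blinfun - id_blinfun :: 'a \<Rightarrow>\<^sub>L 'a)) (at_right 0)"
      by (intro bounded_linear.uniform_limit[OF bounded_linear_mult_right] uniform_limit_norm)
    then have "uniform_limit UNIV (\<lambda>t X. 2 * norm (M t X - id_blinfun)) (\<lambda>X. 0) (at_right 0)" by simp
    then have "uniform_limit UNIV (\<lambda>t X. ?J t X - id_blinfun) (\<lambda>X. 0) (at_right 0)"
    proof (rule uniform_limit_null_comparison[rotated])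
      show "\<forall>\<^sub>F t in at_right 0. \<forall>X\<in>UNIV. norm (?J t X - id_blinfun) \<le> 2 * norm (M t X - id_blinfun)"
        using small
      proof eventually_elim
        case (elim t)
        then have t: "t \<in> {0..\<tau>}" by simp
        have "norm (?J t X - id_blinfun) \<le> 2 * norm (M t X - id_blinfun)" for X
        proof -
          have "?J t X - id_blinfun = ?J t X o\<^sub>L (id_blinfun - M t X)"
            using SA(4)[OF t, of X] by (simp add: bounded_bilinear.diff_right[OF bounded_bilinear_blinfun_compose] blinfun_eqI)
          then have "norm (?J t X - id_blinfun) \<le> norm (?J t X) * norm (id_blinfun - M t X)"
            using norm_blinfun_compose by metis
          also have "\<dots> \<le> 2 * norm (id_blinfun - M t X)" by (intro mult_right_mono SA(5)[OF t]) simp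
          finally show ?thesis by (simp add: norm_minus_commute)
        qed
        then show ?case by blast
      qed
    qed
    then have "uniform_limit UNIV (\<lambda>t X. (?J t X - id_blinfun) + id_blinfun) (\<lambda>X. 0 + id_blinfun) (at_right 0)"
      by (intro uniform_limit_add uniform_limit_const)
    then show ?thesis by simp
  qed
  have bid: "bounded ((\<lambda>X. id_blinfun) ` (UNIV :: 'a set))" by (simp add: image_constant_conv)
  have "uniform_limit UNIV (\<lambda>t X. - blinfun_adjoint (?J t X o\<^sub>L ?U t X)) (\<lambda>X. - blinfun_adjoint (id_blinfun o\<^sub>L V' X)) (at_right 0)"
    by (intro uniform_limit_uminus bounded_linear.uniform_limit[OF bounded_linear_blinfun_adjoint]
        bounded_bilinear.bounded_uniform_limit[OF bounded_bilinear_blinfun_compose Jlim Mlim bV' bid])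
  then have Blim: "uniform_limit UNIV (\<lambda>t X. (blinfun_adjoint (?J t X) - id_blinfun) /\<^sub>R t) (\<lambda>X. - blinfun_adjoint (V' X)) (at_right 0)"
  proof (rule uniform_limit_cong[THEN iffD1, rotated -1])
    show "\<forall>\<^sub>F t in at_right 0. \<forall>X\<in>UNIV. - blinfun_adjoint (?J t X o\<^sub>L ?U t X) = (blinfun_adjoint (?J t X) - id_blinfun) /\<^sub>R t"
      using small
    proof eventually_elim
      case (elim t)
      then have t: "t \<in> {0..\<tau>}" by simp
      have "- blinfun_adjoint (?J t X o\<^sub>L ?U t X) = (blinfun_adjoint (?J t X) - id_blinfun) /\<^sub>R t" for X
      proof -
        have eq: "?J t X o\<^sub>L ?U t X = (id_blinfun - ?J t X) /\<^sub>R t"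
        proof (rule blinfun_eqI)
          fix h
          have "?J t X (M t X h) = h"
            using arg_cong[OF SA(4)[OF t, of X], of "\<lambda>f. blinfun_apply f h"] by simp
          then show "(?J t X o\<^sub>L ?U t X) h = ((id_blinfun - ?J t X) /\<^sub>R t) h"
            by (simp add: blinfun.scaleR_left blinfun.scaleR_right blinfun.diff_left blinfun.diff_right)
        qed
        have "linear (blinfun_adjoint :: ('a \<Rightarrow>\<^sub>L 'a) \<Rightarrow> _)" by (rule bounded_linear.linear[OF bounded_linear_blinfun_adjoint])
        then show ?thesis
          unfolding eq by (simp only: linear_diff linear_scale blinfun_adjoint_id scaleR_minus_right[symmetric] minus_diff_eq)
      qed
      then show ?case by blast
    qed
    show "- blinfun_adjoint (id_blinfun o\<^sub>L V' X) = - blinfun_adjoint (V' X)" for X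
      by (intro arg_cong[of _ _ "\<lambda>A. - blinfun_adjoint A"] blinfun_eqI) simp
  qed
  have "bounded ((\<lambda>X. - blinfun_adjoint (V' X)) ` UNIV)"
  proof -
    have "bounded ((\<lambda>A. - blinfun_adjoint A) ` range V')"
      by (intro bounded_linear_image bV' bounded_linear_minus bounded_linear_blinfun_adjoint)
    then show ?thesis by (simp add: image_image)
  qed
  show thesis
  proof (rule that[OF \<tau> Blim])
    show "bounded (range (\<lambda>X. - blinfun_adjoint (V' X)))" by fact
    fix t and f :: "'a \<Rightarrow> real"
    assume t: "t \<in> {0..\<tau>}" and f: "Ck_boundary 1 (frontier \<Omega>) (\<lambda>X. f (x t X))"
    note tr = xc[OF t] SA(1)[OF t] SA(2)[OF t] SA(3)[OF t] inj[OF t]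
    show "tgrad (x t ` frontier \<Omega>) f (x t X) =
         orth_part (blinfun_adjoint (?J t X) (outward_normal \<Omega> X)) (blinfun_adjoint (?J t X) (tgrad (frontier \<Omega>) (\<lambda>X. f (x t X)) X))"
      if "X \<in> frontier \<Omega>" for X
      by (rule tgrad_image[OF tr dom f that])
    have fr: "frontier (x t ` \<Omega>) = x t ` frontier \<Omega>" by (rule frontier_image[OF tr])
    have "continuous_on (x t ` frontier \<Omega>) (tgrad (x t ` frontier \<Omega>) f)"
      using continuous_on_tgrad[OF Ck_domain_image[OF tr dom], unfolded fr] Ck_boundary_image[OF tr dom f] by blast
    then show "continuous_on (frontier \<Omega>) (\<lambda>X. tgrad (x t ` frontier \<Omega>) f (x t X))"
      by (rule continuous_on_compose2[OF _ continuous_on_subset[OF tr(1)]]) auto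
  qed
qed

section \<open>The shape derivative of the tangential gradient\<close>

theorem theorem35:
  fixes D \<Omega> \<Gamma> :: "'a::euclidean_space set"
    and \<epsilon> :: real
    and V x :: "real \<Rightarrow> 'a \<Rightarrow> 'a"
    and z :: "'a set \<Rightarrow> 'a \<Rightarrow> real"
    and z' v\<^sub>n :: "'a \<Rightarrow> real"
    and n :: "'a \<Rightarrow> 'a"
  assumes "open D"
    and "Ck_domain 2 \<Omega>" and "\<Omega> \<subseteq> D"
    and "\<Gamma> = frontier \<Omega>"
    and "n = outward_normal \<Omega>"
    and "\<epsilon> > 0"
    and "velocity_field 2 \<epsilon> D V"
    and "is_flow \<epsilon> V x"
    and "v\<^sub>n = (\<lambda>X. V 0 X \<bullet> n X)"
    and "Ck_boundary 2 \<Gamma> (z \<Gamma>)"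
    and "has_shape_derivative 2 z \<Gamma> x (V 0) z'"
  shows "has_shape_derivative_vec 1 (\<lambda>\<Gamma>. tgrad \<Gamma> (z \<Gamma>)) \<Gamma> x (V 0)
           (\<lambda>X. tgrad \<Gamma> z' X
              + (outer (n X) (tgrad \<Gamma> v\<^sub>n X) (tgrad \<Gamma> (z \<Gamma>) X)
                 - v\<^sub>n X *\<^sub>R tderiv \<Gamma> n X (tgrad \<Gamma> (z \<Gamma>) X)))"
proof -
  note dom = \<open>Ck_domain 2 \<Omega>\<close>
  note dom1 = Ck_domain_2_imp_1[OF dom]
  note \<Gamma> = \<open>\<Gamma> = frontier \<Omega>\<close> and n = \<open>n = outward_normal \<Omega>\<close> and vn = \<open>v\<^sub>n = (\<lambda>X. V 0 X \<bullet> n X)\<close>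
  note z2 = \<open>Ck_boundary 2 \<Gamma> (z \<Gamma>)\<close>
  have comp: "compact \<Gamma>" unfolding \<Gamma> by (rule compact_frontier_Ck_domain[OF dom])
  define g where "g = tgrad \<Gamma> (z \<Gamma>)"
  define v where "v = V 0"
  \<comment> \<open>The difference quotient of \<open>z\<close> along the flow, so that \<open>z (x t ` \<Gamma>) \<circ> x t = z \<Gamma> + t f t\<close> on \<open>\<Gamma>\<close>.\<close>
  define f where "f t X = (z (x t ` \<Gamma>) (x t X) - z \<Gamma> X) /\<^sub>R t" for t X
  obtain zdot where lim: "Ck_limit 1 \<Gamma> f zdot (at_right 0)"
    and z'_eq: "\<And>X. X \<in> \<Gamma> \<Longrightarrow> z' X = zdot X - g X \<bullet> v X"
    using \<open>has_shape_derivative 2 z \<Gamma> x (V 0) z'\<close>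
    unfolding has_shape_derivative_def has_material_derivative_def g_def v_def f_def[abs_def] by auto
  obtain F U N W where U: "open U" "\<Gamma> \<subseteq> U" "Ck_on 2 U F" and F: "Ck_extension 1 \<Gamma> (z \<Gamma>) F"
    and N: "Ck_extension 1 \<Gamma> n N"
    and W_def: "W = (\<lambda>Y. gradient F Y - (N Y \<bullet> gradient F Y) *\<^sub>R N Y)"
    and W: "Ck_extension 1 \<Gamma> g W"
    by (rule tgrad_C1_extension[OF dom z2[unfolded \<Gamma>], folded \<Gamma> n, folded g_def])
  have z1: "Ck_boundary 1 \<Gamma> (z \<Gamma>)" using F by (auto simp: Ck_boundary_def)
  have g1: "Ck_boundary 1 \<Gamma> g" using W by (auto simp: Ck_boundary_def)
  have zdot1: "Ck_boundary 1 \<Gamma> zdot" and f1: "\<forall>\<^sub>F t in at_right 0. Ck_boundary 1 \<Gamma> (f t)"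
    using lim by (auto simp: Ck_limit_def)
  define q0 where "q0 = tgrad \<Gamma> zdot"
  have gc: "continuous_on \<Gamma> g" and q0c: "continuous_on \<Gamma> q0"
    unfolding g_def q0_def \<Gamma> using z1 zdot1 by (auto intro!: continuous_on_tgrad[OF dom1] simp: \<Gamma>)
  have bnd: "bounded (h ` \<Gamma>)" if "continuous_on \<Gamma> h" for h :: "'a \<Rightarrow> 'a"
    by (rule compact_imp_bounded[OF compact_continuous_image[OF that comp]])
  have unit: "norm (n X) = 1" if "X \<in> \<Gamma>" for X
    using outward_normal_unit[OF dom1] that by (simp add: n \<Gamma>)
  have ng: "n X \<bullet> g X = 0" if "X \<in> \<Gamma>" for X
    using tgrad_orthogonal[OF dom1 _ z1[unfolded \<Gamma>]] that by (simp add: n \<Gamma> g_def)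
  have nq: "n X \<bullet> q0 X = 0" if "X \<in> \<Gamma>" for X
    using tgrad_orthogonal[OF dom1 _ zdot1[unfolded \<Gamma>]] that by (simp add: n \<Gamma> q0_def)

  define v' where "v' X = Blinfun (frechet_derivative v (at X))" for X
  define E where "E X = blinfun_adjoint (v' X)" for X
  obtain \<tau> B where \<tau>: "\<tau> > 0"
    and B: "uniform_limit UNIV (\<lambda>t X. (B t X - id_blinfun) /\<^sub>R t) (\<lambda>X. - E X) (at_right 0)"
    and bE: "bounded (range (\<lambda>X. - E X))"
    and tr: "\<And>t h X. t \<in> {0..\<tau>} \<Longrightarrow> Ck_boundary 1 \<Gamma> (\<lambda>X. h (x t X)) \<Longrightarrow> X \<in> \<Gamma> \<Longrightarrow>
       tgrad (x t ` \<Gamma>) h (x t X) = orth_part (B t X (n X)) (B t X (tgrad \<Gamma> (\<lambda>X. h (x t X)) X))"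
    and trc: "\<And>t h. t \<in> {0..\<tau>} \<Longrightarrow> Ck_boundary 1 \<Gamma> (\<lambda>X. h (x t X)) \<Longrightarrow>
       continuous_on \<Gamma> (\<lambda>X. tgrad (x t ` \<Gamma>) h (x t X))"
    using flow_transport[OF \<open>velocity_field 2 \<epsilon> D V\<close> \<open>\<epsilon> > 0\<close> \<open>is_flow \<epsilon> V x\<close> dom1]
    unfolding \<Gamma> n E_def v'_def v_def by blast
  define w where "w t X = (tgrad (x t ` \<Gamma>) (z (x t ` \<Gamma>)) (x t X) - g X) /\<^sub>R t" for t X
  \<comment> \<open>The limit that the transport formula yields for the material derivative, with \<open>- E\<close> as the derivative of \<open>B\<close> at time \<open>0\<close>.\<close>
  define wdot where "wdot X = (- E X (g X) + q0 X) - (- E X (n X) \<bullet> g X + n X \<bullet> (- E X (g X) + q0 X)) *\<^sub>R n X" for X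

  have "\<forall>\<^sub>F t in at_right 0. t \<in> {0<..\<tau>}"
    using \<tau> by (auto simp: eventually_at_right_field intro!: exI[of _ \<tau>])
  then have good: "\<forall>\<^sub>F t in at_right 0. t \<in> {0<..\<tau>} \<and> Ck_boundary 1 \<Gamma> (f t)"
    using f1 by (rule eventually_conj)
  have moved: "Ck_boundary 1 \<Gamma> (\<lambda>X. z (x t ` \<Gamma>) (x t X))"
    "\<And>X. X \<in> \<Gamma> \<Longrightarrow> tgrad \<Gamma> (\<lambda>X. z (x t ` \<Gamma>) (x t X)) X = g X + t *\<^sub>R tgrad \<Gamma> (f t) X"
    if t: "t \<in> {0<..\<tau>}" and ft: "Ck_boundary 1 \<Gamma> (f t)" for t
  proof -
    have eq: "z \<Gamma> X + t *\<^sub>R f t X = z (x t ` \<Gamma>) (x t X)" for X using t by (simp add: f_def mult.assoc[symmetric])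
    obtain Z where Z: "Ck_extension 1 \<Gamma> (f t) Z" using ft by (auto simp: Ck_boundary_def)
    show "Ck_boundary 1 \<Gamma> (\<lambda>X. z (x t ` \<Gamma>) (x t X))"
      unfolding eq[symmetric] Ck_boundary_def using Ck_extension_add_scaleR[OF F Z] by blast
    show "tgrad \<Gamma> (\<lambda>X. z (x t ` \<Gamma>) (x t X)) X = g X + t *\<^sub>R tgrad \<Gamma> (f t) X" if "X \<in> \<Gamma>" for X
      using tgrad_add_scaleR[OF dom1 that[unfolded \<Gamma>] z1[unfolded \<Gamma>] ft[unfolded \<Gamma>], of t, folded \<Gamma>]
      unfolding eq g_def .
  qed
  have wlim: "uniform_limit \<Gamma> w wdot (at_right 0)"
  proof -
    have "uniform_limit \<Gamma> (\<lambda>t X. (orth_part (B t X (n X)) (B t X (g X + t *\<^sub>R tgrad \<Gamma> (f t) X)) - g X) /\<^sub>R t)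
      (\<lambda>X. ((- E X) (g X) + q0 X) - ((- E X) (n X) \<bullet> g X + n X \<bullet> ((- E X) (g X) + q0 X)) *\<^sub>R n X) (at_right 0)"
    proof (rule tangential_transport_limit)
      show "uniform_limit \<Gamma> (\<lambda>t X. (B t X - id_blinfun) /\<^sub>R t) (\<lambda>X. - E X) (at_right 0)"
        by (rule uniform_limit_on_subset[OF B]) simp
      show "uniform_limit \<Gamma> (\<lambda>t. tgrad \<Gamma> (f t)) q0 (at_right 0)"
        unfolding q0_def \<Gamma> by (rule uniform_limit_tgrad[OF dom1 lim[unfolded \<Gamma>]])
      show "bounded ((\<lambda>X. - E X) ` \<Gamma>)" by (rule bounded_subset[OF bE]) auto
    qed (use unit ng bnd gc q0c in auto)
    then show ?thesis
    proof (rule uniform_limit_cong[THEN iffD1, rotated -1])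
      show "\<forall>\<^sub>F t in at_right 0. \<forall>X\<in>\<Gamma>.
          (orth_part (B t X (n X)) (B t X (g X + t *\<^sub>R tgrad \<Gamma> (f t) X)) - g X) /\<^sub>R t = w t X"
        using good
      proof eventually_elim
        case (elim t)
        then have "t \<in> {0..\<tau>}" by simp
        then show ?case using tr[OF _ moved(1)] moved(2) elim by (auto simp: w_def)
      qed
    qed (simp add: wdot_def blinfun.minus_left)
  qed
  have wc: "\<forall>\<^sub>F t in at_right 0. continuous_on \<Gamma> (w t)"
    using good
  proof eventually_elim
    case (elim t)
    then have "t \<in> {0..\<tau>}" by simp
    then show ?case unfolding w_def using elim by (intro continuous_intros trc moved(1) gc) auto
  qed
  \<comment> \<open>As a uniform limit of continuous functions, \<open>wdot\<close> inherits its regularity from the quotients.\<close>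
  have wdotc: "continuous_on \<Gamma> wdot"
    by (rule uniform_limit_theorem[OF wc wlim]) simp
  have "has_material_derivative 1 (\<lambda>\<Gamma>. tgrad \<Gamma> (z \<Gamma>)) \<Gamma> x wdot"
    unfolding has_material_derivative_def Ck_limit_def
  proof (intro conjI)
    have closed: "closed \<Gamma>" using comp by (rule compact_imp_closed)
    show "Ck_boundary 1 \<Gamma> (tgrad \<Gamma> (z \<Gamma>))" using g1 by (simp add: g_def)
    show "\<forall>\<^sub>F t in at_right 0. Ck_boundary (1 - 1) \<Gamma>
        (\<lambda>X. (tgrad (x t ` \<Gamma>) (z (x t ` \<Gamma>)) (x t X) - tgrad \<Gamma> (z \<Gamma>) X) /\<^sub>R t)"
      using wc by eventually_elim (simp add: Ck_boundary_0[OF closed] w_def g_def)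
    show "Ck_boundary (1 - 1) \<Gamma> wdot" by (simp add: Ck_boundary_0[OF closed wdotc])
    show "\<forall>bs. set bs \<subseteq> Basis \<and> length bs \<le> 1 - 1 \<longrightarrow> uniform_limit \<Gamma>
        (\<lambda>t. tpartial \<Gamma> bs (\<lambda>X. (tgrad (x t ` \<Gamma>) (z (x t ` \<Gamma>)) (x t X) - tgrad \<Gamma> (z \<Gamma>) X) /\<^sub>R t))
        (tpartial \<Gamma> bs wdot) (at_right 0)"
      using wlim by (simp add: w_def[abs_def] g_def)
  qed simp
  moreover have "tgrad \<Gamma> z' X + (outer (n X) (tgrad \<Gamma> v\<^sub>n X) (tgrad \<Gamma> (z \<Gamma>) X)
      - v\<^sub>n X *\<^sub>R tderiv \<Gamma> n X (tgrad \<Gamma> (z \<Gamma>) X)) = wdot X - tderiv \<Gamma> (tgrad \<Gamma> (z \<Gamma>)) X (V 0 X)"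
    if X: "X \<in> \<Gamma>" for X
  proof (rule vector_eq_rdot[THEN iffD1], rule allI)
    fix h
    note X' = X[unfolded \<Gamma>]
    let ?P = "orth_part (n X)" and ?L = "tderiv \<Gamma> n X" and ?Dg = "tderiv \<Gamma> g X"
    have v1: "Ck_on 1 UNIV v"
    proof -
      have "Ck_on 2 UNIV (V 0)"
        using \<open>velocity_field 2 \<epsilon> D V\<close> \<open>\<epsilon> > 0\<close> by (auto simp: velocity_field_def Vspace_def)
      then show ?thesis unfolding v_def by (rule Ck_on_mono) auto
    qed
    have dv: "(v has_derivative v' X) (at X)"
      using has_C1_derivativeD(1)[OF Ck_on_1_canonical[OF v1]] by (simp add: v'_def)
    have ext: "Y \<in> \<Gamma> \<Longrightarrow> N Y = n Y" "Y \<in> \<Gamma> \<Longrightarrow> W Y = g Y" for Y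
      using N W by (auto simp: Ck_extension_def)
    let ?N' = "frechet_derivative N (at X)" and ?W' = "frechet_derivative W (at X)"
    note dN = Ck_extension_1_derivative[OF N X] and dW = Ck_extension_1_derivative[OF W X]
    have L: "?L k = ?N' (?P k)" for k
      using tderiv_extension[OF dom1 X' N[unfolded \<Gamma>]] by (simp add: \<Gamma> n)
    have Dg: "?Dg k = ?W' (?P k)" for k
      using tderiv_extension[OF dom1 X' W[unfolded \<Gamma>]] by (simp add: \<Gamma> n)
    have vn1: "Ck_boundary 1 \<Gamma> v\<^sub>n" and gv1: "Ck_boundary 1 \<Gamma> (\<lambda>X. g X \<bullet> v X)"
    proof -
      obtain U1 U2 where u: "open U1" "\<Gamma> \<subseteq> U1" "Ck_on 1 U1 N" "open U2" "\<Gamma> \<subseteq> U2" "Ck_on 1 U2 W"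
        using N W by (auto simp: Ck_extension_def)
      have c: "Ck_on 1 U1 (\<lambda>X. v X \<bullet> N X)" "Ck_on 1 U2 (\<lambda>X. W X \<bullet> v X)"
        by (intro Ck_on_1_inner u Ck_on_mono[OF v1] order_refl subset_UNIV)+
      have "Ck_extension 1 \<Gamma> v\<^sub>n (\<lambda>X. v X \<bullet> N X)"
        unfolding Ck_extension_def using u(1,2) c(1) by (intro conjI exI[of _ U1]) (auto simp: vn v_def ext)
      then show "Ck_boundary 1 \<Gamma> v\<^sub>n" unfolding Ck_boundary_def by blast
      have "Ck_extension 1 \<Gamma> (\<lambda>X. g X \<bullet> v X) (\<lambda>X. W X \<bullet> v X)"
        unfolding Ck_extension_def using u(4,5) c(2) by (intro conjI exI[of _ U2]) (auto simp: ext)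
      then show "Ck_boundary 1 \<Gamma> (\<lambda>X. g X \<bullet> v X)" unfolding Ck_boundary_def by blast
    qed
    have Dvn: "tderiv \<Gamma> v\<^sub>n X k = v X \<bullet> ?L k + v' X (?P k) \<bullet> n X" for k
    proof -
      have "((\<lambda>Y. v Y \<bullet> N Y) has_derivative (\<lambda>k. v X \<bullet> ?N' k + v' X k \<bullet> N X)) (at X)"
        by (intro has_derivative_inner dv dN)
      from tderiv_normal[OF dom1 X' vn1[unfolded \<Gamma>] this, of UNIV, folded \<Gamma> n] show ?thesis
        using ext X by (simp add: vn v_def L)
    qed
    have tz': "tgrad \<Gamma> z' X = q0 X - tgrad \<Gamma> (\<lambda>X. g X \<bullet> v X) X"
    proof -
      have eq: "z' Y = zdot Y + (-1) *\<^sub>R (g Y \<bullet> v Y)" if "Y \<in> \<Gamma>" for Y using z'_eq[OF that] by simp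
      then have "tgrad \<Gamma> z' = tgrad \<Gamma> (\<lambda>Y. zdot Y + (-1) *\<^sub>R (g Y \<bullet> v Y))" by (rule tgrad_cong)
      then show "tgrad \<Gamma> z' X = q0 X - tgrad \<Gamma> (\<lambda>X. g X \<bullet> v X) X"
        using tgrad_add_scaleR[OF dom1 X' zdot1[unfolded \<Gamma>] gv1[unfolded \<Gamma>], of "-1"]
        by (simp add: q0_def \<Gamma>)
    qed
    have Dgv: "tgrad \<Gamma> (\<lambda>X. g X \<bullet> v X) X \<bullet> k = g X \<bullet> v' X (?P k) + ?Dg k \<bullet> v X" for k
    proof -
      have "((\<lambda>Y. W Y \<bullet> v Y) has_derivative (\<lambda>k. W X \<bullet> v' X k + ?W' k \<bullet> v X)) (at X)"
        by (intro has_derivative_inner dv dW)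
      from tderiv_normal[OF dom1 X' gv1[unfolded \<Gamma>] this, of UNIV, folded \<Gamma> n]
      show ?thesis
        using ext X tgrad_inner_eq_tderiv[OF dom1 X' gv1[unfolded \<Gamma>], folded \<Gamma>] by (simp add: Dg)
    qed
    have tvn: "tgrad \<Gamma> v\<^sub>n X \<bullet> g X = v X \<bullet> ?L (g X) + v' X (g X) \<bullet> n X"
      using tgrad_inner_eq_tderiv[OF dom1 X' vn1[unfolded \<Gamma>]] Dvn[of "g X"] orth_part_id[OF ng[OF X]]
      by (simp add: \<Gamma>)
    \<comment> \<open>The adjoint of \<open>D\<^sub>\<Gamma>g\<close> comes from the product rule in \<open>z'\<close>, and \<open>D\<^sub>\<Gamma>g v\<close> from the definition of the shape derivative.\<close>
    have anti: "?Dg h \<bullet> v X - ?Dg (v X) \<bullet> h = (n X \<bullet> h) * (v X \<bullet> ?L (g X)) - (v X \<bullet> n X) * (?L (g X) \<bullet> h)"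
      using tderiv_tgrad_antisymmetric_part[OF dom X' z2[unfolded \<Gamma>], of h "v X"] by (simp add: \<Gamma> n g_def)
    have lhs: "(tgrad \<Gamma> z' X + (outer (n X) (tgrad \<Gamma> v\<^sub>n X) (g X) - v\<^sub>n X *\<^sub>R ?L (g X))) \<bullet> h
        = q0 X \<bullet> h - (g X \<bullet> v' X (?P h) + ?Dg h \<bullet> v X)
          + (v X \<bullet> ?L (g X) + v' X (g X) \<bullet> n X) * (n X \<bullet> h) - (v X \<bullet> n X) * (?L (g X) \<bullet> h)"
      by (simp only: tz' inner_add_left inner_diff_left inner_scaleR_left Dgv outer_def tvn)
         (simp add: vn v_def)
    have wd: "wdot X = q0 X - ?P (E X (g X)) + (v' X (g X) \<bullet> n X) *\<^sub>R n X"
      by (simp add: wdot_def orth_part_unit[OF unit[OF X]] E_def blinfun_adjoint_inner nq[OF X] inner_add_right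
          scaleR_add_left inner_commute[of "n X" "blinfun_apply (v' X) _"])
         (simp add: nq[OF X] algebra_simps)
    have rhs: "(wdot X - ?Dg (v X)) \<bullet> h
        = q0 X \<bullet> h - g X \<bullet> v' X (?P h) + (v' X (g X) \<bullet> n X) * (n X \<bullet> h) - ?Dg (v X) \<bullet> h"
      by (simp add: wd inner_add_left inner_diff_left orth_part_inner_swap E_def blinfun_adjoint_inner)
    show "(tgrad \<Gamma> z' X + (outer (n X) (tgrad \<Gamma> v\<^sub>n X) (tgrad \<Gamma> (z \<Gamma>) X)
      - v\<^sub>n X *\<^sub>R tderiv \<Gamma> n X (tgrad \<Gamma> (z \<Gamma>) X))) \<bullet> h = (wdot X - tderiv \<Gamma> (tgrad \<Gamma> (z \<Gamma>)) X (V 0 X)) \<bullet> h"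
      unfolding g_def[symmetric] v_def[symmetric] lhs rhs
      using anti by (simp add: algebra_simps)
  qed
  ultimately show ?thesis
    unfolding has_shape_derivative_vec_def by blast
qed

end
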